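(* Let $C_5^{3-}$ denote the $3$-graph on vertex set $\{1,2,3,4,5\}$ with edge set $\{\{1,2,3\},\{2,3,4\},\{3,4,5\},\{4,5,1\}\}$. Then the Turán density of $C_5^{3-}$ satisfies $$\pi(C_5^{3-})=\lim_{n\to\infty}\frac{\mathrm{ex}(n,C_5^{3-})}{\binom{n}{3}}=\frac14.$$
   Context: A $3$-graph is a collection of $3$-element subsets (edges) of a vertex set. For a $3$-graph $F$, $\mathrm{ex}(n,F)$ is the maximum number of edges in an $n$-vertex $3$-graph containing no copy of $F$ as a (not necessarily induced) subgraph, and $\pi(F)=\lim_{n\to\infty}\mathrm{ex}(n,F)/\binom{n}{3}$ (this limit exists). *)

theory Defs
  imports "HOL-Analysis.Analysis"
begin

type_synonym 'a hypergraph = "'a set \<times> 'a set set"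

definition three_graph :: "'a hypergraph \<Rightarrow> bool" where
  "three_graph G \<longleftrightarrow> (\<forall>e\<in>snd G. e \<subseteq> fst G \<and> card e = 3)"

definition contains_copy :: "'b hypergraph \<Rightarrow> 'a hypergraph \<Rightarrow> bool" where
  "contains_copy G F \<longleftrightarrow>
     (\<exists>\<phi>. inj_on \<phi> (fst F) \<and> \<phi> ` fst F \<subseteq> fst G \<and> (\<forall>e\<in>snd F. \<phi> ` e \<in> snd G))"

text \<open>Every finite 3-graph is isomorphic to one whose vertices are natural numbers, so hosts
  range over those. If \<open>F\<close> has an edge, the maximum is over a finite nonempty set.\<close>

definition free_sizes :: "nat \<Rightarrow> 'a hypergraph \<Rightarrow> nat set" where
  "free_sizes n F = {card (snd G) | G :: nat hypergraph.
     finite (fst G) \<and> card (fst G) = n \<and> three_graph G \<and> \<not> contains_copy G F}"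

definition ex_turan :: "nat \<Rightarrow> 'a hypergraph \<Rightarrow> nat" where
  "ex_turan n F = Max (free_sizes n F)"

definition turan_density :: "'a hypergraph \<Rightarrow> real" where
  "turan_density F = lim (\<lambda>n. real (ex_turan n F) / real (n choose 3))"

definition C5_minus :: "nat hypergraph" where
  "C5_minus = ({1,2,3,4,5}, {{1,2,3}, {2,3,4}, {3,4,5}, {4,5,1}})"

lemma three_graph_C5_minus: "three_graph C5_minus"
  by (simp add: three_graph_def C5_minus_def)

lemma finite_free_sizes: "finite (free_sizes n F)"
proof -
  have "card (snd G) \<le> n choose 3"
    if "finite (fst G)" "card (fst G) = n" "three_graph G" for G :: "nat hypergraph"
  proof -
    have "snd G \<subseteq> {e. e \<subseteq> fst G \<and> card e = 3}"
      using that by (auto simp: three_graph_def)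
    moreover have "finite {e. e \<subseteq> fst G \<and> card e = 3}"
      using that(1) by simp
    ultimately have "card (snd G) \<le> card {e. e \<subseteq> fst G \<and> card e = 3}"
      by (rule card_mono[rotated])
    then show ?thesis
      by (simp only: n_subsets[OF that(1)] that(2))
  qed
  then have "free_sizes n F \<subseteq> {..n choose 3}"
    by (auto simp: free_sizes_def)
  then show ?thesis
    using finite_subset by blast
qed

lemma free_sizes_nonempty:
  assumes "snd F \<noteq> {}"
  shows "free_sizes n F \<noteq> {}"
proof -
  let ?G = "({..<n}, {}) :: nat hypergraph"
  have "three_graph ?G"
    by (simp add: three_graph_def)
  moreover have "\<not> contains_copy ?G F"
    using assms by (simp add: contains_copy_def ex_in_conv[symmetric])
  ultimately have "card (snd ?G) \<in> free_sizes n F"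
    unfolding free_sizes_def by (intro CollectI exI[of _ ?G]) simp
  then show ?thesis
    by blast
qed

end

theory Submission
  imports Defs "HOL-Real_Asymp.Real_Asymp"
begin

text \<open>A 3-graph is treated as a symmetric relation \<open>E\<close>. Two copies of \<open>K\<^sub>4\<close> minus an edge with the same three
  leaves contain the cycle, so a cycle-free 3-graph has few such copies, and sampling reduces the upper bound to
  \<^emph>\<open>good\<close> relations: no homomorphic image of the cycle or of \<open>K\<^sub>4\<close> minus an edge. Let \<open>dens\<close> be their extremal
  density. In a nearly extremal good relation a flag-algebra certificate on six vertices yields an edge \<open>xyz\<close> whose
  links \<open>N(yz)\<close>, \<open>N(xz)\<close>, \<open>N(xy)\<close> almost cover the vertices, are almost equal in size and almost completely joined.
  Every vertex link is then concentrated between two of these classes, which partitions all vertices into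
  \<open>U\<^sub>1, U\<^sub>2, U\<^sub>3\<close>. Edges with exactly two vertices in one part are outnumbered by missing transversal triples, so the
  number of ordered edges is at most \<open>dens * (\<bar>U\<^sub>1\<bar>\<^sup>3 + \<bar>U\<^sub>2\<bar>\<^sup>3 + \<bar>U\<^sub>3\<bar>\<^sup>3) + 6 * \<bar>U\<^sub>1\<bar> * \<bar>U\<^sub>2\<bar> * \<bar>U\<^sub>3\<bar>\<close>,
  which forces \<open>dens \<le> 1/4\<close>. The iterated balanced blow-up of an edge gives the matching lower bound.\<close>

text \<open>The conjectured optimum repeats inside its own parts at every scale, so the proof keeps
  the unknown value \<open>dens\<close> and arrives at an inequality in which the parts again
  contribute \<open>dens\<close> times their cubes. Counts run over ordered tuples with repetition.
  Goodness excludes homomorphic images, hence is closed under pulling back along arbitrary maps: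
  blow-ups, clones and samples with repetition stay good, and both the density bound on subsets and
  the averaging of the certificate are exact, without lower-order errors. The certificate need not
  prove the sharp value; it only locates one edge with well-behaved links, and its strict slack
  absorbs the defect of a nearly extremal relation. Sampling stands in for a removal argument: n^3
  copies of \<open>K\<^sub>4\<close> minus an edge could still meet every edge, but a sample of
  fixed size m contains only about m^4/n of them.\<close>

definition good :: "('v \<Rightarrow> 'v \<Rightarrow> 'v \<Rightarrow> bool) \<Rightarrow> bool" where
  "good E \<longleftrightarrow> (\<forall>x y z. E x y z \<longrightarrow> E y x z \<and> E x z y) \<and> (\<forall>x y. \<not> E x x y) \<and>
     (\<forall>a b c d. E a b c \<longrightarrow> E a b d \<longrightarrow> \<not> E a c d) \<and>
     (\<forall>a b c d e. E a b c \<longrightarrow> E b c d \<longrightarrow> E c d e \<longrightarrow> \<not> E d e a)"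

section \<open>The certificate on six vertices\<close>

text \<open>The integer weights are a rounded solution of a semidefinite program. Summed over all ways to place six vertices,
  \<open>flag_term\<close> is the quantity that is to become negative for some edge, plus sums of squares
  (\<open>edge_square\<close>, rooted at an edge and a fourth vertex; \<open>pair_square\<close>, rooted at a pair) and multiples of the
  constraints on the number of edges inside \<open>V\<close> and inside \<open>N(xy) \<inter> N(yz)\<close>, at \<open>dens = 1/4\<close>. The dependence on
  \<open>dens\<close> is linear with coefficient \<open>slope_term\<close>. It remains to check the finitely many good relations on six points.\<close>

datatype ix = I0 | I1 | I2 | I3 | I4 | I5

datatype flag_kind = K0 | K1 | K2 | K3 | K4 | K5 | K6

text \<open>Position of a vertex p relative to a root edge ijk and a fourth root l, as seen from i:
  m says that p is in the class N(jk) of i, n that it is in another class, and s, t, u are the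
  triples of l and p with i, j, k. The rule is symmetric in t and u, that is, under exchange of j
  and k. K0 collects the positions of weight zero.\<close>

definition kind :: "bool \<Rightarrow> bool \<Rightarrow> bool \<Rightarrow> bool \<Rightarrow> bool \<Rightarrow> flag_kind" where
  "kind m n s t u = (if m then (if s then K5 else if t \<or> u then K4 else K1)
     else if n then (if s then K3 else K0)
     else if s then (if t \<or> u then K0 else K2) else if t \<and> u then K6 else K0)"

fun weight_a :: "flag_kind \<Rightarrow> int" where
  "weight_a K0 = 0" | "weight_a K1 = 9" | "weight_a K2 = 97" | "weight_a K3 = -15" | "weight_a K4 = 12" | "weight_a K5 = -24" | "weight_a K6 = 18"
fun weight_b :: "flag_kind \<Rightarrow> int" where
  "weight_b K0 = 0" | "weight_b K1 = -8" | "weight_b K2 = 30" | "weight_b K3 = 34" | "weight_b K4 = 16" | "weight_b K5 = 81" | "weight_b K6 = -37"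
fun weight_c :: "flag_kind \<Rightarrow> int" where
  "weight_c K0 = 0" | "weight_c K1 = 33" | "weight_c K2 = -15" | "weight_c K3 = -9" | "weight_c K4 = 66" | "weight_c K5 = 28" | "weight_c K6 = 61"

definition weight_form :: "flag_kind \<Rightarrow> flag_kind \<Rightarrow> int" where
  "weight_form a b = 149 * weight_a a * weight_a b + 1129 * weight_b a * weight_b b + 579 * weight_c a * weight_c b"

text \<open>The component that is invariant under permutations of the root edge. The flags m0, m1,
  m2 name the class of p; in a good relation at most one of them holds, which makes the nested
  conditionals symmetric.\<close>

definition orbit_weight :: "bool \<Rightarrow> bool \<Rightarrow> bool \<Rightarrow> bool \<Rightarrow> bool \<Rightarrow> bool \<Rightarrow> int" where
  "orbit_weight m0 m1 m2 s0 s1 s2 =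
    (if m0 then (if s0 then -39 else if s1 \<or> s2 then -10 else 46)
     else if m1 then (if s1 then -39 else if s0 \<or> s2 then -10 else 46)
     else if m2 then (if s2 then -39 else if s0 \<or> s1 then -10 else 46)
     else if s0 then (if s1 then (if s2 then -57 else -45) else if s2 then -45 else -29)
     else if s1 then (if s2 then -45 else -29) else if s2 then -29 else 17)"

text \<open>Polarised sum of the squares of the three differences a - b, a - c, b - c. The symmetric
  group of the root edge acts on the flags, and this is the part belonging to its two-dimensional
  standard representation; \<open>orbit_weight\<close> supplies the trivial one.\<close>

definition standard_form :: "flag_kind \<Rightarrow> flag_kind \<Rightarrow> flag_kind \<Rightarrow> flag_kind \<Rightarrow> flag_kind \<Rightarrow> flag_kind \<Rightarrow> int" where
  "standard_form a b c a' b' c' = 2 * (weight_form a a' + weight_form b b' + weight_form c c')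
      - (weight_form a b' + weight_form a c' + weight_form b a' + weight_form b c' + weight_form c a' + weight_form c b')"

definition edge_flag :: "('v \<Rightarrow> 'v \<Rightarrow> 'v \<Rightarrow> bool) \<Rightarrow> 'v \<Rightarrow> 'v \<Rightarrow> 'v \<Rightarrow> 'v \<Rightarrow> 'v \<Rightarrow> flag_kind" where
  "edge_flag E i j k l p = kind (E j k p) (E i k p \<or> E i j p) (E i l p) (E j l p) (E k l p)"

text \<open>The root type is four vertices spanning only the edge ijk; all other types contribute 0.
  The condition that ijk is an edge is imposed in \<open>flag_term\<close>.\<close>

definition edge_square :: "('v \<Rightarrow> 'v \<Rightarrow> 'v \<Rightarrow> bool) \<Rightarrow> 'v \<Rightarrow> 'v \<Rightarrow> 'v \<Rightarrow> 'v \<Rightarrow> 'v \<Rightarrow> 'v \<Rightarrow> int" where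
  "edge_square E i j k l p q = (if E i j l \<or> E i k l \<or> E j k l then 0 else
     standard_form (edge_flag E i j k l p) (edge_flag E j i k l p) (edge_flag E k i j l p) (edge_flag E i j k l q) (edge_flag E j i k l q) (edge_flag E k i j l q)
     + 1137 * orbit_weight (E j k p) (E i k p) (E i j p) (E i l p) (E j l p) (E k l p)
            * orbit_weight (E j k q) (E i k q) (E i j q) (E i l q) (E j l q) (E k l q))"

datatype vclass = C0 | C1 | C2 | C3

definition edge_class :: "('v \<Rightarrow> 'v \<Rightarrow> 'v \<Rightarrow> bool) \<Rightarrow> 'v \<Rightarrow> 'v \<Rightarrow> 'v \<Rightarrow> 'v \<Rightarrow> vclass" where
  "edge_class E i j k p = (if E j k p then C1 else if E i k p then C2 else if E i j p then C3 else C0)"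

text \<open>Integrand, at density 1/4, of the cubic form in \<open>objective_sum\<close>. Entries
  with C0 expand 4500 * (49 v0 - s) * (3 s - v0)^2, symmetrised over the three positions: 220500 =
  4500 * 49. On transversal triples -18225000 = -4500 * 900 * 27 / 6, and a missing one adds 4500 *
  27000 / 6.\<close>

definition objective :: "vclass \<Rightarrow> vclass \<Rightarrow> vclass \<Rightarrow> bool \<Rightarrow> int" where
  "objective a b c e =
    (if a = C0 then (if b = C0 then (if c = C0 then 220500 else -442500) else if c = C0 then -442500 else 670500)
     else if b = C0 then (if c = C0 then -442500 else 670500) else if c = C0 then 670500
     else 4009500 + (if a = b \<and> b = c then (if e then -12150000 else 4050000)
        else if a = b \<or> b = c \<or> a = c then 0 else if e then -18225000 else 2025000))"

definition two_links :: "('v \<Rightarrow> 'v \<Rightarrow> 'v \<Rightarrow> bool) \<Rightarrow> 'v \<Rightarrow> 'v \<Rightarrow> 'v \<Rightarrow> 'v \<Rightarrow> 'v \<Rightarrow> 'v \<Rightarrow> bool" where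
  "two_links E x y z p q r \<longleftrightarrow> E x y p \<and> E y z p \<and> E x y q \<and> E y z q \<and> E x y r \<and> E y z r"

text \<open>The constants combine three multipliers: 15138000 for the number of edges being near its
  maximum, 12564000 for the upper bound on edges inside V, and 32670000 for the bound inside two
  links. Thus 1930500 = 15138000 * 3/4 - 12564000 * 3/4, 14494500 = 15138000 * 3/4 + 12564000 / 4,
  -3784500 = -15138000 / 4, and 4383000 = 32670000 / 4 - 3784500.\<close>

definition flag_term :: "('v \<Rightarrow> 'v \<Rightarrow> 'v \<Rightarrow> bool) \<Rightarrow> 'v \<Rightarrow> 'v \<Rightarrow> 'v \<Rightarrow> 'v \<Rightarrow> 'v \<Rightarrow> 'v \<Rightarrow> int" where
  "flag_term E i j k l p q = (if E i j k then
       objective (edge_class E i j k l) (edge_class E i j k p) (edge_class E i j k q) (E l p q)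
       + 3 * (edge_square E i j k l p q + edge_square E i j k p l q + edge_square E i j k q l p)
       + (if E l p q then 1930500 else 14494500)
     else if two_links E i j k l p q \<or> two_links E j i k l p q \<or> two_links E i k j l p q then (if E l p q then -28287000 else 4383000)
     else -3784500)"

text \<open>Derivative of the integrand in the density: 16200000 = 4500 * 3600 from the cubes of the
  classes, -2574000 = 12564000 - 15138000 and 17532000 = 32670000 - 15138000.\<close>

definition slope_term :: "('v \<Rightarrow> 'v \<Rightarrow> 'v \<Rightarrow> bool) \<Rightarrow> 'v \<Rightarrow> 'v \<Rightarrow> 'v \<Rightarrow> 'v \<Rightarrow> 'v \<Rightarrow> 'v \<Rightarrow> int" where
  "slope_term E i j k l p q = (if E i j k then
       (if edge_class E i j k l \<noteq> C0 \<and> edge_class E i j k l = edge_class E i j k p \<and> edge_class E i j k p = edge_class E i j k q then 16200000 else 0) - 2574000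
     else if two_links E i j k l p q \<or> two_links E j i k l p q \<or> two_links E i k j l p q then 17532000
     else -15138000)"

datatype pair_kind = F0 | F1 | F2 | F3 | F4 | F5

definition pair_flag :: "('v \<Rightarrow> 'v \<Rightarrow> 'v \<Rightarrow> bool) \<Rightarrow> 'v \<Rightarrow> 'v \<Rightarrow> 'v \<Rightarrow> 'v \<Rightarrow> pair_kind" where
  "pair_flag E a b p q = (if E a p q then (if E b p q then F5 else if E a b p \<or> E a b q then F4 else F3)
     else if E b p q then (if E a b p \<or> E a b q then F4 else F3)
     else if E a b p then (if E a b q then F2 else F1) else if E a b q then F1 else F0)"

fun weight_d :: "pair_kind \<Rightarrow> int" where
  "weight_d F0 = 9" | "weight_d F1 = -35" | "weight_d F2 = 85" | "weight_d F3 = 7" | "weight_d F4 = -30" | "weight_d F5 = -3"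
fun weight_e :: "pair_kind \<Rightarrow> int" where
  "weight_e F0 = -29" | "weight_e F1 = -30" | "weight_e F2 = 2" | "weight_e F3 = 9" | "weight_e F4 = 24" | "weight_e F5 = 88"

definition pair_form :: "pair_kind \<Rightarrow> pair_kind \<Rightarrow> int" where
  "pair_form a b = 194 * weight_d a * weight_d b + 481 * weight_e a * weight_e b"

definition pair_square :: "('v \<Rightarrow> 'v \<Rightarrow> 'v \<Rightarrow> bool) \<Rightarrow> 'v \<Rightarrow> 'v \<Rightarrow> 'v \<Rightarrow> 'v \<Rightarrow> 'v \<Rightarrow> 'v \<Rightarrow> int" where
  "pair_square E a b c d e f = pair_form (pair_flag E a b c d) (pair_flag E a b e f) + pair_form (pair_flag E c d a b) (pair_flag E c d e f)
     + pair_form (pair_flag E e f a b) (pair_flag E e f c d)"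

text \<open>One term per choice of three roots among six points; the order inside each half is
  irrelevant by \<open>flag_term_swap\<close>.\<close>

definition sum20 :: "(ix \<Rightarrow> ix \<Rightarrow> ix \<Rightarrow> ix \<Rightarrow> ix \<Rightarrow> ix \<Rightarrow> int) \<Rightarrow> int" where
  "sum20 f = f I0 I1 I2 I3 I4 I5 + f I0 I1 I3 I2 I4 I5 + f I0 I1 I4 I2 I3 I5 + f I0 I1 I5 I2 I3 I4 + f I0 I2 I3 I1 I4 I5 + f I0 I2 I4 I1 I3 I5 + f I0 I2 I5 I1 I3 I4 + f I0 I3 I4 I1 I2 I5 + f I0 I3 I5 I1 I2 I4 + f I0 I4 I5 I1 I2 I3 + f I1 I2 I3 I0 I4 I5 + f I1 I2 I4 I0 I3 I5 + f I1 I2 I5 I0 I3 I4 + f I1 I3 I4 I0 I2 I5 + f I1 I3 I5 I0 I2 I4 + f I1 I4 I5 I0 I2 I3 + f I2 I3 I4 I0 I1 I5 + f I2 I3 I5 I0 I1 I4 + f I2 I4 I5 I0 I1 I3 + f I3 I4 I5 I0 I1 I2"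

text \<open>One term per perfect matching of the six points.\<close>

definition sum15 :: "(ix \<Rightarrow> ix \<Rightarrow> ix \<Rightarrow> ix \<Rightarrow> ix \<Rightarrow> ix \<Rightarrow> int) \<Rightarrow> int" where
  "sum15 f = f I0 I1 I2 I3 I4 I5 + f I0 I1 I2 I4 I3 I5 + f I0 I1 I2 I5 I3 I4 + f I0 I2 I1 I3 I4 I5 + f I0 I2 I1 I4 I3 I5 + f I0 I2 I1 I5 I3 I4 + f I0 I3 I1 I2 I4 I5 + f I0 I3 I1 I4 I2 I5 + f I0 I3 I1 I5 I2 I4 + f I0 I4 I1 I2 I3 I5 + f I0 I4 I1 I3 I2 I5 + f I0 I4 I1 I5 I2 I3 + f I0 I5 I1 I2 I3 I4 + f I0 I5 I1 I3 I2 I4 + f I0 I5 I1 I4 I2 I3"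

definition certificate :: "(ix \<Rightarrow> ix \<Rightarrow> ix \<Rightarrow> bool) \<Rightarrow> int" where
  "certificate e = sum20 (flag_term e) + 4 * sum15 (pair_square e)"

definition slope :: "(ix \<Rightarrow> ix \<Rightarrow> ix \<Rightarrow> bool) \<Rightarrow> int" where
  "slope e = sum20 (slope_term e)"

text \<open>Tabulated values, so that the evaluation by rewriting looks up numerals instead of
  multiplying.\<close>

lemma weight_form_code [code]:
  "weight_form K0 K0 = 0" "weight_form K0 K1 = 0" "weight_form K0 K2 = 0" "weight_form K0 K3 = 0" "weight_form K0 K4 = 0" "weight_form K0 K5 = 0" "weight_form K0 K6 = 0"
  "weight_form K1 K0 = 0" "weight_form K1 K1 = 714856" "weight_form K1 K2 = - 427488" "weight_form K1 K3 = - 499166" "weight_form K1 K4 = 1132642" "weight_form K1 K5 = - 228780" "weight_form K1 K6 = 1523849"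
  "weight_form K2 K0 = 0" "weight_form K2 K1 = - 427488" "weight_form K2 K2 = 2548316" "weight_form K2 K3 = 1012950" "weight_form K2 K4 = 142146" "weight_form K2 K5 = 2153418" "weight_form K2 K6 = - 1522821"
  "weight_form K3 K0 = 0" "weight_form K3 K1 = - 499166" "weight_form K3 K2 = 1012950" "weight_form K3 K3 = 1385548" "weight_form K3 K4 = 243430" "weight_form K3 K5 = 3016998" "weight_form K3 K6 = - 1778383"
  "weight_form K4 K0 = 0" "weight_form K4 K1 = 1132642" "weight_form K4 K2 = 142146" "weight_form K4 K3 = 243430" "weight_form K4 K4 = 2832604" "weight_form K4 K5 = 2490264" "weight_form K4 K6 = 1694870"
  "weight_form K5 K0 = 0" "weight_form K5 K1 = - 228780" "weight_form K5 K2 = 2153418" "weight_form K5 K3 = 3016998" "weight_form K5 K4 = 2490264" "weight_form K5 K5 = 7947129" "weight_form K5 K6 = - 2459049"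
  "weight_form K6 K0 = 0" "weight_form K6 K1 = 1523849" "weight_form K6 K2 = - 1522821" "weight_form K6 K3 = - 1778383" "weight_form K6 K4 = 1694870" "weight_form K6 K5 = - 2459049" "weight_form K6 K6 = 3748336"
  by (simp_all add: weight_form_def)

lemma pair_form_code [code]:
  "pair_form F0 F0 = 420235" "pair_form F0 F1 = 357360" "pair_form F0 F2 = 120512" "pair_form F0 F3 = - 113319" "pair_form F0 F4 = - 387156" "pair_form F0 F5 = - 1232750"
  "pair_form F1 F0 = 357360" "pair_form F1 F1 = 670550" "pair_form F1 F2 = - 606010" "pair_form F1 F3 = - 177400" "pair_form F1 F4 = - 142620" "pair_form F1 F5 = - 1249470"
  "pair_form F2 F0 = 120512" "pair_form F2 F1 = - 606010" "pair_form F2 F2 = 1403574" "pair_form F2 F3 = 124088" "pair_form F2 F4 = - 471612" "pair_form F2 F5 = 35186"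
  "pair_form F3 F0 = - 113319" "pair_form F3 F1 = - 177400" "pair_form F3 F2 = 124088" "pair_form F3 F3 = 48467" "pair_form F3 F4 = 63156" "pair_form F3 F5 = 376878"
  "pair_form F4 F0 = - 387156" "pair_form F4 F1 = - 142620" "pair_form F4 F2 = - 471612" "pair_form F4 F3 = 63156" "pair_form F4 F4 = 451656" "pair_form F4 F5 = 1033332"
  "pair_form F5 F0 = - 1232750" "pair_form F5 F1 = - 1249470" "pair_form F5 F2 = 35186" "pair_form F5 F3 = 376878" "pair_form F5 F4 = 1033332" "pair_form F5 F5 = 3726610"
  by (simp_all add: pair_form_def)

text \<open>Relations on six points are stored as nested tuples, which keeps their evaluation by rewriting cheap.\<close>

datatype 'a sextuple = Six 'a 'a 'a 'a 'a 'a
fun select :: "'a sextuple \<Rightarrow> ix \<Rightarrow> 'a" where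
 "select (Six a b c d e f) I0 = a" | "select (Six a b c d e f) I1 = b" | "select (Six a b c d e f) I2 = c"
| "select (Six a b c d e f) I3 = d" | "select (Six a b c d e f) I4 = e" | "select (Six a b c d e f) I5 = f"
definition lookup :: "bool sextuple sextuple sextuple \<Rightarrow> ix \<Rightarrow> ix \<Rightarrow> ix \<Rightarrow> bool" where "lookup g i j k = select (select (select g i) j) k"
definition table :: "bool \<Rightarrow> bool \<Rightarrow> bool \<Rightarrow> bool \<Rightarrow> bool \<Rightarrow> bool \<Rightarrow> bool \<Rightarrow> bool \<Rightarrow> bool \<Rightarrow> bool \<Rightarrow> bool \<Rightarrow> bool \<Rightarrow> bool \<Rightarrow> bool \<Rightarrow> bool \<Rightarrow> bool \<Rightarrow> bool \<Rightarrow> bool \<Rightarrow> bool \<Rightarrow> bool \<Rightarrow> bool sextuple sextuple sextuple" where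
  "table b012 b013 b014 b015 b023 b024 b025 b034 b035 b045 b123 b124 b125 b134 b135 b145 b234 b235 b245 b345 = Six
    (Six (Six False False False False False False) (Six False False b012 b013 b014 b015) (Six False b012 False b023 b024 b025) (Six False b013 b023 False b034 b035) (Six False b014 b024 b034 False b045) (Six False b015 b025 b035 b045 False))
    (Six (Six False False b012 b013 b014 b015) (Six False False False False False False) (Six b012 False False b123 b124 b125) (Six b013 False b123 False b134 b135) (Six b014 False b124 b134 False b145) (Six b015 False b125 b135 b145 False))
    (Six (Six False b012 False b023 b024 b025) (Six b012 False False b123 b124 b125) (Six False False False False False False) (Six b023 b123 False False b234 b235) (Six b024 b124 False b234 False b245) (Six b025 b125 False b235 b245 False))
    (Six (Six False b013 b023 False b034 b035) (Six b013 False b123 False b134 b135) (Six b023 b123 False False b234 b235) (Six False False False False False False) (Six b034 b134 b234 False False b345) (Six b035 b135 b235 False b345 False))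
    (Six (Six False b014 b024 b034 False b045) (Six b014 False b124 b134 False b145) (Six b024 b124 False b234 False b245) (Six b034 b134 b234 False False b345) (Six False False False False False False) (Six b045 b145 b245 b345 False False))
    (Six (Six False b015 b025 b035 b045 False) (Six b015 False b125 b135 b145 False) (Six b025 b125 False b235 b245 False) (Six b035 b135 b235 False b345 False) (Six b045 b145 b245 b345 False False) (Six False False False False False False))"

abbreviation table_of :: "(ix \<Rightarrow> ix \<Rightarrow> ix \<Rightarrow> bool) \<Rightarrow> bool sextuple sextuple sextuple" where
  "table_of e \<equiv> table (e I0 I1 I2) (e I0 I1 I3) (e I0 I1 I4) (e I0 I1 I5) (e I0 I2 I3) (e I0 I2 I4) (e I0 I2 I5) (e I0 I3 I4) (e I0 I3 I5) (e I0 I4 I5) (e I1 I2 I3) (e I1 I2 I4) (e I1 I2 I5) (e I1 I3 I4) (e I1 I3 I5) (e I1 I4 I5) (e I2 I3 I4) (e I2 I3 I5) (e I2 I4 I5) (e I3 I4 I5)"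

definition all_bool :: "(bool \<Rightarrow> bool) \<Rightarrow> bool" where "all_bool P \<longleftrightarrow> P True \<and> P False"
definition all_ix :: "(ix \<Rightarrow> bool) \<Rightarrow> bool" where
  "all_ix P \<longleftrightarrow> P I0 \<and> P I1 \<and> P I2 \<and> P I3 \<and> P I4 \<and> P I5"
definition C5_free_on_six :: "(ix \<Rightarrow> ix \<Rightarrow> ix \<Rightarrow> bool) \<Rightarrow> bool" where
  "C5_free_on_six e \<longleftrightarrow> all_ix (\<lambda>a. all_ix (\<lambda>b. all_ix (\<lambda>c. if e a b c then all_ix (\<lambda>d. if e b c d then all_ix (\<lambda>f. if e c d f then \<not> e d f a else True) else True) else True)))"
text \<open>At most two of the four triples of a 4-set are edges, written so that undecided triples
  are inspected as late as possible.\<close>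

definition K4_free_on_four :: "bool \<Rightarrow> bool \<Rightarrow> bool \<Rightarrow> bool \<Rightarrow> bool" where
  "K4_free_on_four r x y z \<longleftrightarrow> (if x then (if y then \<not> r \<and> \<not> z else z \<longrightarrow> \<not> r) else y \<and> z \<longrightarrow> \<not> r)"
definition check :: "bool sextuple sextuple sextuple \<Rightarrow> bool" where
  "check g \<longleftrightarrow> (if C5_free_on_six (lookup g) then certificate (lookup g) \<le> -28800 \<and> slope (lookup g) \<le> 0 else True)"
text \<open>The triples 012 and 013 are present, which forces 023 and 123 to be absent; the
  arguments are the triples through 4 that avoid 5. The triples through 5 are branched in an order
  that completes 4-sets early, so that most branches are pruned before the costly
  \<open>check\<close>.\<close>

definition check_extensions :: "bool \<Rightarrow> bool \<Rightarrow> bool \<Rightarrow> bool \<Rightarrow> bool \<Rightarrow> bool \<Rightarrow> bool" where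
  "check_extensions b014 b024 b034 b124 b134 b234 \<longleftrightarrow> all_bool (\<lambda>b015. all_bool (\<lambda>b025. all_bool (\<lambda>b125. if \<not> K4_free_on_four True b015 b025 b125 then True else all_bool (\<lambda>b035. all_bool (\<lambda>b135. if \<not> K4_free_on_four True b015 b035 b135 then True else all_bool (\<lambda>b235. if \<not> K4_free_on_four False b025 b035 b235 then True else if \<not> K4_free_on_four False b125 b135 b235 then True else all_bool (\<lambda>b045. all_bool (\<lambda>b145. if \<not> K4_free_on_four b014 b015 b045 b145 then True else all_bool (\<lambda>b245. if \<not> K4_free_on_four b024 b025 b045 b245 then True else if \<not> K4_free_on_four b124 b125 b145 b245 then True else all_bool (\<lambda>b345. if \<not> K4_free_on_four b034 b035 b045 b345 then True else if \<not> K4_free_on_four b134 b135 b145 b345 then True else if \<not> K4_free_on_four b234 b235 b245 b345 then True else check (table True True b014 b015 False b024 b025 b034 b035 b045 False b124 b125 b134 b135 b145 b234 b235 b245 b345)))))))))))"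

section \<open>Evaluation of the certificate on representative relations\<close>

lemma check_empty: "check (table False False False False False False False False False False False False False False False False False False False False)"
  by code_simp

lemma check_012: "check (table True False False False False False False False False False False False False False False False False False False False)"
  by code_simp

lemma check_012_345: "check (table True False False False False False False False False False False False False False False False False False False True)"
  by code_simp

lemma check_012_034: "check (table True False False False False False False True False False False False False False False False False False False False)"
  by code_simp

lemma check_012_034_135: "check (table True False False False False False False True False False False False False False True False False False False False)"
  by code_simp

lemma check_012_034_145: "check (table True False False False False False False True False False False False False False False True False False False False)"
  by code_simp

lemma check_012_034_235: "check (table True False False False False False False True False False False False False False False False False True False False)"
  by code_simp

lemma check_012_034_245: "check (table True False False False False False False True False False False False False False False False False False True False)"
  by code_simp

lemma check_012_034_135_245: "check (table True False False False False False False True False False False False False False True False False False True False)"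
  by code_simp

lemma check_012_034_145_235: "check (table True False False False False False False True False False False False False False False True False True False False)"
  by code_simp

text \<open>Together with the five that follow, this covers up to symmetry every way to attach a
  fifth point to the edges 012 and 013; \<open>share_pair_bound\<close> shows that no other way is
  left.\<close>

lemma check_extensions_0: "check_extensions False False False False False False"
  by code_simp

lemma check_extensions_1: "check_extensions True False False False False False"
  by code_simp

lemma check_extensions_2: "check_extensions False True False False False False"
  by code_simp

lemma check_extensions_4: "check_extensions False True True False False False"
  by code_simp

lemma check_extensions_8: "check_extensions False False False False False True"
  by code_simp

lemma check_extensions_9: "check_extensions True False False False False True"
  by code_simp

section \<open>Pullbacks and the symmetry of the certificate\<close>

lemma goodD:
  assumes "good E"
  shows good_sym1: "E x y z \<Longrightarrow> E y x z" and good_sym2: "E x y z \<Longrightarrow> E x z y"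
    and good_irr: "\<not> E x x y" "\<not> E x y x" "\<not> E y x x"
    and good_K4: "E a b c \<Longrightarrow> E a b d \<Longrightarrow> E a c d \<Longrightarrow> False"
    and good_C5: "E a b c \<Longrightarrow> E b c d \<Longrightarrow> E c d e \<Longrightarrow> E d e a \<Longrightarrow> False"
  using assms unfolding good_def by metis+

lemma good_commute:
  assumes "good E" shows "E x y z = E y x z" "E x y z = E x z y"
  using good_sym1[OF assms] good_sym2[OF assms] by blast+

text \<open>Pullback along a map that may identify points: isomorphism, blow-up, cloning and
  sampling are all instances.\<close>

definition reind :: "('u \<Rightarrow> 'u \<Rightarrow> 'u \<Rightarrow> bool) \<Rightarrow> ('v \<Rightarrow> 'u) \<Rightarrow> 'v \<Rightarrow> 'v \<Rightarrow> 'v \<Rightarrow> bool" where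
  "reind E t i j k = E (t i) (t j) (t k)"

lemma good_reind: "good E \<Longrightarrow> good (reind E t)"
  unfolding good_def reind_def by blast

lemma flag_term_reind: "flag_term (reind E t) i j k l p q = flag_term E (t i) (t j) (t k) (t l) (t p) (t q)"
  by (simp add: flag_term_def edge_square_def edge_flag_def edge_class_def two_links_def reind_def)

lemma slope_term_reind: "slope_term (reind E t) i j k l p q = slope_term E (t i) (t j) (t k) (t l) (t p) (t q)"
  by (simp add: slope_term_def edge_class_def two_links_def reind_def)

lemma pair_square_reind: "pair_square (reind E t) i j k l p q = pair_square E (t i) (t j) (t k) (t l) (t p) (t q)"
  unfolding pair_square_def pair_flag_def reind_def by (rule refl)

lemma weight_form_commute: "weight_form a b = weight_form b a"
  by (simp add: weight_form_def)

lemma pair_form_commute: "pair_form a b = pair_form b a"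
  by (simp add: pair_form_def)

text \<open>Permuting the root edge permutes the three flags. \<open>orbit_weight\<close> tests the
  classes by priority, so its symmetry depends on no vertex lying in two classes, which the
  exclusion of \<open>K\<^sub>4\<close> minus an edge guarantees when ijk is an edge.\<close>

lemma edge_square_swap:
  assumes "good E" "E i j k"
  shows "edge_square E j i k l p q = edge_square E i j k l p q" "edge_square E i k j l p q = edge_square E i j k l p q"
    "edge_square E i j k l q p = edge_square E i j k l p q"
proof -
  have flag_kind: "kind m n s t u = kind m n s u t" for m n s t u
    by (auto simp: kind_def)
  have o1: "orbit_weight m1 m0 m2 s1 s0 s2 = orbit_weight m0 m1 m2 s0 s1 s2" if "\<not> (m0 \<and> m1)" for m0 m1 m2 s0 s1 s2
    using that by (auto simp: orbit_weight_def)
  have o2: "orbit_weight m0 m2 m1 s0 s2 s1 = orbit_weight m0 m1 m2 s0 s1 s2" if "\<not> (m2 \<and> m1)" for m0 m1 m2 s0 s1 s2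
    using that by (auto simp: orbit_weight_def)
  have ex: "\<not> (E j k r \<and> E i k r)" "\<not> (E i k r \<and> E i j r)" "\<not> (E i j r \<and> E i k r)" for r
    using good_K4[OF assms(1), of k j i r] good_K4[OF assms(1), of i j k r] assms(2)
      good_commute[OF assms(1)] by metis+
  have s1: "standard_form b a c b' a' c' = standard_form a b c a' b' c'" for a b c a' b' c'
    by (simp add: standard_form_def)
  have s2: "standard_form a c b a' c' b' = standard_form a b c a' b' c'" for a b c a' b' c'
    by (simp add: standard_form_def)
  have s3: "standard_form a' b' c' a b c = standard_form a b c a' b' c'" for a b c a' b' c'
    by (simp add: standard_form_def weight_form_commute)
  have E: "E j i x = E i j x" "E k j x = E j k x" "E k i x = E i k x" for x
    using good_commute[OF assms(1)] by blast+
  have k1: "edge_flag E k j i l r = edge_flag E k i j l r" "edge_flag E i k j l r = edge_flag E i j k l r" "edge_flag E j k i l r = edge_flag E j i k l r" for r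
    unfolding edge_flag_def by (simp_all add: E flag_kind disj_commute)
  have p1: "orbit_weight (E i k r) (E j k r) m s1 s0 s2 = orbit_weight (E j k r) (E i k r) m s0 s1 s2" for r m s0 s1 s2
    by (rule o1[OF ex(1)])
  have p2: "orbit_weight m (E i j r) (E i k r) s0 s2 s1 = orbit_weight m (E i k r) (E i j r) s0 s1 s2" for r m s0 s1 s2
    by (rule o2[OF ex(3)])
  show "edge_square E j i k l p q = edge_square E i j k l p q"
    unfolding edge_square_def k1 by (simp add: E s1 disj_ac p1)
  show "edge_square E i k j l p q = edge_square E i j k l p q"
    unfolding edge_square_def k1 by (simp add: E s2 disj_ac p2)
  show "edge_square E i j k l q p = edge_square E i j k l p q"
    unfolding edge_square_def by (simp add: s3[of "edge_flag E i j k l q"] mult.commute mult.left_commute)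
qed

lemma objective_swap: "objective b a c e = objective a b c e" "objective a c b e = objective a b c e"
  by (auto simp: objective_def)

lemma two_links_swap:
  assumes "good E"
  shows "two_links E z y x p q r = two_links E x y z p q r" "two_links E x y z q p r = two_links E x y z p q r" "two_links E x y z p r q = two_links E x y z p q r"
  unfolding two_links_def using good_commute[OF assms] by blast+

lemma edge_class_swap:
  assumes "good E" "E i j k"
  shows "edge_class E j i k p = (case edge_class E i j k p of C1 \<Rightarrow> C2 | C2 \<Rightarrow> C1 | C3 \<Rightarrow> C3 | C0 \<Rightarrow> C0)"
    "edge_class E i k j p = (case edge_class E i j k p of C1 \<Rightarrow> C1 | C2 \<Rightarrow> C3 | C3 \<Rightarrow> C2 | C0 \<Rightarrow> C0)"
proof -
  have ex: "\<not> (E j k p \<and> E i k p)" "\<not> (E i k p \<and> E i j p)" "\<not> (E i j p \<and> E j k p)"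
    using good_K4[OF assms(1), of k j i p] good_K4[OF assms(1), of i j k p] good_K4[OF assms(1), of j i k p] assms(2)
      good_commute[OF assms(1)] by metis+
  have E: "E j i p = E i j p" "E k j p = E j k p"
    using good_commute[OF assms(1)] by blast+
  show "edge_class E j i k p = (case edge_class E i j k p of C1 \<Rightarrow> C2 | C2 \<Rightarrow> C1 | C3 \<Rightarrow> C3 | C0 \<Rightarrow> C0)"
    "edge_class E i k j p = (case edge_class E i j k p of C1 \<Rightarrow> C1 | C2 \<Rightarrow> C3 | C3 \<Rightarrow> C2 | C0 \<Rightarrow> C0)"
    using ex unfolding edge_class_def E by auto
qed

lemma objective_case:
  "objective (case a of C1 \<Rightarrow> C2 | C2 \<Rightarrow> C1 | C3 \<Rightarrow> C3 | C0 \<Rightarrow> C0) (case b of C1 \<Rightarrow> C2 | C2 \<Rightarrow> C1 | C3 \<Rightarrow> C3 | C0 \<Rightarrow> C0)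
     (case c of C1 \<Rightarrow> C2 | C2 \<Rightarrow> C1 | C3 \<Rightarrow> C3 | C0 \<Rightarrow> C0) e = objective a b c e"
  "objective (case a of C1 \<Rightarrow> C1 | C2 \<Rightarrow> C3 | C3 \<Rightarrow> C2 | C0 \<Rightarrow> C0) (case b of C1 \<Rightarrow> C1 | C2 \<Rightarrow> C3 | C3 \<Rightarrow> C2 | C0 \<Rightarrow> C0)
     (case c of C1 \<Rightarrow> C1 | C2 \<Rightarrow> C3 | C3 \<Rightarrow> C2 | C0 \<Rightarrow> C0) e = objective a b c e"
  by (cases a; cases b; cases c; simp add: objective_def)+

lemma flag_term_swap:
  assumes "good E"
  shows "flag_term E j i k l p q = flag_term E i j k l p q" "flag_term E i k j l p q = flag_term E i j k l p q"
    "flag_term E i j k p l q = flag_term E i j k l p q" "flag_term E i j k l q p = flag_term E i j k l p q"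
proof -
  note s = good_commute[OF assms]
  have e1: "E j i k = E i j k" "E i k j = E i j k" "E p l q = E l p q" "E l q p = E l p q"
    using s by blast+
  show "flag_term E j i k l p q = flag_term E i j k l p q"
    unfolding flag_term_def e1 using edge_square_swap(1)[OF assms] two_links_swap(1)[OF assms]
    by (auto simp: edge_class_swap(1)[OF assms] objective_case)
  show "flag_term E i k j l p q = flag_term E i j k l p q"
    unfolding flag_term_def e1 using edge_square_swap(2)[OF assms] two_links_swap(1)[OF assms]
    by (auto simp: edge_class_swap(2)[OF assms] objective_case)
  show "flag_term E i j k p l q = flag_term E i j k l p q"
    unfolding flag_term_def e1 two_links_swap(2)[OF assms, of _ _ _ p l q]
    using edge_square_swap(3)[OF assms] by (auto simp: objective_swap)
  show "flag_term E i j k l q p = flag_term E i j k l p q"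
    unfolding flag_term_def e1 two_links_swap(3)[OF assms, of _ _ _ l q p]
    using edge_square_swap(3)[OF assms] by (auto simp: objective_swap)
qed

lemma slope_term_swap:
  assumes "good E"
  shows "slope_term E j i k l p q = slope_term E i j k l p q" "slope_term E i k j l p q = slope_term E i j k l p q"
    "slope_term E i j k p l q = slope_term E i j k l p q" "slope_term E i j k l q p = slope_term E i j k l p q"
proof -
  note s = good_commute[OF assms]
  have e1: "E j i k = E i j k" "E i k j = E i j k"
    using s by blast+
  show "slope_term E j i k l p q = slope_term E i j k l p q"
    unfolding slope_term_def e1 using two_links_swap(1)[OF assms]
    by (auto simp: edge_class_swap(1)[OF assms] split: vclass.splits)
  show "slope_term E i k j l p q = slope_term E i j k l p q"
    unfolding slope_term_def e1 using two_links_swap(1)[OF assms]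
    by (auto simp: edge_class_swap(2)[OF assms] split: vclass.splits)
  show "slope_term E i j k p l q = slope_term E i j k l p q"
    unfolding slope_term_def e1 two_links_swap(2)[OF assms, of _ _ _ p l q] by auto
  show "slope_term E i j k l q p = slope_term E i j k l p q"
    unfolding slope_term_def e1 two_links_swap(3)[OF assms, of _ _ _ l q p] by auto
qed

lemma pair_flag_swap:
  assumes "good E"
  shows "pair_flag E b a p q = pair_flag E a b p q" "pair_flag E a b q p = pair_flag E a b p q"
proof -
  note s = good_commute[OF assms]
  have e1: "E b a x = E a b x" "E a q p = E a p q" "E b q p = E b p q" for x
    using s by blast+
  show "pair_flag E b a p q = pair_flag E a b p q" "pair_flag E a b q p = pair_flag E a b p q"
    unfolding pair_flag_def e1 by auto
qed

lemma pair_square_swap: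
  assumes "good E"
  shows "pair_square E b a c d e f = pair_square E a b c d e f" "pair_square E a b d c e f = pair_square E a b c d e f"
    "pair_square E a b c d f e = pair_square E a b c d e f" "pair_square E c d a b e f = pair_square E a b c d e f"
    "pair_square E a b e f c d = pair_square E a b c d e f"
proof -
  note f1 = pair_flag_swap(1)[OF assms] and f2 = pair_flag_swap(2)[OF assms]
  show "pair_square E b a c d e f = pair_square E a b c d e f"
    unfolding pair_square_def f1[of b a] f2[of _ _ b a] by (rule refl)
  show "pair_square E a b d c e f = pair_square E a b c d e f"
    unfolding pair_square_def f1[of d c] f2[of _ _ d c] by (rule refl)
  show "pair_square E a b c d f e = pair_square E a b c d e f"
    unfolding pair_square_def f1[of f e] f2[of _ _ f e] by (rule refl)
  show "pair_square E c d a b e f = pair_square E a b c d e f" "pair_square E a b e f c d = pair_square E a b c d e f"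
    unfolding pair_square_def by (simp_all add: pair_form_commute)
qed

lemma sum20_transpose:
  assumes "\<And>i j k l p q. f j i k l p q = f i j k l p q" "\<And>i j k l p q. f i k j l p q = f i j k l p q"
    "\<And>i j k l p q. f i j k p l q = f i j k l p q" "\<And>i j k l p q. f i j k l q p = f i j k l p q"
  shows "sum20 (\<lambda>i j k l p q. f (Transposition.transpose a b i) (Transposition.transpose a b j) (Transposition.transpose a b k)
     (Transposition.transpose a b l) (Transposition.transpose a b p) (Transposition.transpose a b q)) = sum20 f"
  by (cases a; cases b; simp add: sum20_def Transposition.transpose_def assms)

lemma sum15_transpose:
  assumes "\<And>i j k l p q. f j i k l p q = f i j k l p q" "\<And>i j k l p q. f i j l k p q = f i j k l p q"
    "\<And>i j k l p q. f i j k l q p = f i j k l p q" "\<And>i j k l p q. f k l i j p q = f i j k l p q"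
    "\<And>i j k l p q. f i j p q k l = f i j k l p q"
  shows "sum15 (\<lambda>i j k l p q. f (Transposition.transpose a b i) (Transposition.transpose a b j) (Transposition.transpose a b k)
     (Transposition.transpose a b l) (Transposition.transpose a b p) (Transposition.transpose a b q)) = sum15 f"
  by (cases a; cases b; simp add: sum15_def Transposition.transpose_def assms)

lemma certificate_transpose:
  assumes "good e"
  shows "certificate (reind e (Transposition.transpose a b)) = certificate e" "slope (reind e (Transposition.transpose a b)) = slope e"
  unfolding certificate_def slope_def flag_term_reind pair_square_reind slope_term_reind
  using sum20_transpose[of "flag_term e" a b, OF flag_term_swap[OF assms]] sum20_transpose[of "slope_term e" a b, OF slope_term_swap[OF assms]]
    sum15_transpose[of "pair_square e" a b, OF pair_square_swap[OF assms]] by simp_all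

lemma UNIV_ix: "(UNIV :: ix set) = {I0, I1, I2, I3, I4, I5}"
proof -
  have "x \<in> {I0, I1, I2, I3, I4, I5}" for x :: ix
    by (cases x) simp_all
  then show ?thesis by blast
qed

lemma finite_ix [simp]: "finite (A :: ix set)"
proof -
  have "finite (UNIV :: ix set)"
    by (simp add: UNIV_ix)
  then show ?thesis
    by (rule finite_subset[OF subset_UNIV])
qed

text \<open>Transpositions generate the permutations of six points. The relation is generalised in
  the induction because every step replaces it by a pullback.\<close>

lemma certificate_reind:
  assumes "bij t" "good e"
  shows "certificate (reind e t) = certificate e \<and> slope (reind e t) = slope e"
proof -
  have "t permutes UNIV"
    using bij_imp_permutes[OF assms(1)] by simp
  then have "\<forall>e. good e \<longrightarrow> certificate (reind e t) = certificate e \<and> slope (reind e t) = slope e"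
    using finite_ix[of UNIV]
  proof (induction t rule: permutes_induct)
    case id
    then show ?case by (simp add: reind_def[abs_def])
  next
    case (swap a b p)
    show ?case
    proof (intro allI impI)
      fix e :: "ix \<Rightarrow> ix \<Rightarrow> ix \<Rightarrow> bool"
      assume g: "good e"
      have "reind e (Transposition.transpose a b \<circ> p) = reind (reind e (Transposition.transpose a b)) p"
        by (simp add: reind_def[abs_def])
      then show "certificate (reind e (Transposition.transpose a b \<circ> p)) = certificate e \<and> slope (reind e (Transposition.transpose a b \<circ> p)) = slope e"
        using swap.IH good_reind[OF g, of "Transposition.transpose a b"] certificate_transpose[OF g, of a b] by auto
    qed
  qed
  then show ?thesis using assms(2) by blast
qed

section \<open>Reduction of all good relations on six points to the evaluated ones\<close>

lemma lookup_table:
  assumes "good e"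
  shows "e = lookup (table_of e)"
proof (intro ext)
  fix i j k
  have s: "e I1 I0 x = e I0 I1 x" "e I2 I0 x = e I0 I2 x" "e I3 I0 x = e I0 I3 x" "e I4 I0 x = e I0 I4 x" "e I5 I0 x = e I0 I5 x"
    "e I2 I1 x = e I1 I2 x" "e I3 I1 x = e I1 I3 x" "e I4 I1 x = e I1 I4 x" "e I5 I1 x = e I1 I5 x" "e I3 I2 x = e I2 I3 x"
    "e I4 I2 x = e I2 I4 x" "e I5 I2 x = e I2 I5 x" "e I4 I3 x = e I3 I4 x" "e I5 I3 x = e I3 I5 x" "e I5 I4 x = e I4 I5 x" for x
    using good_commute[OF assms] by blast+
  have t: "e x I1 I0 = e x I0 I1" "e x I2 I0 = e x I0 I2" "e x I3 I0 = e x I0 I3" "e x I4 I0 = e x I0 I4" "e x I5 I0 = e x I0 I5"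
    "e x I2 I1 = e x I1 I2" "e x I3 I1 = e x I1 I3" "e x I4 I1 = e x I1 I4" "e x I5 I1 = e x I1 I5" "e x I3 I2 = e x I2 I3"
    "e x I4 I2 = e x I2 I4" "e x I5 I2 = e x I2 I5" "e x I4 I3 = e x I3 I4" "e x I5 I3 = e x I3 I5" "e x I5 I4 = e x I4 I5" for x
    using good_commute[OF assms] by blast+
  show "e i j k = lookup (table_of e) i j k"
    by (cases i; cases j; cases k; simp add: lookup_def table_def good_irr[OF assms] s t)
qed

lemma all_ix_iff: "all_ix P \<longleftrightarrow> (\<forall>x. P x)"
  unfolding all_ix_def by (metis ix.exhaust)

lemma check_bound:
  assumes "good e" "check (table_of e)"
  shows "certificate e \<le> -28800 \<and> slope e \<le> 0"
proof -
  have "C5_free_on_six e"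
    unfolding C5_free_on_six_def all_ix_iff using good_C5[OF assms(1)] by auto
  then show ?thesis
    using assms(2) lookup_table[OF assms(1)] by (simp add: check_def)
qed

lemma K4_free_on_four_good:
  assumes "good e"
  shows "K4_free_on_four (e a b c) (e a b d) (e a c d) (e b c d)"
proof -
  note s = good_commute[OF assms]
  have "\<not> (e a b d \<and> e a c d \<and> e b c d)"
    using good_K4[OF assms, of d a b c] s by metis
  moreover have "\<not> (e a b c \<and> e a b d \<and> e a c d)"
    using good_K4[OF assms, of a b c d] by metis
  moreover have "\<not> (e a b c \<and> e a b d \<and> e b c d)"
    using good_K4[OF assms, of b a c d] s by metis
  moreover have "\<not> (e a b c \<and> e a c d \<and> e b c d)"
    using good_K4[OF assms, of c a b d] s by metis
  ultimately show ?thesis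
    unfolding K4_free_on_four_def by auto
qed

lemma all_bool_iff: "all_bool P \<longleftrightarrow> (\<forall>x. P x)"
  unfolding all_bool_def by (metis (full_types))

lemma if_not_imp: "(if \<not> A then True else B) = (A \<longrightarrow> B)"
  by simp

lemma check_extensions_bound:
  assumes g: "good e" and e: "e I0 I1 I2" "e I0 I1 I3"
    and x: "check_extensions (e I0 I1 I4) (e I0 I2 I4) (e I0 I3 I4) (e I1 I2 I4) (e I1 I3 I4) (e I2 I3 I4)"
  shows "certificate e \<le> -28800 \<and> slope e \<le> 0"
proof -
  note s = good_commute[OF g]
  have n: "\<not> e I0 I2 I3" "\<not> e I1 I2 I3"
    using good_K4[OF g, of I0 I1 I2 I3] good_K4[OF g, of I1 I0 I2 I3] e s by metis+
  note T = K4_free_on_four_good[OF g]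
  show ?thesis
    using x[unfolded check_extensions_def all_bool_iff if_not_imp, rule_format, of "e I0 I1 I5" "e I0 I2 I5" "e I1 I2 I5" "e I0 I3 I5" "e I1 I3 I5" "e I2 I3 I5" "e I0 I4 I5" "e I1 I4 I5" "e I2 I4 I5" "e I3 I4 I5"]
      T[of I0 I1 I2 I5] T[of I0 I1 I3 I5] T[of I0 I2 I3 I5] T[of I1 I2 I3 I5] T[of I0 I1 I4 I5]
      T[of I0 I2 I4 I5] T[of I1 I2 I4 I5] T[of I0 I3 I4 I5] T[of I1 I3 I4 I5] T[of I2 I3 I4 I5]
    by (intro check_bound[OF g]) (simp only: e n simp_thms if_True if_False)
qed

text \<open>The symmetries exchanging 0 with 1 and 2 with 3 preserve the two given edges. If 124 or
  134 is an edge, the forbidden configurations exclude both 024 and 034, so exchanging 0 and 1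
  removes the edges through 1, 4 and one of 2, 3; exchanging 2 and 3 then makes 034 imply 024. Six
  patterns at the point 4 remain.\<close>

lemma share_pair_bound:
  assumes g: "good e" and e: "e I0 I1 I2" "e I0 I1 I3"
  shows "certificate e \<le> -28800 \<and> slope e \<le> 0"
proof -
  have step: "certificate e \<le> -28800 \<and> slope e \<le> 0"
    if "good e" "e I0 I1 I2" "e I0 I1 I3" "\<not> e I1 I2 I4" "\<not> e I1 I3 I4" "e I0 I3 I4 \<longrightarrow> e I0 I2 I4"
    for e :: "ix \<Rightarrow> ix \<Rightarrow> ix \<Rightarrow> bool"
  proof -
    note g = that(1) and e = that(2,3)
    note s = good_commute[OF g] and K = good_K4[OF g] and C = good_C5[OF g]
    have a: "\<not> (e I0 I1 I4 \<and> e I0 I2 I4)"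
      using K[of I0 I1 I2 I4] e by blast
    have b: "\<not> (e I0 I2 I4 \<and> e I2 I3 I4)"
      using C[of I3 I1 I0 I2 I4] e s by metis
    show ?thesis
    proof (cases "e I0 I2 I4")
      case True
      then show ?thesis
        using check_extensions_bound[OF g e] a b that(4-6) check_extensions_2 check_extensions_4 by (cases "e I0 I3 I4") auto
    next
      case False
      then show ?thesis
        using check_extensions_bound[OF g e] that(4-6) check_extensions_0 check_extensions_1 check_extensions_8 check_extensions_9
        by (cases "e I0 I1 I4"; cases "e I2 I3 I4") auto
    qed
  qed
  have step2: "certificate e \<le> -28800 \<and> slope e \<le> 0"
    if "good e" "e I0 I1 I2" "e I0 I1 I3" "\<not> e I1 I2 I4" "\<not> e I1 I3 I4" for e :: "ix \<Rightarrow> ix \<Rightarrow> ix \<Rightarrow> bool"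
  proof (cases "e I0 I3 I4 \<longrightarrow> e I0 I2 I4")
    case True
    then show ?thesis using step[OF that] by blast
  next
    case False
    let ?e = "reind e (Transposition.transpose I2 I3)"
    have "certificate ?e \<le> -28800 \<and> slope ?e \<le> 0"
      using that False by (intro step good_reind[OF that(1)]) (auto simp: reind_def Transposition.transpose_def)
    then show ?thesis
      using certificate_transpose[OF that(1)] by simp
  qed
  show ?thesis
  proof (cases "e I1 I2 I4 \<or> e I1 I3 I4")
    case False
    then show ?thesis using step2[OF g e] by blast
  next
    case True
    note s = good_commute[OF g] and K = good_K4[OF g] and C = good_C5[OF g]
    have "\<not> (e I0 I2 I4 \<and> e I1 I2 I4)" "\<not> (e I0 I3 I4 \<and> e I1 I3 I4)"
      using K[of I2 I0 I1 I4] K[of I3 I0 I1 I4] e s by metis+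
    moreover have "\<not> (e I0 I2 I4 \<and> e I1 I3 I4)" "\<not> (e I0 I3 I4 \<and> e I1 I2 I4)"
      using C[of I4 I2 I0 I1 I3] C[of I4 I3 I0 I1 I2] e s by metis+
    ultimately have n: "\<not> e I0 I2 I4" "\<not> e I0 I3 I4"
      using True by blast+
    let ?e = "reind e (Transposition.transpose I0 I1)"
    have "certificate ?e \<le> -28800 \<and> slope ?e \<le> 0"
      using e n s(1) by (intro step2 good_reind[OF g]) (auto simp: reind_def Transposition.transpose_def)
    then show ?thesis
      using certificate_transpose[OF g] by simp
  qed
qed

lemma ex_perm:
  assumes "distinct [a, b, c, d, f]"
  obtains t :: "ix \<Rightarrow> ix" where "bij t" "t I0 = a" "t I1 = b" "t I2 = c" "t I3 = d" "t I4 = f"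
proof -
  have "card {a, b, c, d, f} = 5"
    using assms by simp
  moreover have "card (UNIV :: ix set) = 6"
    by (simp add: UNIV_ix)
  ultimately have "{a, b, c, d, f} \<noteq> UNIV"
    by auto
  then obtain x where x: "x \<notin> {a, b, c, d, f}"
    by blast
  define t where "t i = (case i of I0 \<Rightarrow> a | I1 \<Rightarrow> b | I2 \<Rightarrow> c | I3 \<Rightarrow> d | I4 \<Rightarrow> f | I5 \<Rightarrow> x)" for i
  have "inj t"
  proof (rule injI)
    fix i j assume "t i = t j"
    then show "i = j"
      using assms x by (cases i; cases j) (auto simp: t_def)
  qed
  then have "bij t"
    by (simp add: bij_def finite_UNIV_inj_surj)
  then show ?thesis
    by (rule that) (simp_all add: t_def)
qed

lemma disjoint_edges_bound:
  assumes g: "good e" and e: "e I0 I1 I2"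
    and d: "\<And>a b c d f. e a b c \<Longrightarrow> e a d f \<Longrightarrow> {b, c} = {d, f}"
  shows "certificate e \<le> -28800 \<and> slope e \<le> 0"
proof -
  note s = good_commute[OF g]
  have 0: "\<not> e I0 x y" if "{x, y} \<noteq> {I1, I2}" for x y
    using d[OF e, of x y] that by auto
  have 1: "\<not> e I1 x y" if "{x, y} \<noteq> {I0, I2}" for x y
    using d[of I1 I0 I2 x y] e s(1)[of I1 I0 I2] that by auto
  have 2: "\<not> e I2 x y" if "{x, y} \<noteq> {I0, I1}" for x y
    using d[of I2 I0 I1 x y] e s(1)[of I2 I0 I1] s(2)[of I0 I2 I1] that by auto
  show ?thesis
  proof (rule check_bound[OF g], cases "e I3 I4 I5")
    case True
    then show "check (table_of e)"
      using check_012_345 e by (simp add: 0 1 2 doubleton_eq_iff)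
  next
    case False
    then show "check (table_of e)"
      using check_012 e by (simp add: 0 1 2 doubleton_eq_iff)
  qed
qed

text \<open>As no two edges share a pair, a further edge must consist of 5, one of 1, 2 and one of
  3, 4. Two of these four triples can coexist only if they meet in 5 alone, which leaves seven
  patterns.\<close>

lemma linear_bound:
  assumes g: "good e" and e: "e I0 I1 I2" "e I0 I3 I4"
    and d: "\<And>a b c d. e a b c \<Longrightarrow> e a b d \<Longrightarrow> c = d"
  shows "certificate e \<le> -28800 \<and> slope e \<le> 0"
proof -
  note s = good_commute[OF g]
  have e': "e I0 I2 I1" "e I1 I2 I0" "e I0 I4 I3" "e I3 I4 I0"
    using e s by metis+
  have n: "\<not> e I0 I1 I3" "\<not> e I0 I1 I4" "\<not> e I0 I1 I5" "\<not> e I0 I2 I3" "\<not> e I0 I2 I4" "\<not> e I0 I2 I5"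
    "\<not> e I0 I3 I5" "\<not> e I0 I4 I5" "\<not> e I1 I2 I3" "\<not> e I1 I2 I4" "\<not> e I1 I2 I5" "\<not> e I3 I4 I5"
    using d[OF e(1)] d[OF e(2)] d[OF e'(1)] d[OF e'(2)] d[OF e'(3)] d[OF e'(4)] by blast+
  have m: "\<not> e I1 I3 I4" "\<not> e I2 I3 I4"
    using d[OF e'(4), of I1] d[OF e'(4), of I2] s(1)[of I3 I1 I4] s(2)[of I3 I4 I1] s(1)[of I3 I2 I4] s(2)[of I3 I4 I2]
    by auto
  have x: "\<not> (e I1 I3 I5 \<and> e I1 I4 I5)" "\<not> (e I1 I3 I5 \<and> e I2 I3 I5)" "\<not> (e I1 I4 I5 \<and> e I2 I4 I5)"
    "\<not> (e I2 I3 I5 \<and> e I2 I4 I5)"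
    using d[of I1 I5 I3 I4] d[of I3 I5 I1 I2] d[of I4 I5 I1 I2] d[of I2 I5 I3 I4]
      s(2)[of I1 I5 I3] s(2)[of I1 I5 I4] s(2)[of I2 I5 I3] s(2)[of I2 I5 I4]
      s(2)[of I3 I5 I1] s(1)[of I3 I1 I5] s(2)[of I3 I5 I2] s(1)[of I3 I2 I5]
      s(2)[of I4 I5 I1] s(1)[of I4 I1 I5] s(2)[of I4 I5 I2] s(1)[of I4 I2 I5] by auto
  show ?thesis
  proof (rule check_bound[OF g])
    show "check (table_of e)"
      using check_012_034 check_012_034_135 check_012_034_145 check_012_034_235 check_012_034_245
        check_012_034_135_245 check_012_034_145_235 x
      by (cases "e I1 I3 I5"; cases "e I1 I4 I5"; cases "e I2 I3 I5"; cases "e I2 I4 I5") (simp_all add: e n m)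
  qed
qed

text \<open>The cases follow the largest intersection of two distinct edges: two points, one point,
  none, or no edge at all. A permutation of the six points brings each case to its standard
  position.\<close>

theorem certificate_bound:
  assumes g: "good e"
  shows "certificate e \<le> -28800 \<and> slope e \<le> 0"
proof -
  note s = good_commute[OF g] and irr = good_irr[OF g]
  have dist: "a \<noteq> b \<and> a \<noteq> c \<and> b \<noteq> c" if "e a b c" for a b c
    using that irr by metis
  have ex1: "\<exists>f. f \<notin> {a, b, c, d}" for a b c d :: ix
  proof -
    have "card {a, b, c, d} \<le> 4"
      using card_length[of "[a, b, c, d]"] by simp
    moreover have "card (UNIV :: ix set) = 6"
      by (simp add: UNIV_ix)
    ultimately have "{a, b, c, d} \<noteq> UNIV"
      by auto
    then show ?thesis
      by blast
  qed
  consider (pair) a b c d where "e a b c" "e a b d" "c \<noteq> d"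
    | (one) a b c d f where "e a b c" "e a d f" "distinct [a, b, c, d, f]" "\<And>a b c d. e a b c \<Longrightarrow> e a b d \<Longrightarrow> c = d"
    | (disj) a b c where "e a b c" "\<And>a b c d f. e a b c \<Longrightarrow> e a d f \<Longrightarrow> {b, c} = {d, f}"
    | (empty) "\<And>a b c. \<not> e a b c"
  proof -
    have "\<exists>a b c d f. e a b c \<and> e a d f \<and> distinct [a, b, c, d, f]"
      if "\<forall>a b c d. e a b c \<longrightarrow> e a b d \<longrightarrow> c = d" "e a b c" "e a d f" "{b, c} \<noteq> {d, f}" for a b c d f
    proof -
      have "b \<noteq> d" "b \<noteq> f" "c \<noteq> d" "c \<noteq> f"
        using that s by blast+
      then have "distinct [a, b, c, d, f]"
        using dist[OF that(2)] dist[OF that(3)] by auto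
      then show ?thesis using that(2,3) by blast
    qed
    then show ?thesis using that by metis
  qed
  then show ?thesis
  proof cases
    case pair
    obtain f where f: "f \<notin> {a, b, c, d}" using ex1 by blast
    have "distinct [a, b, c, d, f]"
      using pair dist f by auto
    then obtain t where t: "bij t" "t I0 = a" "t I1 = b" "t I2 = c" "t I3 = d"
      by (rule ex_perm)
    have "certificate (reind e t) \<le> -28800 \<and> slope (reind e t) \<le> 0"
      using pair t by (intro share_pair_bound good_reind[OF g]) (simp_all add: reind_def)
    then show ?thesis using certificate_reind[OF t(1) g] by simp
  next
    case one
    obtain t where t: "bij t" "t I0 = a" "t I1 = b" "t I2 = c" "t I3 = d" "t I4 = f"
      using one(3) by (rule ex_perm)
    have "certificate (reind e t) \<le> -28800 \<and> slope (reind e t) \<le> 0"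
    proof (rule linear_bound[OF good_reind[OF g]])
      show "reind e t I0 I1 I2" "reind e t I0 I3 I4"
        using one t by (simp_all add: reind_def)
      show "c = d" if "reind e t a b c" "reind e t a b d" for a b c d
        using one(4)[of "t a" "t b" "t c" "t d"] that bij_is_inj[OF t(1)] unfolding reind_def by (simp add: inj_eq)
    qed
    then show ?thesis using certificate_reind[OF t(1) g] by simp
  next
    case disj
    obtain d where d: "d \<notin> {a, b, c, a}" using ex1 by blast
    obtain f where f: "f \<notin> {a, b, c, d}" using ex1 by blast
    have "distinct [a, b, c, d, f]"
      using dist[OF disj(1)] d f by auto
    then obtain t where t: "bij t" "t I0 = a" "t I1 = b" "t I2 = c"
      by (rule ex_perm)
    have "certificate (reind e t) \<le> -28800 \<and> slope (reind e t) \<le> 0"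
    proof (rule disjoint_edges_bound[OF good_reind[OF g]])
      show "reind e t I0 I1 I2"
        using disj t by (simp add: reind_def)
      show "{b, c} = {d, f}" if "reind e t a b c" "reind e t a d f" for a b c d f
        using disj(2)[of "t a" "t b" "t c" "t d" "t f"] that bij_is_inj[OF t(1)] unfolding reind_def
        by (simp add: doubleton_eq_iff inj_eq)
    qed
    then show ?thesis using certificate_reind[OF t(1) g] by simp
  next
    case empty
    show ?thesis
      using check_empty by (intro check_bound[OF g]) (simp add: empty)
  qed
qed

section \<open>Averaging the certificate\<close>

text \<open>The terms of \<open>sum20\<close> and \<open>sum15\<close> read the six coordinates in
  different orders; after this reindexing they all have the same total.\<close>

lemma sum_functions:
  fixes f :: "'a \<Rightarrow> 'a \<Rightarrow> 'a \<Rightarrow> 'a \<Rightarrow> 'a \<Rightarrow> 'a \<Rightarrow> real" and V :: "'a set"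
  assumes "finite V" "distinct [i0, i1, i2, i3, i4, i5]"
  shows "(\<Sum>x | range x \<subseteq> V. f (x i0) (x i1) (x i2) (x i3) (x i4) (x (i5 :: ix)))
     = (\<Sum>a\<in>V. \<Sum>b\<in>V. \<Sum>c\<in>V. \<Sum>d\<in>V. \<Sum>e\<in>V. \<Sum>g\<in>V. f a b c d e g)"
proof -
  define h :: "'a \<times> 'a \<times> 'a \<times> 'a \<times> 'a \<times> 'a \<Rightarrow> ix \<Rightarrow> 'a" where
    "h = (\<lambda>(a, b, c, d, e, g) i. if i = i0 then a else if i = i1 then b else if i = i2 then c
            else if i = i3 then d else if i = i4 then e else g)"
  have U: "x \<in> {i0, i1, i2, i3, i4, i5}" for x
  proof -
    have "card {i0, i1, i2, i3, i4, i5} = card (UNIV :: ix set)"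
      using assms(2) by (simp add: UNIV_ix)
    then have "{i0, i1, i2, i3, i4, i5} = (UNIV :: ix set)"
      by (intro card_subset_eq) simp_all
    then show ?thesis by auto
  qed
  have "bij_betw h (V \<times> V \<times> V \<times> V \<times> V \<times> V) {x. range x \<subseteq> V}"
  proof (rule bij_betw_byWitness[where f' = "\<lambda>x. (x i0, x i1, x i2, x i3, x i4, x i5)"])
    show "\<forall>a\<in>V \<times> V \<times> V \<times> V \<times> V \<times> V. (h a i0, h a i1, h a i2, h a i3, h a i4, h a i5) = a"
      using assms(2) by (auto simp: h_def)
    show "\<forall>x\<in>{x. range x \<subseteq> V}. h (x i0, x i1, x i2, x i3, x i4, x i5) = x"
      using U by (auto simp: h_def fun_eq_iff)
  qed (auto simp: h_def)
  then have "(\<Sum>x | range x \<subseteq> V. f (x i0) (x i1) (x i2) (x i3) (x i4) (x i5))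
    = (\<Sum>a\<in>V \<times> V \<times> V \<times> V \<times> V \<times> V. f (h a i0) (h a i1) (h a i2) (h a i3) (h a i4) (h a i5))"
    by (rule sum.reindex_bij_betw[symmetric])
  also have "\<dots> = (\<Sum>(a, b, c, d, e, g)\<in>V \<times> V \<times> V \<times> V \<times> V \<times> V. f a b c d e g)"
    using assms(2) by (intro sum.cong) (auto simp: h_def)
  also have "\<dots> = (\<Sum>a\<in>V. \<Sum>b\<in>V. \<Sum>c\<in>V. \<Sum>d\<in>V. \<Sum>e\<in>V. \<Sum>g\<in>V. f a b c d e g)"
    by (simp add: sum.cartesian_product)
  finally show ?thesis .
qed

lemma sum_prod2: "(\<Sum>p\<in>V. \<Sum>q\<in>V. k * f p * g q) = k * sum f V * sum g V" for k :: "'a :: comm_semiring_1"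
  unfolding mult.assoc sum_product unfolding sum_distrib_left ..

lemma sum_prod4:
  "(\<Sum>c\<in>V. \<Sum>d\<in>V. \<Sum>e\<in>V. \<Sum>f\<in>V. k * F c d * G e f) = k * (\<Sum>c\<in>V. \<Sum>d\<in>V. F c d) * (\<Sum>e\<in>V. \<Sum>f\<in>V. G e f)"
  for k :: "'a :: comm_semiring_1"
proof -
  have 1: "(\<Sum>e\<in>V. \<Sum>f\<in>V. x * G e f) = x * (\<Sum>e\<in>V. \<Sum>f\<in>V. G e f)" for x
    by (simp only: sum_distrib_left)
  have 2: "(\<Sum>c\<in>V. \<Sum>d\<in>V. k * F c d * r) = k * (\<Sum>c\<in>V. \<Sum>d\<in>V. F c d) * r" for r
    by (simp only: sum_distrib_left sum_distrib_right)
  show ?thesis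
    by (simp only: 1 2)
qed

lemma card_functions:
  assumes "finite (V :: 'a set)"
  shows "real (card {x :: ix \<Rightarrow> 'a. range x \<subseteq> V}) = real (card V) ^ 6"
  using sum_functions[OF assms, of I0 I1 I2 I3 I4 I5 "\<lambda>_ _ _ _ _ _. 1"]
  by (simp add: power_numeral_reduce)

abbreviation sum6 :: "'a set \<Rightarrow> ('a \<Rightarrow> 'a \<Rightarrow> 'a \<Rightarrow> 'a \<Rightarrow> 'a \<Rightarrow> 'a \<Rightarrow> real) \<Rightarrow> real" where
  "sum6 V f \<equiv> (\<Sum>a\<in>V. \<Sum>b\<in>V. \<Sum>c\<in>V. \<Sum>d\<in>V. \<Sum>e\<in>V. \<Sum>g\<in>V. f a b c d e g)"

text \<open>Every one of the n^6 maps from the six points into V pulls \<open>E\<close> back to a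
  good relation, so the pointwise bound can be summed with no correction for coinciding vertices.
  The factor 60 is 4 * 15.\<close>

lemma sum6_bound:
  fixes V :: "'a set"
  assumes V: "finite V" and g: "good E"
  shows "20 * sum6 V (\<lambda>i j k l p q. real_of_int (flag_term E i j k l p q)) + 60 * sum6 V (\<lambda>i j k l p q. real_of_int (pair_square E i j k l p q))
     \<le> - 28800 * real (card V) ^ 6"
    and "sum6 V (\<lambda>i j k l p q. real_of_int (slope_term E i j k l p q)) \<le> 0"
proof -
  let ?X = "{x :: ix \<Rightarrow> 'a. range x \<subseteq> V}"
  have sum20: "(\<Sum>x\<in>?X. real_of_int (sum20 (\<lambda>i j k l p q. f (x i) (x j) (x k) (x l) (x p) (x q))))
     = 20 * sum6 V (\<lambda>i j k l p q. real_of_int (f i j k l p q))" for f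
    unfolding sum20_def by (simp add: sum.distrib sum_functions[OF V, of _ _ _ _ _ _ "\<lambda>i j k l p q. real_of_int (f i j k l p q)"])
  have sum15: "(\<Sum>x\<in>?X. real_of_int (sum15 (\<lambda>i j k l p q. f (x i) (x j) (x k) (x l) (x p) (x q))))
     = 15 * sum6 V (\<lambda>i j k l p q. real_of_int (f i j k l p q))" for f
    unfolding sum15_def by (simp add: sum.distrib sum_functions[OF V, of _ _ _ _ _ _ "\<lambda>i j k l p q. real_of_int (f i j k l p q)"])
  have "(\<Sum>x\<in>?X. real_of_int (certificate (reind E x))) \<le> (\<Sum>x\<in>?X. - 28800)"
  proof (rule sum_mono)
    fix x
    show "real_of_int (certificate (reind E x)) \<le> - 28800"
      using certificate_bound[OF good_reind[OF g, of x]] by linarith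
  qed
  moreover have "(\<Sum>x\<in>?X. real_of_int (certificate (reind E x)))
     = (\<Sum>x\<in>?X. real_of_int (sum20 (\<lambda>i j k l p q. flag_term E (x i) (x j) (x k) (x l) (x p) (x q))))
     + 4 * (\<Sum>x\<in>?X. real_of_int (sum15 (\<lambda>i j k l p q. pair_square E (x i) (x j) (x k) (x l) (x p) (x q))))"
    unfolding certificate_def flag_term_reind[abs_def] pair_square_reind[abs_def] by (simp add: sum.distrib sum_distrib_left)
  ultimately show "20 * sum6 V (\<lambda>i j k l p q. real_of_int (flag_term E i j k l p q)) + 60 * sum6 V (\<lambda>i j k l p q. real_of_int (pair_square E i j k l p q))
     \<le> - 28800 * real (card V) ^ 6"
    unfolding sum20 sum15 by (simp add: card_functions[OF V])
  have "(\<Sum>x\<in>?X. real_of_int (slope (reind E x))) \<le> (\<Sum>x\<in>?X. 0)"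
  proof (rule sum_mono)
    fix x
    show "real_of_int (slope (reind E x)) \<le> 0"
      using certificate_bound[OF good_reind[OF g, of x]] by linarith
  qed
  then show "sum6 V (\<lambda>i j k l p q. real_of_int (slope_term E i j k l p q)) \<le> 0"
    unfolding slope_def slope_term_reind[abs_def] sum20 by simp
qed

section \<open>Non-negativity of the squares and existence of a core edge\<close>

text \<open>The three summands of \<open>pair_square\<close> differ by a renaming of the summation
  variables, and for fixed roots the form is a positive combination of two squares.\<close>

lemma pair_square_sum_nonneg:
  assumes "good E"
  shows "0 \<le> sum6 V (\<lambda>a b c d e f. real_of_int (pair_square E a b c d e f))"
proof -
  let ?h = "\<lambda>a b c d e f. real_of_int (pair_form (pair_flag E a b c d) (pair_flag E a b e f))"
  have pos: "0 \<le> sum6 V ?h"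
  proof (rule sum_nonneg, rule sum_nonneg)
    fix a b
    have "(\<Sum>c\<in>V. \<Sum>d\<in>V. \<Sum>e\<in>V. \<Sum>f\<in>V. ?h a b c d e f)
      = 194 * (\<Sum>c\<in>V. \<Sum>d\<in>V. real_of_int (weight_d (pair_flag E a b c d)))\<^sup>2 + 481 * (\<Sum>c\<in>V. \<Sum>d\<in>V. real_of_int (weight_e (pair_flag E a b c d)))\<^sup>2"
      unfolding pair_form_def of_int_add of_int_mult sum.distrib sum_prod4 by (simp add: power2_eq_square)
    also have "\<dots> \<ge> 0"
      by simp
    finally show "0 \<le> (\<Sum>c\<in>V. \<Sum>d\<in>V. \<Sum>e\<in>V. \<Sum>f\<in>V. ?h a b c d e f)" .
  qed
  have sw: "(\<Sum>a\<in>V. \<Sum>b\<in>V. \<Sum>c\<in>V. \<Sum>d\<in>V. g a b c d) = (\<Sum>c\<in>V. \<Sum>d\<in>V. \<Sum>a\<in>V. \<Sum>b\<in>V. g a b c d)" for g :: "'a \<Rightarrow> 'a \<Rightarrow> 'a \<Rightarrow> 'a \<Rightarrow> real"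
  proof -
    have "(\<Sum>a\<in>V. \<Sum>b\<in>V. h a b) = (\<Sum>x\<in>V \<times> V. h (fst x) (snd x))" for h :: "'a \<Rightarrow> 'a \<Rightarrow> real"
      by (simp add: sum.cartesian_product split_def)
    then show ?thesis
      by (simp only:) (rule sum.swap)
  qed
  have "sum6 V (\<lambda>a b c d e f. ?h c d a b e f) = sum6 V ?h"
    by (rule sw)
  moreover have "sum6 V (\<lambda>a b c d e f. ?h e f a b c d) = sum6 V ?h"
  proof -
    have "sum6 V (\<lambda>a b c d e f. ?h e f a b c d) = sum6 V (\<lambda>a b e f c d. ?h e f a b c d)"
      by (intro sum.cong refl sw)
    also have "\<dots> = sum6 V ?h"
      by (rule sw)
    finally show ?thesis .
  qed
  ultimately show ?thesis
    using pos by (simp add: pair_square_def sum.distrib)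
qed

lemma standard_form_sum:
  assumes "finite V"
  shows "(\<Sum>p\<in>V. \<Sum>q\<in>V. real_of_int (standard_form (a p) (b p) (c p) (a q) (b q) (c q)))
    = 149 * (((\<Sum>p\<in>V. weight_a (a p)) - (\<Sum>p\<in>V. weight_a (b p)))\<^sup>2 + ((\<Sum>p\<in>V. weight_a (a p)) - (\<Sum>p\<in>V. weight_a (c p)))\<^sup>2 + ((\<Sum>p\<in>V. weight_a (b p)) - (\<Sum>p\<in>V. weight_a (c p)))\<^sup>2)
    + 1129 * (((\<Sum>p\<in>V. weight_b (a p)) - (\<Sum>p\<in>V. weight_b (b p)))\<^sup>2 + ((\<Sum>p\<in>V. weight_b (a p)) - (\<Sum>p\<in>V. weight_b (c p)))\<^sup>2 + ((\<Sum>p\<in>V. weight_b (b p)) - (\<Sum>p\<in>V. weight_b (c p)))\<^sup>2)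
    + 579 * (((\<Sum>p\<in>V. weight_c (a p)) - (\<Sum>p\<in>V. weight_c (b p)))\<^sup>2 + ((\<Sum>p\<in>V. weight_c (a p)) - (\<Sum>p\<in>V. weight_c (c p)))\<^sup>2 + ((\<Sum>p\<in>V. weight_c (b p)) - (\<Sum>p\<in>V. weight_c (c p)))\<^sup>2)"
proof -
  have prod: "(\<Sum>p\<in>V. \<Sum>q\<in>V. real_of_int (k * f p * g q)) = k * real_of_int (\<Sum>p\<in>V. f p) * real_of_int (\<Sum>p\<in>V. g p)" for k f g
    unfolding of_int_mult sum_prod2 by simp
  have weight_form: "(\<Sum>p\<in>V. \<Sum>q\<in>V. real_of_int (weight_form (f p) (g q))) = 149 * real_of_int (\<Sum>p\<in>V. weight_a (f p)) * real_of_int (\<Sum>p\<in>V. weight_a (g p))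
     + 1129 * real_of_int (\<Sum>p\<in>V. weight_b (f p)) * real_of_int (\<Sum>p\<in>V. weight_b (g p)) + 579 * real_of_int (\<Sum>p\<in>V. weight_c (f p)) * real_of_int (\<Sum>p\<in>V. weight_c (g p))" for f g
    unfolding weight_form_def of_int_add sum.distrib prod by simp
  show ?thesis
    unfolding standard_form_def of_int_add of_int_diff of_int_mult sum.distrib sum_subtractf sum_distrib_left[symmetric] weight_form
    by (simp add: power2_eq_square algebra_simps)
qed

lemma edge_square_sum_nonneg:
  assumes "finite V"
  shows "0 \<le> (\<Sum>p\<in>V. \<Sum>q\<in>V. real_of_int (edge_square E i j k l p q))"
proof (cases "E i j l \<or> E i k l \<or> E j k l")
  case False
  let ?o = "\<lambda>p. orbit_weight (E j k p) (E i k p) (E i j p) (E i l p) (E j l p) (E k l p)"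
  have "(\<Sum>p\<in>V. \<Sum>q\<in>V. real_of_int (edge_square E i j k l p q))
    = (\<Sum>p\<in>V. \<Sum>q\<in>V. real_of_int (standard_form (edge_flag E i j k l p) (edge_flag E j i k l p) (edge_flag E k i j l p) (edge_flag E i j k l q) (edge_flag E j i k l q) (edge_flag E k i j l q)))
      + 1137 * (\<Sum>p\<in>V. real_of_int (?o p))\<^sup>2"
    using False unfolding edge_square_def of_int_add of_int_mult
    by (simp add: sum.distrib power2_eq_square sum_prod2)
  then show ?thesis
    unfolding standard_form_sum[OF assms] by simp
qed (simp add: edge_square_def)

lemma sum_prod3: "(\<Sum>p\<in>V. \<Sum>q\<in>V. \<Sum>r\<in>V. k * f p * g q * h r) = k * sum f V * sum g V * sum h V" for k :: "'a :: comm_semiring_1"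
proof -
  have "(\<Sum>p\<in>V. \<Sum>q\<in>V. \<Sum>r\<in>V. k * f p * g q * h r) = (\<Sum>p\<in>V. \<Sum>q\<in>V. (k * sum h V) * f p * g q)"
    by (simp add: sum_distrib_left sum_distrib_right mult_ac)
  then show ?thesis
    by (simp only: sum_prod2) (simp add: mult_ac)
qed

lemma sum_of_bool_filter:
  fixes f :: "'a \<Rightarrow> real"
  assumes "finite V"
  shows "(\<Sum>p\<in>V. of_bool (P p) * f p) = (\<Sum>p\<in>{p \<in> V. P p}. f p)"
  unfolding sum.inter_filter[OF assms] by (intro sum.cong) auto

definition nedge :: "('a \<Rightarrow> 'a \<Rightarrow> 'a \<Rightarrow> bool) \<Rightarrow> 'a set \<Rightarrow> real" where
  "nedge E W = (\<Sum>x\<in>W. \<Sum>y\<in>W. \<Sum>z\<in>W. of_bool (E x y z))"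

text \<open>Written in class indicators, the integrand is a combination of products of one function
  per variable, so the sums factor. The last summand is (50 v0 - n) * (4 s - n)^2 with n = v0 + s,
  which keeps the expression homogeneous of degree three; it is negative enough to matter only when
  few vertices are uncovered.\<close>

lemma objective_sum:
  fixes c :: "'a \<Rightarrow> vclass" and V :: "'a set" and lam :: real
  assumes V: "finite V" and g: "good e"
  defines "W \<equiv> \<lambda>k. {p \<in> V. c p = k}"
  defines "v \<equiv> \<lambda>k. real (card (W k))"
  shows "(\<Sum>l\<in>V. \<Sum>p\<in>V. \<Sum>q\<in>V. real_of_int (objective (c l) (c p) (c q) (e l p q))
        + (lam - 1/4) * (16200000 * of_bool (c l \<noteq> C0 \<and> c l = c p \<and> c p = c q)))
     = 4500 * (27000 * (\<Sum>x\<in>W C1. \<Sum>y\<in>W C2. \<Sum>z\<in>W C3. of_bool (\<not> e x y z))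
       + 900 * ((v C1 + v C2 + v C3) ^ 3 - 27 * v C1 * v C2 * v C3)
       + 3600 * ((lam * v C1 ^ 3 - nedge e (W C1)) + (lam * v C2 ^ 3 - nedge e (W C2)) + (lam * v C3 ^ 3 - nedge e (W C3)))
       + (49 * v C0 - (v C1 + v C2 + v C3)) * (3 * (v C1 + v C2 + v C3) - v C0)\<^sup>2)"
proof -
  define d where "d k p = (of_bool (c p = k) :: real)" for k p
  have sd: "sum (d k) V = v k" for k
  proof -
    have "sum (d k) V = (\<Sum>p\<in>V. of_bool (c p = k) * 1)"
      by (simp add: d_def)
    also have "\<dots> = v k"
      unfolding sum_of_bool_filter[OF V] by (simp add: v_def W_def)
    finally show ?thesis .
  qed
  define X where "X i j k = (\<Sum>l\<in>V. \<Sum>p\<in>V. \<Sum>q\<in>V. d i l * d j p * d k q * of_bool (e l p q))" for i j k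
  have X12: "X j i k = X i j k" for i j k
  proof -
    have "X j i k = (\<Sum>p\<in>V. \<Sum>l\<in>V. \<Sum>q\<in>V. d j l * d i p * d k q * of_bool (e l p q))"
      unfolding X_def by (rule sum.swap)
    then show ?thesis
      unfolding X_def using good_commute(1)[OF g] by (simp add: mult_ac)
  qed
  have X23: "X i k j = X i j k" for i j k
  proof -
    have "X i k j = (\<Sum>l\<in>V. \<Sum>q\<in>V. \<Sum>p\<in>V. d i l * d k p * d j q * of_bool (e l p q))"
      unfolding X_def by (intro sum.cong refl sum.swap)
    then show ?thesis
      unfolding X_def using good_commute(2)[OF g] by (simp add: mult_ac)
  qed
  have Xeq: "X i j k = (\<Sum>x\<in>W i. \<Sum>y\<in>W j. \<Sum>z\<in>W k. of_bool (e x y z))" for i j k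
    unfolding X_def d_def W_def
    by (simp add: sum_of_bool_filter[OF V] sum_distrib_left[symmetric] mult.assoc)
  have M: "(\<Sum>x\<in>W C1. \<Sum>y\<in>W C2. \<Sum>z\<in>W C3. of_bool (\<not> e x y z)) = v C1 * v C2 * v C3 - X C1 C2 C3"
    unfolding Xeq by (simp add: of_bool_not_iff sum_subtractf v_def)
  let ?a = "\<lambda>p. 49 * d C0 p - (d C1 p + d C2 p + d C3 p)"
  let ?b = "\<lambda>p. 3 * (d C1 p + d C2 p + d C3 p) - d C0 p"
  let ?z = "\<lambda>p. d C1 p + d C2 p + d C3 p"
  let ?t = "\<lambda>i j k l p q. d i l * d j p * d k q * of_bool (e l p q)"
  have pt: "real_of_int (objective (c l) (c p) (c q) (e l p q))
        + (lam - 1/4) * (16200000 * of_bool (c l \<noteq> C0 \<and> c l = c p \<and> c p = c q))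
    = 4050000 * ?z l * ?z p * ?z q
      + 16200000 * lam * d C1 l * d C1 p * d C1 q + 16200000 * lam * d C2 l * d C2 p * d C2 q + 16200000 * lam * d C3 l * d C3 p * d C3 q
      - 16200000 * (?t C1 C1 C1 l p q + ?t C2 C2 C2 l p q + ?t C3 C3 C3 l p q)
      + 2025000 * d C1 l * d C2 p * d C3 q + 2025000 * d C1 l * d C3 p * d C2 q + 2025000 * d C2 l * d C1 p * d C3 q
      + 2025000 * d C2 l * d C3 p * d C1 q + 2025000 * d C3 l * d C1 p * d C2 q + 2025000 * d C3 l * d C2 p * d C1 q
      - 20250000 * (?t C1 C2 C3 l p q + ?t C1 C3 C2 l p q + ?t C2 C1 C3 l p q + ?t C2 C3 C1 l p q + ?t C3 C1 C2 l p q + ?t C3 C2 C1 l p q)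
      + 1500 * ?a l * ?b p * ?b q + 1500 * ?b l * ?a p * ?b q + 1500 * ?b l * ?b p * ?a q" for l p q
    by (cases "c l"; cases "c p"; cases "c q"; cases "e l p q"; simp add: d_def objective_def)
  have slope: "sum ?z V = v C1 + v C2 + v C3"
    by (simp add: sum.distrib sd)
  have sa: "sum ?a V = 49 * v C0 - (v C1 + v C2 + v C3)"
    by (simp add: sum.distrib sum_subtractf sum_distrib_left[symmetric] sd)
  have sb: "sum ?b V = 3 * (v C1 + v C2 + v C3) - v C0"
    by (simp add: sum.distrib sum_subtractf sum_distrib_left[symmetric] sd)
  have "(\<Sum>l\<in>V. \<Sum>p\<in>V. \<Sum>q\<in>V. real_of_int (objective (c l) (c p) (c q) (e l p q))
        + (lam - 1/4) * (16200000 * of_bool (c l \<noteq> C0 \<and> c l = c p \<and> c p = c q)))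
     = 4050000 * (v C1 + v C2 + v C3) * (v C1 + v C2 + v C3) * (v C1 + v C2 + v C3)
      + 16200000 * lam * v C1 * v C1 * v C1 + 16200000 * lam * v C2 * v C2 * v C2 + 16200000 * lam * v C3 * v C3 * v C3
      - 16200000 * (X C1 C1 C1 + X C2 C2 C2 + X C3 C3 C3)
      + 2025000 * v C1 * v C2 * v C3 + 2025000 * v C1 * v C3 * v C2 + 2025000 * v C2 * v C1 * v C3
      + 2025000 * v C2 * v C3 * v C1 + 2025000 * v C3 * v C1 * v C2 + 2025000 * v C3 * v C2 * v C1
      - 20250000 * (X C1 C2 C3 + X C1 C3 C2 + X C2 C1 C3 + X C2 C3 C1 + X C3 C1 C2 + X C3 C2 C1)
      + 1500 * (49 * v C0 - (v C1 + v C2 + v C3)) * (3 * (v C1 + v C2 + v C3) - v C0) * (3 * (v C1 + v C2 + v C3) - v C0)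
      + 1500 * (3 * (v C1 + v C2 + v C3) - v C0) * (49 * v C0 - (v C1 + v C2 + v C3)) * (3 * (v C1 + v C2 + v C3) - v C0)
      + 1500 * (3 * (v C1 + v C2 + v C3) - v C0) * (3 * (v C1 + v C2 + v C3) - v C0) * (49 * v C0 - (v C1 + v C2 + v C3))"
    unfolding pt sum.distrib sum_subtractf sum_distrib_left[symmetric, of "16200000" "\<lambda>q. _ + _ + _"]
      sum_distrib_left[symmetric, of "16200000"] sum_distrib_left[symmetric, of "20250000"] sum_prod3 slope sa sb sd X_def
    by (simp only: sum_distrib_left[symmetric] sum.distrib sd)
  also have "\<dots> = 4500 * (27000 * (v C1 * v C2 * v C3 - X C1 C2 C3)
       + 900 * ((v C1 + v C2 + v C3) ^ 3 - 27 * v C1 * v C2 * v C3)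
       + 3600 * ((lam * v C1 ^ 3 - X C1 C1 C1) + (lam * v C2 ^ 3 - X C2 C2 C2) + (lam * v C3 ^ 3 - X C3 C3 C3))
       + (49 * v C0 - (v C1 + v C2 + v C3)) * (3 * (v C1 + v C2 + v C3) - v C0)\<^sup>2)"
  proof -
    have x: "X C1 C3 C2 = X C1 C2 C3" "X C2 C1 C3 = X C1 C2 C3" "X C2 C3 C1 = X C1 C2 C3" "X C3 C1 C2 = X C1 C2 C3" "X C3 C2 C1 = X C1 C2 C3"
      using X12 X23 by metis+
    show ?thesis
      unfolding x by (simp add: power3_eq_cube power2_eq_square algebra_simps)
  qed
  finally show ?thesis
    unfolding M by (simp add: nedge_def Xeq)
qed

lemma two_links_sum_nonneg:
  fixes V :: "'a set"
  assumes "finite V" and rec: "\<And>W. W \<subseteq> V \<Longrightarrow> nedge E W \<le> lam * real (card W) ^ 3"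
  shows "0 \<le> (\<Sum>p\<in>V. \<Sum>q\<in>V. \<Sum>r\<in>V. of_bool (two_links E x y z p q r) * (lam - of_bool (E p q r)))"
proof -
  let ?W = "{p \<in> V. E x y p \<and> E y z p}"
  have "(\<Sum>p\<in>V. \<Sum>q\<in>V. \<Sum>r\<in>V. of_bool (two_links E x y z p q r) * (lam - of_bool (E p q r)))
    = (\<Sum>p\<in>V. of_bool (E x y p \<and> E y z p) * (\<Sum>q\<in>V. of_bool (E x y q \<and> E y z q) * (\<Sum>r\<in>V. of_bool (E x y r \<and> E y z r) * (lam - of_bool (E p q r)))))"
    unfolding sum_distrib_left by (intro sum.cong refl) (auto simp: two_links_def)
  also have "\<dots> = (\<Sum>p\<in>?W. \<Sum>q\<in>?W. \<Sum>r\<in>?W. lam - of_bool (E p q r))"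
    by (simp only: sum_of_bool_filter[OF assms(1)])
  also have "\<dots> = lam * real (card ?W) ^ 3 - nedge E ?W"
    by (simp add: nedge_def sum_subtractf power3_eq_cube)
  finally show ?thesis
    using rec[of ?W] by auto
qed

text \<open>The sum of \<open>Ob\<close> over all edges equals the averaged certificate minus
  squares and constraint terms of known sign. It is negative, so some edge has a negative
  \<open>Ob\<close>, and \<open>objective_sum\<close> rewrites that value as the claimed
  inequality.\<close>

theorem core_edge:
  fixes V :: "'a set" and lam :: real
  assumes V: "finite V" "V \<noteq> {}" and g: "good E" and lam: "1/4 \<le> lam"
    and N: "(lam - 1/20000) * real (card V) ^ 3 \<le> nedge E V"
    and rec: "\<And>W. W \<subseteq> V \<Longrightarrow> nedge E W \<le> lam * real (card W) ^ 3"
  obtains x y z where "x \<in> V" "y \<in> V" "z \<in> V" "E x y z"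
    "27000 * (\<Sum>a\<in>{p\<in>V. E y z p}. \<Sum>b\<in>{p\<in>V. E x z p}. \<Sum>c\<in>{p\<in>V. E x y p}. of_bool (\<not> E a b c))
     + 900 * ((real (card {p\<in>V. E y z p}) + real (card {p\<in>V. E x z p}) + real (card {p\<in>V. E x y p})) ^ 3
        - 27 * real (card {p\<in>V. E y z p}) * real (card {p\<in>V. E x z p}) * real (card {p\<in>V. E x y p}))
     + 3600 * ((lam * real (card {p\<in>V. E y z p}) ^ 3 - nedge E {p\<in>V. E y z p})
        + (lam * real (card {p\<in>V. E x z p}) ^ 3 - nedge E {p\<in>V. E x z p})
        + (lam * real (card {p\<in>V. E x y p}) ^ 3 - nedge E {p\<in>V. E x y p}))
     + (50 * real (card (V - ({p\<in>V. E y z p} \<union> {p\<in>V. E x z p} \<union> {p\<in>V. E x y p}))) - real (card V))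
        * (4 * (real (card {p\<in>V. E y z p}) + real (card {p\<in>V. E x z p}) + real (card {p\<in>V. E x y p})) - real (card V))\<^sup>2 < 0"
proof -
  define n where "n = real (card V)"
  define \<delta> where "\<delta> = lam - 1/4"
  define Ob where "Ob i j k = (\<Sum>l\<in>V. \<Sum>p\<in>V. \<Sum>q\<in>V. real_of_int (objective (edge_class E i j k l) (edge_class E i j k p) (edge_class E i j k q) (E l p q))
        + (lam - 1/4) * (16200000 * of_bool (edge_class E i j k l \<noteq> C0 \<and> edge_class E i j k l = edge_class E i j k p \<and> edge_class E i j k p = edge_class E i j k q)))" for i j k
  have n: "n > 0" using V by (simp add: n_def card_gt_0_iff)
  let ?R = "\<lambda>x y z p q r. of_bool (two_links E x y z p q r) * (lam - of_bool (E p q r))"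
  note s = good_commute[OF g]
  \<comment> \<open>At an edge no vertex lies in two links, so the \<open>two_links\<close> terms
    vanish; at a non-edge at most one of the three can hold. Hence the case distinction in
    \<open>flag_term\<close> agrees with this sum.\<close>
  have pt: "real_of_int (flag_term E i j k l p q) + \<delta> * real_of_int (slope_term E i j k l p q) =
      of_bool (E i j k) * (real_of_int (objective (edge_class E i j k l) (edge_class E i j k p) (edge_class E i j k q) (E l p q))
        + (lam - 1/4) * (16200000 * of_bool (edge_class E i j k l \<noteq> C0 \<and> edge_class E i j k l = edge_class E i j k p \<and> edge_class E i j k p = edge_class E i j k q)))
      + 3 * (of_bool (E i j k) * (real_of_int (edge_square E i j k l p q) + real_of_int (edge_square E i j k p l q) + real_of_int (edge_square E i j k q l p)))
      + 32670000 * (?R i j k l p q + ?R j i k l p q + ?R i k j l p q)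
      + 15138000 * (of_bool (E i j k) - lam)
      - 12564000 * (of_bool (E i j k) * (of_bool (E l p q) - lam))" for i j k l p q
  proof (cases "E i j k")
    case True
    have "\<not> two_links E i j k l p q" "\<not> two_links E j i k l p q" "\<not> two_links E i k j l p q"
      using good_K4[OF g, of j i k l] good_K4[OF g, of i j k l] good_K4[OF g, of k i j l] True s
      unfolding two_links_def by metis+
    then show ?thesis
      using True by (auto simp: flag_term_def slope_term_def \<delta>_def algebra_simps)
  next
    case False
    have "\<not> (E i j l \<and> E j k l \<and> E i k l)"
      using good_K4[OF g, of l i j k] s by metis
    then have "\<not> (two_links E i j k l p q \<and> two_links E j i k l p q)" "\<not> (two_links E i j k l p q \<and> two_links E i k j l p q)"
      "\<not> (two_links E j i k l p q \<and> two_links E i k j l p q)"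
      unfolding two_links_def using s by metis+
    then show ?thesis
      using False by (auto simp: flag_term_def slope_term_def \<delta>_def algebra_simps)
  qed
  have edge_square: "0 \<le> sum6 V (\<lambda>i j k l p q. of_bool (E i j k) * (real_of_int (edge_square E i j k l p q) + real_of_int (edge_square E i j k p l q) + real_of_int (edge_square E i j k q l p)))"
  proof (rule sum_nonneg, rule sum_nonneg, rule sum_nonneg)
    fix i j k
    let ?h = "\<lambda>l p q. real_of_int (edge_square E i j k l p q)"
    have "0 \<le> (\<Sum>l\<in>V. \<Sum>p\<in>V. \<Sum>q\<in>V. ?h l p q)"
      by (intro sum_nonneg edge_square_sum_nonneg[OF V(1)])
    moreover have "(\<Sum>l\<in>V. \<Sum>p\<in>V. \<Sum>q\<in>V. ?h p l q) = (\<Sum>l\<in>V. \<Sum>p\<in>V. \<Sum>q\<in>V. ?h l p q)"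
      by (rule sum.swap)
    moreover have "(\<Sum>l\<in>V. \<Sum>p\<in>V. \<Sum>q\<in>V. ?h q l p) = (\<Sum>l\<in>V. \<Sum>p\<in>V. \<Sum>q\<in>V. ?h l p q)"
    proof -
      have "(\<Sum>l\<in>V. \<Sum>p\<in>V. \<Sum>q\<in>V. ?h q l p) = (\<Sum>l\<in>V. \<Sum>q\<in>V. \<Sum>p\<in>V. ?h q l p)"
        by (intro sum.cong refl sum.swap)
      also have "\<dots> = (\<Sum>q\<in>V. \<Sum>l\<in>V. \<Sum>p\<in>V. ?h q l p)"
        by (rule sum.swap)
      finally show ?thesis .
    qed
    ultimately have "0 \<le> of_bool (E i j k) * ((\<Sum>l\<in>V. \<Sum>p\<in>V. \<Sum>q\<in>V. ?h l p q) + (\<Sum>l\<in>V. \<Sum>p\<in>V. \<Sum>q\<in>V. ?h p l q) + (\<Sum>l\<in>V. \<Sum>p\<in>V. \<Sum>q\<in>V. ?h q l p))"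
      by simp
    then show "0 \<le> (\<Sum>l\<in>V. \<Sum>p\<in>V. \<Sum>q\<in>V. of_bool (E i j k) * (?h l p q + ?h p l q + ?h q l p))"
      by (simp add: sum.distrib sum_distrib_left[symmetric])
  qed
  have R: "0 \<le> sum6 V (\<lambda>i j k l p q. ?R i j k l p q + ?R j i k l p q + ?R i k j l p q)"
    unfolding sum.distrib by (intro add_nonneg_nonneg sum_nonneg two_links_sum_nonneg[OF V(1) rec])
  have N3: "nedge E V \<le> lam * n ^ 3"
    using rec[of V] by (simp add: n_def)
  have N0: "0 \<le> nedge E V"
    unfolding nedge_def by (intro sum_nonneg) simp
  have T1: "sum6 V (\<lambda>i j k l p q. of_bool (E i j k) - lam) = n ^ 3 * (nedge E V - lam * n ^ 3)"
    by (simp add: nedge_def n_def sum_subtractf sum_distrib_left[symmetric] power3_eq_cube algebra_simps)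
  have T2: "sum6 V (\<lambda>i j k l p q. of_bool (E i j k) * (of_bool (E l p q) - lam)) = nedge E V * (nedge E V - lam * n ^ 3)"
  proof -
    have "(\<Sum>l\<in>V. \<Sum>p\<in>V. \<Sum>q\<in>V. of_bool (E l p q) - lam) = nedge E V - lam * n ^ 3"
      by (simp add: nedge_def n_def sum_subtractf power3_eq_cube)
    then show ?thesis
      by (simp add: sum_distrib_left[symmetric] sum_distrib_right[symmetric] nedge_def[symmetric])
  qed
  have "sum6 V (\<lambda>i j k l p q. real_of_int (flag_term E i j k l p q)) + \<delta> * sum6 V (\<lambda>i j k l p q. real_of_int (slope_term E i j k l p q))
    = sum6 V (\<lambda>i j k l p q. real_of_int (flag_term E i j k l p q) + \<delta> * real_of_int (slope_term E i j k l p q))"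
    by (simp only: sum.distrib sum_distrib_left)
  also have "\<dots> = (\<Sum>i\<in>V. \<Sum>j\<in>V. \<Sum>k\<in>V. of_bool (E i j k) * Ob i j k)
     + 3 * sum6 V (\<lambda>i j k l p q. of_bool (E i j k) * (real_of_int (edge_square E i j k l p q) + real_of_int (edge_square E i j k p l q) + real_of_int (edge_square E i j k q l p)))
     + 32670000 * sum6 V (\<lambda>i j k l p q. ?R i j k l p q + ?R j i k l p q + ?R i k j l p q)
     + 15138000 * sum6 V (\<lambda>i j k l p q. of_bool (E i j k) - lam)
     - 12564000 * sum6 V (\<lambda>i j k l p q. of_bool (E i j k) * (of_bool (E l p q) - lam))"
    unfolding pt Ob_def sum_distrib_left by (simp only: sum.distrib sum_subtractf)
  finally have eq: "sum6 V (\<lambda>i j k l p q. real_of_int (flag_term E i j k l p q)) + \<delta> * sum6 V (\<lambda>i j k l p q. real_of_int (slope_term E i j k l p q)) = \<dots>" .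
  have "\<delta> * sum6 V (\<lambda>i j k l p q. real_of_int (slope_term E i j k l p q)) \<le> 0"
    using sum6_bound(2)[OF V(1) g] lam by (simp add: \<delta>_def mult_nonneg_nonpos)
  moreover have "20 * sum6 V (\<lambda>i j k l p q. real_of_int (flag_term E i j k l p q)) \<le> - 28800 * n ^ 6"
    using sum6_bound(1)[OF V(1) g] pair_square_sum_nonneg[OF g, of V] by (simp add: n_def)
  \<comment> \<open>The deficit n^3 / 20000 costs 15138000 / 20000 < 757, against the gain 28800 /
    20 = 1440 of the certificate; 683 is left over.\<close>
  moreover have "15138000 * (n ^ 3 * (nedge E V - lam * n ^ 3)) \<ge> - 757 * n ^ 6"
  proof -
    have "nedge E V - lam * n ^ 3 \<ge> - (1/20000) * n ^ 3"
      using N by (simp add: n_def algebra_simps)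
    then have "n ^ 3 * (nedge E V - lam * n ^ 3) \<ge> n ^ 3 * (- (1/20000) * n ^ 3)"
      using n by (intro mult_left_mono) simp_all
    moreover have "n ^ 3 * (- (1/20000) * n ^ 3) = - (1/20000) * n ^ 6"
      by (simp add: power_add[symmetric])
    moreover have "n ^ 6 > 0"
      using n by simp
    ultimately show ?thesis
      by linarith
  qed
  moreover have "- 12564000 * (nedge E V * (nedge E V - lam * n ^ 3)) \<ge> 0"
    using N0 N3 by (simp add: mult_nonneg_nonpos)
  ultimately have "(\<Sum>i\<in>V. \<Sum>j\<in>V. \<Sum>k\<in>V. of_bool (E i j k) * Ob i j k) \<le> - 683 * n ^ 6"
    using eq edge_square R unfolding T1 T2 by linarith
  moreover have "n ^ 6 > 0"
    using n by simp
  ultimately have neg: "(\<Sum>i\<in>V. \<Sum>j\<in>V. \<Sum>k\<in>V. of_bool (E i j k) * Ob i j k) < 0"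
    by linarith
  have "\<exists>x\<in>V. \<exists>y\<in>V. \<exists>z\<in>V. of_bool (E x y z) * Ob x y z < 0"
  proof (rule ccontr)
    assume "\<not> ?thesis"
    then have "0 \<le> (\<Sum>i\<in>V. \<Sum>j\<in>V. \<Sum>k\<in>V. of_bool (E i j k) * Ob i j k)"
      by (intro sum_nonneg) (auto simp: not_less)
    then show False using neg by linarith
  qed
  then obtain x y z where xyz: "x \<in> V" "y \<in> V" "z \<in> V" and neg: "of_bool (E x y z) * Ob x y z < 0"
    by blast
  then have e: "E x y z" and ob: "Ob x y z < 0"
    by (auto simp: of_bool_def split: if_splits)
  have ex: "\<not> (E y z p \<and> E x z p)" "\<not> (E y z p \<and> E x y p)" "\<not> (E x z p \<and> E x y p)" for p
    using good_K4[OF g, of z x y p] good_K4[OF g, of y x z p] good_K4[OF g, of x y z p] e s by metis+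
  have W: "{p\<in>V. edge_class E x y z p = C1} = {p\<in>V. E y z p}" "{p\<in>V. edge_class E x y z p = C2} = {p\<in>V. E x z p}"
    "{p\<in>V. edge_class E x y z p = C3} = {p\<in>V. E x y p}"
    "{p\<in>V. edge_class E x y z p = C0} = V - ({p\<in>V. E y z p} \<union> {p\<in>V. E x z p} \<union> {p\<in>V. E x y p})"
    using ex by (auto simp: edge_class_def)
  let ?A = "{p\<in>V. E y z p}" and ?B = "{p\<in>V. E x z p}" and ?C = "{p\<in>V. E x y p}"
  have "card (?A \<union> ?B \<union> ?C) = card ?A + card ?B + card ?C"
  proof -
    have "card (?A \<union> ?B \<union> ?C) = card (?A \<union> ?B) + card ?C"
      using V(1) ex by (intro card_Un_disjoint) auto
    also have "card (?A \<union> ?B) = card ?A + card ?B"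
      using V(1) ex by (intro card_Un_disjoint) auto
    finally show ?thesis .
  qed
  then have c: "real (card V) = real (card (V - (?A \<union> ?B \<union> ?C))) + (real (card ?A) + real (card ?B) + real (card ?C))"
    using card_Diff_subset[of "?A \<union> ?B \<union> ?C" V] card_mono[of V "?A \<union> ?B \<union> ?C"] V(1) by force
  have "4500 * t < 0 \<Longrightarrow> t < 0" for t :: real
    by simp
  from this[OF ob[unfolded Ob_def objective_sum[OF V(1) g] W]] show thesis
    by (intro that[OF xyz e]) (simp add: c algebra_simps)
qed

section \<open>The extremal density of good relations\<close>

declare sum_of_bool_eq [simp del]

definition link :: "('a \<Rightarrow> 'a \<Rightarrow> 'a \<Rightarrow> bool) \<Rightarrow> 'a \<Rightarrow> 'a set \<Rightarrow> 'a set \<Rightarrow> real" where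
  "link E u A B = (\<Sum>a\<in>A. \<Sum>b\<in>B. of_bool (E u a b))"

definition miss :: "('a \<Rightarrow> 'a \<Rightarrow> 'a \<Rightarrow> bool) \<Rightarrow> 'a set \<Rightarrow> 'a set \<Rightarrow> 'a set \<Rightarrow> real" where
  "miss E A B C = (\<Sum>a\<in>A. \<Sum>b\<in>B. \<Sum>c\<in>C. of_bool (\<not> E a b c))"

lemma link_nonneg: "0 \<le> link E u A B"
  unfolding link_def by (intro sum_nonneg) simp

lemma miss_nonneg: "0 \<le> miss E A B C"
  unfolding miss_def by (intro sum_nonneg) simp

lemma link_le: "link E u A B \<le> real (card A) * real (card B)"
proof -
  have "link E u A B \<le> (\<Sum>a\<in>A. \<Sum>b\<in>B. 1)"
    unfolding link_def by (intro sum_mono) simp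
  then show ?thesis by simp
qed

lemma link_commute:
  assumes "good E" shows "link E u A B = link E u B A"
  unfolding link_def by (subst sum.swap) (simp add: good_commute(2)[OF assms, of u])

lemma miss_swap:
  assumes "good E" shows "miss E B A C = miss E A B C" "miss E A C B = miss E A B C"
proof -
  show "miss E B A C = miss E A B C"
    unfolding miss_def by (subst sum.swap) (simp add: good_commute(1)[OF assms, of _ _ "_ :: 'a"])
  have "(\<Sum>c\<in>C. \<Sum>b\<in>B. of_bool (\<not> E a c b)) = (\<Sum>b\<in>B. \<Sum>c\<in>C. of_bool (\<not> E a b c) :: real)" for a
    by (subst sum.swap) (simp add: good_commute(2)[OF assms, of a])
  then show "miss E A C B = miss E A B C"
    unfolding miss_def by simp
qed

lemma link_Un1: "finite A \<Longrightarrow> finite B \<Longrightarrow> A \<inter> B = {} \<Longrightarrow> link E u (A \<union> B) C = link E u A C + link E u B C"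
  unfolding link_def by (rule sum.union_disjoint)

lemma link_Un2: "finite A \<Longrightarrow> finite B \<Longrightarrow> A \<inter> B = {} \<Longrightarrow> link E u C (A \<union> B) = link E u C A + link E u C B"
  unfolding link_def by (simp add: sum.union_disjoint sum.distrib)

lemma link_mono:
  assumes "finite A'" "finite B'" "A \<subseteq> A'" "B \<subseteq> B'"
  shows "link E u A B \<le> link E u A' B'"
proof -
  have "link E u A B \<le> link E u A B'"
    unfolding link_def using assms by (intro sum_mono sum_mono2) auto
  also have "\<dots> \<le> link E u A' B'"
    unfolding link_def using assms by (intro sum_mono2 sum_nonneg) auto
  finally show ?thesis .
qed

lemma nedge_link: "nedge E W = (\<Sum>x\<in>W. link E x W W)"
  by (simp add: nedge_def link_def)

text \<open>The new vertex may occupy any of three positions, and by irreflexivity never two of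
  them.\<close>

lemma nedge_insert:
  assumes g: "good E" and "finite A" "x \<notin> A"
  shows "nedge E (insert x A) = nedge E A + 3 * link E x A A"
proof -
  have 1: "link E x (insert x A) (insert x A) = link E x A A"
    using assms(2,3) by (simp add: link_def good_irr[OF g])
  have 2: "link E a (insert x A) (insert x A) = link E a A A + 2 * (\<Sum>b\<in>A. of_bool (E x a b))" if "a \<in> A" for a
    using assms(2,3) good_commute(2)[OF g, of a _ x] good_commute(1)[OF g, of a x]
    by (simp add: link_def good_irr[OF g] sum.distrib)
  have "nedge E (insert x A) = link E x A A + (\<Sum>a\<in>A. link E a A A + 2 * (\<Sum>b\<in>A. of_bool (E x a b)))"
    unfolding nedge_link using assms(2,3) by (simp add: 1 2)
  also have "\<dots> = nedge E A + 3 * link E x A A"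
    by (simp add: sum.distrib nedge_link sum_distrib_left[symmetric] link_def)
  finally show ?thesis .
qed

lemma nedge_image:
  assumes "inj_on f A" shows "nedge E (f ` A) = nedge (reind E f) A"
  unfolding nedge_def by (simp add: sum.reindex[OF assms] reind_def)

lemma nedge_le: "nedge E A \<le> real (card A) ^ 3"
proof -
  have "nedge E A \<le> (\<Sum>x\<in>A. \<Sum>y\<in>A. \<Sum>z\<in>A. 1)"
    unfolding nedge_def by (intro sum_mono) simp
  then show ?thesis by (simp add: power3_eq_cube)
qed

lemma nedge_nonneg: "0 \<le> nedge E A"
  unfolding nedge_def by (intro sum_nonneg) simp

section \<open>The extremal density, blow-ups and optimal relations\<close>

text \<open>With the cube as normalisation the density is unchanged by blow-ups, so a supremum over
  all sizes serves and bounds every finite set exactly.\<close>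

definition dens :: real where
  "dens = Sup {nedge E {..<m} / real m ^ 3 | E m. good (E :: nat \<Rightarrow> nat \<Rightarrow> nat \<Rightarrow> bool) \<and> 0 < m}"

lemma dens_bdd: "bdd_above {nedge E {..<m} / real m ^ 3 | E m. good (E :: nat \<Rightarrow> nat \<Rightarrow> nat \<Rightarrow> bool) \<and> 0 < m}"
proof (rule bdd_aboveI[where M = 1])
  fix x assume "x \<in> {nedge E {..<m} / real m ^ 3 | E m. good (E :: nat \<Rightarrow> nat \<Rightarrow> nat \<Rightarrow> bool) \<and> 0 < m}"
  then obtain E m where "x = nedge E {..<m} / real m ^ 3" "0 < m"
    by blast
  then show "x \<le> 1"
    using nedge_le[of E "{..<m}"] by (simp add: divide_le_eq)
qed

lemma good_empty: "good (\<lambda>_ _ _. False)"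
  by (simp add: good_def)

lemma nedge_le_dens:
  fixes E :: "'a \<Rightarrow> 'a \<Rightarrow> 'a \<Rightarrow> bool"
  assumes "good E" "finite W"
  shows "nedge E W \<le> dens * real (card W) ^ 3"
proof (cases "card W = 0")
  case True
  then show ?thesis
    using assms(2) by (simp add: nedge_def)
next
  case False
  obtain f where f: "bij_betw f {..<card W} W"
    using ex_bij_betw_nat_finite[OF assms(2)] by (auto simp: lessThan_atLeast0)
  have "nedge E W = nedge (reind E f) {..<card W}"
    using nedge_image[of f "{..<card W}" E] f by (simp add: bij_betw_def)
  moreover have "nedge (reind E f) {..<card W} / real (card W) ^ 3 \<le> dens"
    unfolding dens_def using good_reind[OF assms(1), of f] False by (intro cSup_upper dens_bdd) blast
  ultimately show ?thesis
    using False by (simp add: divide_le_eq)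
qed

lemma dens_nearly_attained:
  assumes "\<epsilon> > 0"
  obtains E :: "nat \<Rightarrow> nat \<Rightarrow> nat \<Rightarrow> bool" and m where "good E" "m > 0" "(dens - \<epsilon>) * real m ^ 3 < nedge E {..<m}"
proof -
  let ?S = "{nedge E {..<m} / real m ^ 3 | E m. good (E :: nat \<Rightarrow> nat \<Rightarrow> nat \<Rightarrow> bool) \<and> 0 < m}"
  have "?S \<noteq> {}"
    using good_empty by blast
  moreover have "dens - \<epsilon> < Sup ?S"
    using assms by (simp add: dens_def)
  ultimately obtain x where "x \<in> ?S" "dens - \<epsilon> < x"
    using less_cSup_iff[OF _ dens_bdd] by blast
  then show thesis
    using that by (auto simp: pos_less_divide_eq)
qed

text \<open>Gives nearly extremal relations whose number of vertices is as large and as divisible as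
  desired.\<close>

lemma nedge_blow_up:
  assumes "m > 0" shows "nedge (reind E (\<lambda>i. i mod m)) {..<m * k} = real k ^ 3 * nedge E {..<m}"
proof -
  have s: "(\<Sum>i<m * k. f (i mod m)) = real k * (\<Sum>i<m. f i)" for f :: "nat \<Rightarrow> real"
  proof (induction k)
    case (Suc k)
    have "(\<Sum>i<m * Suc k. f (i mod m)) = (\<Sum>i<m * k. f (i mod m)) + (\<Sum>i=m * k..<m * k + m. f (i mod m))"
      by (subst sum.atLeastLessThan_concat[of 0 "m * k", symmetric, simplified lessThan_atLeast0[symmetric]])
        (simp_all add: lessThan_atLeast0 add.commute sum.atLeastLessThan_concat)
    also have "(\<Sum>i=m * k..<m * k + m. f (i mod m)) = (\<Sum>i<m. f i)"
      using sum.shift_bounds_nat_ivl[of "\<lambda>i. f (i mod m)" 0 "m * k" m] by (simp add: lessThan_atLeast0 add.commute)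
    finally show ?case
      using Suc by (simp add: algebra_simps)
  qed simp
  show ?thesis
    unfolding nedge_def reind_def s[of "\<lambda>z. of_bool (E _ _ z)"]
      s[of "\<lambda>y. real k * (\<Sum>z<m. of_bool (E _ y z))"] s[of "\<lambda>x. real k * (\<Sum>y<m. real k * (\<Sum>z<m. of_bool (E x y z)))"]
    by (simp only: sum_distrib_left[symmetric] power3_eq_cube mult.assoc)
qed

text \<open>The count is a natural number at most n^3, hence attains its maximum although there are
  infinitely many relations on \<open>nat\<close>.\<close>

lemma ex_optimal:
  obtains E :: "nat \<Rightarrow> nat \<Rightarrow> nat \<Rightarrow> bool" where "good E"
    "\<And>E'. good E' \<Longrightarrow> nedge E' {..<n} \<le> nedge E {..<n}"
proof -
  define f where "f E = nat \<lfloor>nedge E {..<n}\<rfloor>" for E :: "nat \<Rightarrow> nat \<Rightarrow> nat \<Rightarrow> bool"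
  have f: "real (f E) = nedge E {..<n}" for E
  proof -
    have "nedge E {..<n} = real (\<Sum>x<n. \<Sum>y<n. \<Sum>z<n. of_bool (E x y z))"
      by (simp add: nedge_def)
    then show ?thesis
      by (simp only: f_def floor_of_nat nat_int)
  qed
  have "f E < Suc (n ^ 3)" for E
    using nedge_le[of E "{..<n}"] f[of E] by (simp add: less_Suc_eq_le flip: of_nat_power)
  then obtain E where "good E" "\<forall>E'. good E' \<longrightarrow> f E' \<le> f E"
    using ex_has_greatest_nat[of good "\<lambda>_ _ _. False" f "Suc (n ^ 3)"] good_empty by blast
  then show thesis
    using that f by (metis of_nat_le_iff)
qed

text \<open>Symmetrisation: pulling back along the map that sends x to y turns x into a clone of y
  and cannot gain edges, so no degree exceeds that of x by more than the pairs through x, at most 2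
  * card V. Averaging over y compares the degree of x with the mean.\<close>

lemma optimal_degree:
  assumes g: "good E" and opt: "\<And>E'. good E' \<Longrightarrow> nedge E' V \<le> nedge E V"
    and V: "finite V" "x \<in> V"
  shows "nedge E V \<le> real (card V) * link E x V V + 2 * real (card V) ^ 2"
proof -
  have "link E y V V \<le> link E x V V + 2 * real (card V)" if y: "y \<in> V" for y
  proof (cases "y = x")
    case False
    let ?A = "V - {x}" and ?E = "reind E (id(x := y))"
    have ins: "insert x ?A = V" "finite ?A" "x \<notin> ?A"
      using V by auto
    have "nedge ?E V \<le> nedge E V"
      by (rule opt[OF good_reind[OF g]])
    moreover have "nedge ?E V = nedge ?E ?A + 3 * link ?E x ?A ?A" "nedge E V = nedge E ?A + 3 * link E x ?A ?A"
      using nedge_insert[OF good_reind[OF g] ins(2,3)] nedge_insert[OF g ins(2,3)] by (simp_all only: ins)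
    moreover have "nedge ?E ?A = nedge E ?A"
      unfolding nedge_def reind_def by (intro sum.cong) auto
    moreover have "link ?E x ?A ?A = link E y ?A ?A"
      unfolding link_def reind_def by (intro sum.cong) auto
    ultimately have "link E y ?A ?A \<le> link E x ?A ?A"
      by linarith
    also have "\<dots> \<le> link E x V V"
      using V by (intro link_mono) auto
    finally have 1: "link E y ?A ?A \<le> link E x V V" .
    have "link E y V V = link E y ({x} \<union> ?A) ({x} \<union> ?A)"
      using ins by simp
    also have "\<dots> = link E y {x} {x} + link E y ?A {x} + link E y {x} ?A + link E y ?A ?A"
    proof -
      have d: "finite {x}" "{x} \<inter> ?A = {}"
        by auto
      show ?thesis
        unfolding link_Un1[OF d(1) ins(2) d(2)] link_Un2[OF d(1) ins(2) d(2)] by simp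
    qed
    also have "\<dots> \<le> 0 + real (card V) + real (card V) + link E x V V"
    proof -
      have "card ?A \<le> card V"
        by (intro card_mono) (use V in auto)
      then show ?thesis
        using 1 link_le[of E y ?A "{x}"] link_le[of E y "{x}" ?A] by (auto simp: link_def good_irr[OF g])
    qed
    finally show ?thesis by simp
  qed simp
  then have "(\<Sum>y\<in>V. link E y V V) \<le> (\<Sum>y\<in>V. link E x V V + 2 * real (card V))"
    by (intro sum_mono)
  then show ?thesis
    by (simp add: nedge_link power2_eq_square algebra_simps)
qed

text \<open>Adding \<open>k\<close> clones of \<open>u\<close> to \<open>A\<close> keeps the relation good.\<close>

lemma clone_bound:
  fixes E :: "'a \<Rightarrow> 'a \<Rightarrow> 'a \<Rightarrow> bool"
  assumes g: "good E" and A: "finite A"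
  shows "nedge E A + 3 * real k * link E u A A \<le> dens * (real (card A) + real k) ^ 3"
proof -
  let ?E = "reind E (case_sum id (\<lambda>_ :: nat. u))"
  note g' = good_reind[OF g, of "case_sum id (\<lambda>_ :: nat. u)"]
  have Inl: "link ?E (Inr i) (Inl ` A) (Inl ` A) = link E u A A" for i
    by (simp add: link_def sum.reindex reind_def)
  have "nedge E A + 3 * real k * link E u A A \<le> nedge ?E (Inl ` A \<union> Inr ` {..<k})"
  proof (induction k)
    case 0
    then show ?case
      by (simp add: nedge_image reind_def[abs_def])
  next
    case (Suc k)
    let ?B = "Inl ` A \<union> Inr ` {..<k}"
    have "nedge ?E (Inl ` A \<union> Inr ` {..<Suc k}) = nedge ?E ?B + 3 * link ?E (Inr k) ?B ?B"
      using nedge_insert[OF g', of ?B "Inr k"] A by (auto simp: lessThan_Suc)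
    moreover have "link ?E (Inr k) ?B ?B \<ge> link E u A A"
      unfolding Inl[of k, symmetric] using A by (intro link_mono) auto
    ultimately show ?case
      using Suc by (simp add: algebra_simps)
  qed
  also have "\<dots> \<le> dens * real (card (Inl ` A \<union> Inr ` {..<k} :: ('a + nat) set)) ^ 3"
    using A by (intro nedge_le_dens[OF g']) simp
  also have "card (Inl ` A \<union> Inr ` {..<k} :: ('a + nat) set) = card A + k"
    using A by (subst card_Un_disjoint) (auto simp: card_image)
  finally show ?thesis by simp
qed

section \<open>Inequalities for the link of one vertex\<close>

text \<open>If ab and b'c are both in the link of u, then the cycle on u, b', c, a, b shows that
  ab'c or abc is missing. Thus a link cannot be large both between A and B and between B and C when
  few transversal triples are missing.\<close>

lemma link_product:
  assumes g: "good E"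
  shows "link E u A B * link E u B C \<le> 2 * real (card B) * miss E A B C"
proof -
  have "link E u A B * link E u B C = (\<Sum>a\<in>A. \<Sum>b\<in>B. \<Sum>b'\<in>B. \<Sum>c\<in>C. of_bool (E u a b) * of_bool (E u b' c))"
  proof -
    have 1: "(\<Sum>b'\<in>B. \<Sum>c\<in>C. r * of_bool (E u b' c)) = r * link E u B C" for r
      by (simp only: sum_distrib_left link_def)
    show ?thesis
      by (simp only: 1 link_def[of E u A B] sum_distrib_right)
  qed
  also have "\<dots> \<le> (\<Sum>a\<in>A. \<Sum>b\<in>B. \<Sum>b'\<in>B. \<Sum>c\<in>C. of_bool (\<not> E a b' c) + of_bool (\<not> E a b c))"
  proof (intro sum_mono)
    fix a b b' c
    have "\<not> (E u a b \<and> E u b' c \<and> E a b' c \<and> E a b c)"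
      using good_C5[OF g, of u b' c a b] good_commute[OF g] by metis
    then show "of_bool (E u a b) * of_bool (E u b' c) \<le> (of_bool (\<not> E a b' c) + of_bool (\<not> E a b c) :: real)"
      by auto
  qed
  also have "\<dots> = 2 * real (card B) * miss E A B C"
    by (simp add: sum.distrib miss_def sum_distrib_left mult.assoc)
  finally show ?thesis .
qed

text \<open>Adjacent vertices have disjoint neighbourhoods, so their weighted degrees add up to at
  most the total weight F. Summing this over adjacent pairs bounds the second moment of the degrees;
  expanding the weighted sum of (D - F/2)^2, which is non-negative, finishes.\<close>

lemma weighted_mantel:
  fixes f :: "'a \<Rightarrow> real"
  assumes X: "finite X" and f: "\<And>x. x \<in> X \<Longrightarrow> 0 \<le> f x" and s: "\<And>x y. L x y \<Longrightarrow> L y x"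
    and t: "\<And>x y z. L x y \<Longrightarrow> L x z \<Longrightarrow> L y z \<Longrightarrow> False"
  shows "(\<Sum>x\<in>X. \<Sum>y\<in>X. f x * f y * of_bool (L x y)) \<le> (sum f X)\<^sup>2 / 2"
proof -
  define F where "F = sum f X"
  define D where "D x = (\<Sum>y\<in>X. f y * of_bool (L x y))" for x
  define T where "T = (\<Sum>x\<in>X. f x * D x)"
  have T: "(\<Sum>x\<in>X. \<Sum>y\<in>X. f x * f y * of_bool (L x y)) = T"
    by (simp add: T_def D_def sum_distrib_left mult.assoc)
  have Ls: "L x y = L y x" for x y
    using s by blast
  have DD: "D x + D y \<le> F" if "L x y" for x y
  proof -
    have "D x + D y = (\<Sum>z\<in>X. f z * (of_bool (L x z) + of_bool (L y z)))"
      by (simp add: D_def sum.distrib distrib_left)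
    also have "\<dots> \<le> (\<Sum>z\<in>X. f z * 1)"
      using t[OF that] f by (intro sum_mono mult_left_mono) auto
    finally show ?thesis by (simp add: F_def)
  qed
  have "2 * (\<Sum>x\<in>X. f x * (D x)\<^sup>2) = (\<Sum>x\<in>X. \<Sum>y\<in>X. f x * f y * of_bool (L x y) * (D x + D y))"
  proof -
    have 1: "(\<Sum>x\<in>X. \<Sum>y\<in>X. f x * f y * of_bool (L x y) * D x) = (\<Sum>x\<in>X. f x * (D x)\<^sup>2)"
    proof (intro sum.cong refl)
      fix x
      have "(\<Sum>y\<in>X. f x * f y * of_bool (L x y) * D x) = f x * D x * (\<Sum>y\<in>X. f y * of_bool (L x y))"
        by (simp add: sum_distrib_left mult_ac)
      then show "(\<Sum>y\<in>X. f x * f y * of_bool (L x y) * D x) = f x * (D x)\<^sup>2"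
        by (simp add: D_def[symmetric] power2_eq_square)
    qed
    have "(\<Sum>x\<in>X. \<Sum>y\<in>X. f x * f y * of_bool (L x y) * D y) = (\<Sum>y\<in>X. \<Sum>x\<in>X. f x * f y * of_bool (L x y) * D y)"
      by (rule sum.swap)
    also have "\<dots> = (\<Sum>x\<in>X. \<Sum>y\<in>X. f x * f y * of_bool (L x y) * D x)"
      using Ls by (simp add: mult_ac)
    finally show ?thesis
      using 1 by (simp add: distrib_left sum.distrib)
  qed
  also have "\<dots> \<le> (\<Sum>x\<in>X. \<Sum>y\<in>X. f x * f y * of_bool (L x y) * F)"
  proof (intro sum_mono)
    fix x y assume "x \<in> X" "y \<in> X"
    then show "f x * f y * of_bool (L x y) * (D x + D y) \<le> f x * f y * of_bool (L x y) * F"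
      using DD[of x y] f by (cases "L x y") (auto intro!: mult_left_mono)
  qed
  also have "\<dots> = F * T"
    unfolding T[symmetric] by (simp add: sum_distrib_left mult_ac)
  finally have 1: "2 * (\<Sum>x\<in>X. f x * (D x)\<^sup>2) \<le> F * T" .
  have "0 \<le> (\<Sum>x\<in>X. f x * (D x - F / 2)\<^sup>2)"
    using f by (intro sum_nonneg) simp
  also have "\<dots> = (\<Sum>x\<in>X. f x * (D x)\<^sup>2) - F * T + F\<^sup>2 / 4 * F"
  proof -
    have "f x * (D x - F / 2)\<^sup>2 = f x * (D x)\<^sup>2 - F * (f x * D x) + F\<^sup>2 / 4 * f x" for x
      by (simp add: power2_eq_square algebra_simps)
    then show ?thesis
      by (simp add: sum.distrib sum_subtractf sum_distrib_left[symmetric] sum_divide_distrib[symmetric]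
          T_def[symmetric] F_def[symmetric])
  qed
  finally have 2: "F * T \<le> F * (F\<^sup>2 / 2)"
    using 1 by (simp add: power2_eq_square algebra_simps)
  show ?thesis
  proof (cases "F = 0")
    case True
    then have "f x = 0" if "x \<in> X" for x
      using sum_nonneg_eq_0_iff[OF X, of f] f that by (auto simp: F_def)
    then have "T = 0"
      by (simp add: T_def)
    then show ?thesis
      unfolding T by simp
  next
    case False
    moreover have "F \<ge> 0"
      using f by (simp add: F_def sum_nonneg)
    ultimately have "T \<le> F\<^sup>2 / 2"
      using 2 by (metis mult_le_cancel_left_pos order_le_less)
    then show ?thesis
      unfolding T by (simp add: F_def)
  qed
qed

text \<open>Weight each b by the fraction of C to which it is not joined in the link of u. The link
  is triangle-free, so the weighted pairs obey Mantel's bound. The rest is controlled by missing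
  triples: if bb' and bc are in the link, the cycle on b', a, c, b, u forces abc or ab'c to be
  missing.\<close>

lemma link_inside:
  assumes g: "good E" and fin: "finite A" "finite B" "finite C" and ne: "A \<noteq> {}" "C \<noteq> {}"
  shows "link E u B B \<le> (real (card B) - link E u B C / real (card C))\<^sup>2 / 2
     + 4 * real (card B) * miss E A B C / (real (card A) * real (card C))"
proof -
  define nB where "nB b = (\<Sum>b'\<in>B. of_bool (E u b b') :: real)" for b
  define nC where "nC b = (\<Sum>c\<in>C. of_bool (E u b c) :: real)" for b
  have pos: "0 < real (card A)" "0 < real (card C)"
    using fin ne by (simp_all add: card_gt_0_iff)
  have "real (card A) * (\<Sum>b\<in>B. nB b * nC b) = (\<Sum>b\<in>B. \<Sum>b'\<in>B. \<Sum>c\<in>C. \<Sum>a\<in>A. of_bool (E u b b') * of_bool (E u b c))"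
    unfolding nB_def nC_def sum_product by (simp add: sum_distrib_left)
  also have "\<dots> \<le> (\<Sum>b\<in>B. \<Sum>b'\<in>B. \<Sum>c\<in>C. \<Sum>a\<in>A. of_bool (\<not> E b c a) + of_bool (\<not> E b' c a))"
  proof (intro sum_mono)
    fix a b b' c
    have "\<not> (E u b b' \<and> E u b c \<and> E b c a \<and> E b' c a)"
      using good_C5[OF g, of b' a c b u] good_commute[OF g] by metis
    then show "of_bool (E u b b') * of_bool (E u b c) \<le> (of_bool (\<not> E b c a) + of_bool (\<not> E b' c a) :: real)"
      by auto
  qed
  also have "\<dots> = 2 * real (card B) * miss E B C A"
    by (simp add: sum.distrib miss_def sum_distrib_left mult.assoc)
  also have "miss E B C A = miss E A B C"
    using miss_swap[OF g] by metis
  finally have 1: "(\<Sum>b\<in>B. nB b * nC b) \<le> 2 * real (card B) * miss E A B C / real (card A)"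
    using pos by (simp add: pos_le_divide_eq mult.commute)
  define \<gamma> where "\<gamma> b = nC b / real (card C)" for b
  have nC: "0 \<le> nC b" "nC b \<le> real (card C)" for b
  proof -
    show "0 \<le> nC b"
      unfolding nC_def by (intro sum_nonneg) simp
    have "nC b \<le> (\<Sum>c\<in>C. 1)"
      unfolding nC_def by (intro sum_mono) simp
    then show "nC b \<le> real (card C)" by simp
  qed
  have \<gamma>: "0 \<le> \<gamma> b" "\<gamma> b \<le> 1" for b
    using nC[of b] pos by (simp_all add: \<gamma>_def)
  have S\<gamma>: "(\<Sum>b\<in>B. 1 - \<gamma> b) = real (card B) - link E u B C / real (card C)"
    by (simp add: \<gamma>_def sum_subtractf sum_divide_distrib[symmetric] nC_def link_def)
  \<comment> \<open>The factor equals 1 + \<gamma> b * \<gamma> b', hence is at least 1.\<close>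
  have "link E u B B \<le> (\<Sum>b\<in>B. \<Sum>b'\<in>B. ((1 - \<gamma> b) * (1 - \<gamma> b') + \<gamma> b + \<gamma> b') * of_bool (E u b b'))"
    unfolding link_def
  proof (intro sum_mono)
    fix b b'
    have "1 \<le> (1 - \<gamma> b) * (1 - \<gamma> b') + \<gamma> b + \<gamma> b'"
      using mult_nonneg_nonneg[OF \<gamma>(1)[of b] \<gamma>(1)[of b']] by (simp add: algebra_simps)
    then show "of_bool (E u b b') \<le> ((1 - \<gamma> b) * (1 - \<gamma> b') + \<gamma> b + \<gamma> b') * of_bool (E u b b')"
      by simp
  qed
  also have "\<dots> = (\<Sum>b\<in>B. \<Sum>b'\<in>B. (1 - \<gamma> b) * (1 - \<gamma> b') * of_bool (E u b b'))
     + (\<Sum>b\<in>B. \<Sum>b'\<in>B. \<gamma> b * of_bool (E u b b')) + (\<Sum>b\<in>B. \<Sum>b'\<in>B. \<gamma> b' * of_bool (E u b b'))"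
    by (simp only: distrib_right sum.distrib)
  also have "(\<Sum>b\<in>B. \<Sum>b'\<in>B. \<gamma> b' * of_bool (E u b b')) = (\<Sum>b\<in>B. \<Sum>b'\<in>B. \<gamma> b * of_bool (E u b b'))"
    by (subst sum.swap) (simp add: good_commute(2)[OF g, of u])
  also have "(\<Sum>b\<in>B. \<Sum>b'\<in>B. \<gamma> b * of_bool (E u b b')) = (\<Sum>b\<in>B. nB b * nC b) / real (card C)"
    by (simp add: sum_divide_distrib \<gamma>_def nB_def sum_distrib_left sum_distrib_right mult_ac)
  also have "(\<Sum>b\<in>B. \<Sum>b'\<in>B. (1 - \<gamma> b) * (1 - \<gamma> b') * of_bool (E u b b')) \<le> (\<Sum>b\<in>B. 1 - \<gamma> b)\<^sup>2 / 2"
  proof (rule weighted_mantel[OF fin(2)])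
    show "E u x y \<Longrightarrow> E u y x" for x y
      using good_sym2[OF g] .
    show "E u x y \<Longrightarrow> E u x z \<Longrightarrow> E u y z \<Longrightarrow> False" for x y z
      using good_K4[OF g] .
  qed (use \<gamma> in auto)
  finally have "link E u B B \<le> (real (card B) - link E u B C / real (card C))\<^sup>2 / 2
     + (\<Sum>b\<in>B. nB b * nC b) / real (card C) + (\<Sum>b\<in>B. nB b * nC b) / real (card C)"
    unfolding S\<gamma> by simp
  moreover have "(\<Sum>b\<in>B. nB b * nC b) / real (card C) \<le> 2 * real (card B) * miss E A B C / real (card A) / real (card C)"
    using 1 pos by (intro divide_right_mono) auto
  moreover have "4 * real (card B) * miss E A B C / (real (card A) * real (card C))
     = 2 * (2 * real (card B) * miss E A B C / real (card A) / real (card C))"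
    by simp
  ultimately show ?thesis
    by linarith
qed

lemma link_split:
  assumes g: "good E" and V: "finite V" "V = V0 \<union> V1 \<union> V2 \<union> V3"
    and d: "V1 \<inter> V2 = {}" "V1 \<inter> V3 = {}" "V2 \<inter> V3 = {}" "V0 \<inter> (V1 \<union> V2 \<union> V3) = {}"
  shows "link E u V V \<le> 2 * real (card V0) * real (card V) + 2 * (link E u V1 V2 + link E u V1 V3 + link E u V2 V3)
     + (link E u V1 V1 + link E u V2 V2 + link E u V3 V3)"
proof -
  let ?W = "V1 \<union> V2 \<union> V3"
  have fin: "finite V0" "finite V1" "finite V2" "finite V3"
    using V by auto
  have "link E u V V = link E u V0 V + link E u ?W V"
    using fin d(4) link_Un1[of V0 ?W E u V] V(2) by (simp add: Un_assoc)
  also have "link E u ?W V = link E u ?W V0 + link E u ?W ?W"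
    using fin d(4) link_Un2[of V0 ?W E u ?W] V(2) by (simp add: Un_assoc)
  also have "link E u ?W V0 \<le> real (card V) * real (card V0)"
  proof -
    have "card ?W \<le> card V"
      using V by (intro card_mono) auto
    then show ?thesis
      using link_le[of E u ?W V0] by (smt (verit) mult_right_mono of_nat_0_le_iff of_nat_mono)
  qed
  also have "link E u V0 V \<le> real (card V0) * real (card V)"
    by (rule link_le)
  also have "link E u ?W ?W = 2 * (link E u V1 V2 + link E u V1 V3 + link E u V2 V3) + (link E u V1 V1 + link E u V2 V2 + link E u V3 V3)"
    using fin d link_commute[OF g, of u V2 V1] link_commute[OF g, of u V3 V1] link_commute[OF g, of u V3 V2]
    by (simp add: link_Un1 link_Un2 Int_Un_distrib Int_Un_distrib2)
  finally show ?thesis by (simp add: algebra_simps)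
qed

section \<open>The vertex partition around a core edge\<close>

text \<open>Replacing b and c by their mean bounds the defect below by 27/4 * x^2 * (s + x) with x =
  s/3 - a. The estimate is applied twice: s + x at least 49/150 first confines x, and then s + x is
  at least 9126/10000, which gives the constant 6 and the window for a.\<close>

lemma balance:
  fixes a b c s :: real
  assumes nn: "0 \<le> a" "0 \<le> b" "0 \<le> c" and s: "s = a + b + c" "49/50 \<le> s" "s \<le> 1"
    and im: "s ^ 3 - 27 * a * b * c \<le> 1/100"
  shows "6 * (s / 3 - a)\<^sup>2 \<le> s ^ 3 - 27 * a * b * c" "143/500 \<le> a" "a \<le> 187/500"
proof -
  define x where "x = s / 3 - a"
  have "4 * (b * c) \<le> (s - a)\<^sup>2"
    using zero_le_power2[of "b - c"] by (simp add: s power2_eq_square algebra_simps)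
  then have "a * (4 * (b * c)) \<le> a * (s - a)\<^sup>2"
    using nn by (intro mult_left_mono)
  then have "s ^ 3 - 27 / 4 * (a * (s - a)\<^sup>2) \<le> s ^ 3 - 27 * a * b * c"
    by (simp add: mult_ac)
  moreover have "s ^ 3 - 27 / 4 * (a * (s - a)\<^sup>2) = 27 / 4 * (x\<^sup>2 * (s + x))"
    by (simp add: x_def power2_eq_square power3_eq_cube field_simps)
  ultimately have I: "27 / 4 * (x\<^sup>2 * (s + x)) \<le> s ^ 3 - 27 * a * b * c"
    by linarith
  have sx: "s / 3 \<le> s + x"
    unfolding x_def using nn s by linarith
  have "x\<^sup>2 * (49/150) \<le> x\<^sup>2 * (s + x)"
    using sx s by (intro mult_left_mono) auto
  then have "x\<^sup>2 \<le> (674 / 10000)\<^sup>2"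
    using I im by (simp add: power2_eq_square)
  then have "\<bar>x\<bar> \<le> 674 / 10000"
    by (rule power2_le_imp_le[of "\<bar>x\<bar>", simplified]) simp
  then have "x\<^sup>2 * (9126 / 10000) \<le> x\<^sup>2 * (s + x)"
    using s by (intro mult_left_mono) auto
  then have 2: "615 / 100 * x\<^sup>2 \<le> s ^ 3 - 27 * a * b * c"
    using I zero_le_power2[of x] by linarith
  then show "6 * (s / 3 - a)\<^sup>2 \<le> s ^ 3 - 27 * a * b * c"
    unfolding x_def[symmetric] using zero_le_power2[of x] by linarith
  have "x\<^sup>2 \<le> (4034 / 100000)\<^sup>2"
    using 2 im by (simp add: power2_eq_square)
  then have "\<bar>x\<bar> \<le> 4034 / 100000"
    by (rule power2_le_imp_le[of "\<bar>x\<bar>", simplified]) simp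
  then have "x \<le> 4034 / 100000" "- x \<le> 4034 / 100000"
    by (simp_all add: abs_le_iff)
  then show "143/500 \<le> a" "a \<le> 187/500"
    using s(2,3) unfolding x_def by argo+
qed

text \<open>Here l is the densest of the three cross links of a vertex and p its density. A link
  spread over several pairs of classes is limited by \<open>link_product\<close>, one inside a class
  by cloning or by Mantel; if p were below 3/4 these bounds would leave the degree under dens -
  1/1000.\<close>

lemma class_numeric:
  fixes v0 v1 v2 v3 M d l l12 l13 I1 I2 I3 lam p s :: real
  assumes nn: "0 \<le> v0" "0 \<le> v1" "0 \<le> v2" "0 \<le> v3" "0 \<le> M" "0 \<le> d" "0 \<le> l12" "0 \<le> l13"
    and s: "s = v1 + v2 + v3" "v0 + s = 1"
    and bud: "v0 + 60 * M + 2 * (s ^ 3 - 27 * v1 * v2 * v3) + 8 * d \<le> 1/50"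
    and im0: "0 \<le> s ^ 3 - 27 * v1 * v2 * v3"
    and lam: "1/4 \<le> lam"
    and deg: "lam - 1/1000 \<le> 2 * v0 + 2 * (l12 + l13 + l) + I1 + I2 + I3"
    and l: "l12 \<le> l" "l13 \<le> l" "l12 * l \<le> 2 * M * v2" "l13 * l \<le> 2 * M * v3"
    and lp: "l = p * (v2 * v3)" "p \<le> 1"
    and I1: "I1 \<le> lam * (v1\<^sup>2 + v1 / 40 + 1/4800) + 40/3 * d"
    and I2: "I2 \<le> (v2 - p * v2)\<^sup>2 / 2 + 4 * M * v2 / (v1 * v3)"
    and I3: "I3 \<le> (v3 - p * v3)\<^sup>2 / 2 + 4 * M * v3 / (v1 * v2)"
  shows "3/4 \<le> p"
proof (rule ccontr)
  assume np: "\<not> 3/4 \<le> p"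
  define im where "im = s ^ 3 - 27 * v1 * v2 * v3"
  define \<kappa> where "\<kappa> = v1\<^sup>2 + v1 / 40 + 1/4800"
  define x where "x = s / 3 - v1"
  have s1: "49/50 \<le> s" "s \<le> 1" and im: "im \<le> 1/100"
    using bud nn im0 s(2) by (simp_all add: im_def)
  have b1: "6 * x\<^sup>2 \<le> im" "143/500 \<le> v1" "v1 \<le> 187/500"
    using balance[OF nn(2,3,4) s(1) s1] im unfolding im_def x_def by auto
  have b2: "6 * (s / 3 - v2)\<^sup>2 \<le> im" "143/500 \<le> v2" "v2 \<le> 187/500"
    using balance[OF nn(3,2,4) _ s1] im s(1) unfolding im_def by (auto simp: mult_ac)
  have b3: "6 * (s / 3 - v3)\<^sup>2 \<le> im" "143/500 \<le> v3" "v3 \<le> 187/500"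
    using balance[OF nn(4,2,3) _ s1] im s(1) unfolding im_def by (auto simp: mult_ac)
  have quot: "4 * M * b / (a * c) \<le> 37 / 2 * M" if "143/500 \<le> a" "143/500 \<le> c" "b \<le> 187/500" for a b c
  proof -
    have "143/500 * (143/500) \<le> a * c"
      using that by (intro mult_mono) auto
    then have 1: "4 * b \<le> 37/2 * (a * c)" and "0 < a * c"
      using that by auto
    then show ?thesis
      using mult_left_mono[OF 1 nn(5)] by (simp add: pos_divide_le_eq mult_ac)
  qed
  note q2 = quot[OF b1(2) b3(2) b2(3)] and q3 = quot[OF b1(2) b2(2) b3(3)]
  have \<kappa>: "\<kappa> \<le> 1"
  proof -
    have "v1\<^sup>2 \<le> (1/2)\<^sup>2"
      using b1 nn by (intro power_mono) auto
    then show ?thesis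
      using b1 by (simp add: \<kappa>_def power2_eq_square)
  qed
  have "1/4 * (1 - \<kappa>) \<le> lam * (1 - \<kappa>)"
    using lam \<kappa> by (intro mult_right_mono) auto
  then have link: "1/4 - 1/4 * \<kappa> \<le> lam - lam * \<kappa>"
    unfolding right_diff_distrib by simp
  define J where "J = (v2 - p * v2)\<^sup>2 / 2 + (v3 - p * v3)\<^sup>2 / 2"
  \<comment> \<open>Subtracting twice the budget from the degree inequality leaves 83 = 120 - 37
    copies of M, where each of I2, I3 has used 37/2.\<close>
  have main: "249/1000 - 1/4 * \<kappa> \<le> 1/25 - 83 * M - 4 * im + 2 * (l12 + l13) + 2 * l + J"
  proof -
    define J2 J3 K where "J2 = (v2 - p * v2)\<^sup>2 / 2" and "J3 = (v3 - p * v3)\<^sup>2 / 2" and "K = lam * \<kappa>"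
    have "I2 \<le> J2 + 37/2 * M" "I3 \<le> J3 + 37/2 * M" "I1 \<le> K + 40/3 * d" "J = J2 + J3"
      using I1 I2 I3 q2 q3 by (simp_all add: J_def J2_def J3_def K_def \<kappa>_def)
    then show ?thesis
      using deg link bud nn(6) unfolding im_def[symmetric] K_def[symmetric] by argo
  qed
  have cross: "55 * ((l12 + l13) * l) \<le> 83 * M"
  proof -
    have "M * v2 \<le> M * (187/500)" "M * v3 \<le> M * (187/500)"
      using b2 b3 nn by (intro mult_left_mono; simp)+
    then show ?thesis
      using l(3,4) nn(5) by (simp add: distrib_right)
  qed
  have l0: "0 \<le> l"
    using l nn by linarith
  have v1: "v1 = s / 3 - x"
    by (simp add: x_def)
  have x: "\<bar>x\<bar> \<le> 409/10000"
  proof -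
    have "x\<^sup>2 \<le> (409/10000)\<^sup>2"
      using b1(1) im by (simp add: power2_eq_square)
    then show ?thesis
      by (rule power2_le_imp_le[of "\<bar>x\<bar>", simplified]) simp
  qed
  show False
  \<comment> \<open>For small l the gain of all cross links is bounded directly. For l at least 1/20
    the two smaller cross links are paid for by the missing triples, since 55 l exceeds 2, and p is
    bounded away from 0.\<close>
  proof (cases "l < 1/20")
    case True
    have J: "J \<le> (v2\<^sup>2 + v3\<^sup>2) / 2 - l"
    proof -
      have "0 < v2 * v3"
        using b2 b3 by simp
      then have p0: "0 \<le> p"
        using l0 lp(1) by (auto simp: zero_le_mult_iff)
      then have "p * p \<le> p * 1"
        using lp(2) by (intro mult_left_mono)
      then have "(1 - p)\<^sup>2 \<le> 1 - p"
        by (simp add: power2_eq_square algebra_simps)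
      then have "(v2\<^sup>2 + v3\<^sup>2) * (1 - p)\<^sup>2 \<le> (v2\<^sup>2 + v3\<^sup>2) * (1 - p)"
        by (intro mult_left_mono) auto
      moreover have "p * (2 * (v2 * v3)) \<le> p * (v2\<^sup>2 + v3\<^sup>2)"
        using zero_le_power2[of "v2 - v3"] p0 by (intro mult_left_mono) (auto simp: power2_eq_square algebra_simps)
      moreover have "J = (v2\<^sup>2 + v3\<^sup>2) * (1 - p)\<^sup>2 / 2"
        by (simp add: J_def power2_eq_square field_simps)
      ultimately show ?thesis
        using lp(1) by (simp add: algebra_simps)
    qed
    \<comment> \<open>By l12 + l13 \<le> 2 l the left side is at most 5 l - 110 l^2, whose maximum
      5/88 is attained at l = 1/44.\<close>
    have "2 * (l12 + l13) + l - 55 * ((l12 + l13) * l) \<le> 5683/100000"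
    proof (cases "55 * l \<le> 2")
      case True
      have "(l12 + l13) * (2 - 55 * l) \<le> (2 * l) * (2 - 55 * l)"
        using True l by (intro mult_right_mono) auto
      moreover have "0 \<le> (l - 1/44)\<^sup>2"
        by simp
      ultimately show ?thesis
        by (simp add: power2_eq_square algebra_simps)
    next
      case False
      have "(l12 + l13) * (2 - 55 * l) \<le> 0"
        using False nn by (intro mult_nonneg_nonpos) auto
      then show ?thesis
        using True by (simp add: algebra_simps)
    qed
    moreover have "(v2\<^sup>2 + v3\<^sup>2) / 2 + 1/4 * \<kappa> \<le> 152/1000"
    proof -
      have "(v2\<^sup>2 + v3\<^sup>2) = 2 / 9 * s\<^sup>2 + 2 / 3 * (s * x) + (s / 3 - v2)\<^sup>2 + (s / 3 - v3)\<^sup>2"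
        unfolding x_def s(1) by (simp add: power2_eq_square field_simps)
      moreover have "\<kappa> = s\<^sup>2 / 9 - 2 / 3 * (s * x) + x\<^sup>2 + s / 120 - x / 40 + 1 / 4800"
        unfolding \<kappa>_def v1 by (simp add: power2_eq_square field_simps)
      moreover have "s\<^sup>2 \<le> 1"
        using s1 by (simp add: power_le_one)
      moreover have "s * x \<le> 409/10000"
      proof -
        have "s * x \<le> s * \<bar>x\<bar>"
          using s1 by (intro mult_left_mono) auto
        moreover have "s * \<bar>x\<bar> \<le> 1 * \<bar>x\<bar>"
          using s1 by (intro mult_right_mono) auto
        ultimately show ?thesis using x by simp
      qed
      moreover have "- x \<le> 409/10000"
        using x by linarith
      ultimately show ?thesis
        using b1(1) b2(1) b3(1) im s1 by argo
    qed
    ultimately show False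
      using main J cross b1(1) zero_le_power2[of x] by argo
  next
    case False
    have q: "v2 + v3 = 2 * s / 3 + x"
      using s(1) unfolding x_def by argo
    have "4 * (v2 * v3) \<le> (v2 + v3)\<^sup>2"
      using zero_le_power2[of "v2 - v3"] by (simp add: power2_eq_square algebra_simps)
    moreover have "(v2 + v3)\<^sup>2 \<le> (714/1000)\<^sup>2"
      using s(1) s1 b1 nn by (intro power_mono) auto
    ultimately have "v2 * v3 \<le> 13/100"
      by (simp add: power2_eq_square)
    have p: "7/20 \<le> p"
    proof (rule ccontr)
      assume "\<not> 7/20 \<le> p"
      then have "p * (v2 * v3) \<le> 7/20 * (v2 * v3)"
        using b2 b3 by (intro mult_right_mono) auto
      then show False
        using False lp(1) \<open>v2 * v3 \<le> 13/100\<close> by linarith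
    qed
    have "(1 - p)\<^sup>2 \<le> (13/20)\<^sup>2"
      using p lp(2) by (intro power_mono) auto
    then have "(v2 - v3)\<^sup>2 * (1 - p)\<^sup>2 \<le> (v2 - v3)\<^sup>2 * (2 * p)"
      using p by (intro mult_left_mono) (auto simp: power2_eq_square)
    then have "2 * l + J \<le> (v2 + v3)\<^sup>2 / 4 * (1 + p\<^sup>2)"
      unfolding lp(1) J_def by (simp add: power2_eq_square field_simps)
    also have "\<dots> \<le> (v2 + v3)\<^sup>2 / 4 * (25/16)"
    proof (intro mult_left_mono)
      have "p\<^sup>2 \<le> (3/4)\<^sup>2"
        using np p by (intro power_mono) auto
      then show "1 + p\<^sup>2 \<le> 25/16"
        by (simp add: power2_eq_square)
    qed simp
    also have "(v2 + v3)\<^sup>2 \<le> (2/3 + x)\<^sup>2"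
      unfolding q using s1 x by (intro power_mono) (auto simp: abs_le_iff)
    finally have "2 * l + J \<le> 25/64 * (2/3 + x)\<^sup>2"
      by simp
    moreover have "\<kappa> \<le> (1/3 - x)\<^sup>2 + (1/3 - x) / 40 + 1/4800"
    proof -
      have "v1\<^sup>2 \<le> (1/3 - x)\<^sup>2"
        using nn s1 v1 by (intro power_mono) auto
      then show ?thesis
        using s1 v1 unfolding \<kappa>_def by argo
    qed
    moreover have "2 * (l12 + l13) \<le> 83 * M"
    proof -
      have "(l12 + l13) * (2 - 55 * l) \<le> 0"
        using False nn by (intro mult_nonneg_nonpos) auto
      then show ?thesis
        using cross by (simp add: algebra_simps)
    qed
    \<comment> \<open>What remains is a concave quadratic in the imbalance x, the leading term
      coming from 4 * im \<ge> 24 x^2; its maximum is near 3/400.\<close>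
    moreover have "(2/3 + x)\<^sup>2 = 4/9 + 4/3 * x + x\<^sup>2" "(1/3 - x)\<^sup>2 = 1/9 - 2/3 * x + x\<^sup>2"
      "(x - 3/400)\<^sup>2 = x\<^sup>2 - 3/200 * x + 9/160000"
      by (simp_all add: power2_eq_square field_simps)
    moreover have "0 \<le> (x - 3/400)\<^sup>2"
      by simp
    moreover have "- x \<le> 409/10000" "x \<le> 409/10000"
      using x by linarith+
    ultimately show False
      using main b1(1) by argo
  qed
qed

lemma sum_cube_ge:
  fixes a b c :: real
  assumes "0 \<le> a" "0 \<le> b" "0 \<le> c"
  shows "24 * (a * b * c) \<le> (a + b + c) ^ 3 - (a ^ 3 + b ^ 3 + c ^ 3)"
    and "27 * a * b * c \<le> (a + b + c) ^ 3"
proof -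
  have 1: "0 \<le> a * (b - c)\<^sup>2 + b * (a - c)\<^sup>2 + c * (a - b)\<^sup>2"
    using assms by simp
  have 2: "0 \<le> (a + b + c) * ((a - b)\<^sup>2 + (a - c)\<^sup>2 + (b - c)\<^sup>2)"
    using assms by simp
  show "24 * (a * b * c) \<le> (a + b + c) ^ 3 - (a ^ 3 + b ^ 3 + c ^ 3)"
    using 1 by (simp add: power2_eq_square power3_eq_cube algebra_simps)
  show "27 * a * b * c \<le> (a + b + c) ^ 3"
    using 1 2 by (simp add: power2_eq_square power3_eq_cube algebra_simps)
qed

text \<open>Everything is normalised by powers of \<open>card V\<close>. The last inequality is what \<open>core_edge\<close> gives after division by
  450; divisibility by 40 allows \<open>card V / 40\<close> clones of a vertex.\<close>

definition core :: "('a \<Rightarrow> 'a \<Rightarrow> 'a \<Rightarrow> bool) \<Rightarrow> 'a set \<Rightarrow> 'a set \<Rightarrow> 'a set \<Rightarrow> 'a set \<Rightarrow> bool" where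
  "core E V A B C \<longleftrightarrow> good E \<and> finite V \<and> V \<noteq> {} \<and> A \<subseteq> V \<and> B \<subseteq> V \<and> C \<subseteq> V \<and>
     A \<inter> B = {} \<and> A \<inter> C = {} \<and> B \<inter> C = {} \<and> 40 dvd card V \<and> 1/4 \<le> dens \<and>
     (\<forall>u\<in>V. dens - 1/1000 \<le> link E u V V / real (card V) ^ 2) \<and>
     real (card (V - (A \<union> B \<union> C))) / real (card V) + 60 * (miss E A B C / real (card V) ^ 3)
     + 2 * ((real (card A) / real (card V) + real (card B) / real (card V) + real (card C) / real (card V)) ^ 3
         - 27 * (real (card A) / real (card V)) * (real (card B) / real (card V)) * (real (card C) / real (card V)))
     + 8 * ((dens * real (card A) ^ 3 - nedge E A) / real (card V) ^ 3
         + (dens * real (card B) ^ 3 - nedge E B) / real (card V) ^ 3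
         + (dens * real (card C) ^ 3 - nedge E C) / real (card V) ^ 3) \<le> 1/50"

section \<open>Sizes and links in a core\<close>

lemma core_swap:
  assumes "core E V A B C" shows "core E V B A C" "core E V A C B"
proof -
  have g: "good E"
    using assms by (simp add: core_def)
  have u: "B \<union> A \<union> C = A \<union> B \<union> C" "A \<union> C \<union> B = A \<union> B \<union> C"
    by auto
  show "core E V B A C"
    using assms unfolding core_def u miss_swap(1)[OF g, of B A C] by (auto simp: Int_commute add_ac mult_ac)
  show "core E V A C B"
    using assms unfolding core_def u miss_swap(2)[OF g, of A C B] by (auto simp: Int_commute add_ac mult_ac)
qed

lemma core_sizes:
  fixes V :: "'a set"
  assumes core: "core E V A B C"
  defines "n \<equiv> real (card V)"
  shows "0 < n" "finite A" "finite B" "finite C"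
    "143/500 * n \<le> real (card A)" "real (card A) \<le> 187/500 * n"
    "3000 * miss E A B C \<le> n ^ 3"
    "real (card (V - (A \<union> B \<union> C))) / n + 60 * (miss E A B C / n ^ 3) \<le> 1/50"
    "(real (card A) / n + real (card B) / n + real (card C) / n) ^ 3
         - 27 * (real (card A) / n) * (real (card B) / n) * (real (card C) / n) \<le> 1/100"
    "49/50 \<le> real (card A) / n + real (card B) / n + real (card C) / n"
    "real (card (V - (A \<union> B \<union> C))) / n + (real (card A) / n + real (card B) / n + real (card C) / n) = 1"
proof -
  have c: "good E" "finite V" "V \<noteq> {}" "A \<subseteq> V" "B \<subseteq> V" "C \<subseteq> V" "A \<inter> B = {}" "A \<inter> C = {}" "B \<inter> C = {}"
    and bud: "real (card (V - (A \<union> B \<union> C))) / n + 60 * (miss E A B C / n ^ 3)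
     + 2 * ((real (card A) / n + real (card B) / n + real (card C) / n) ^ 3
         - 27 * (real (card A) / n) * (real (card B) / n) * (real (card C) / n))
     + 8 * ((dens * real (card A) ^ 3 - nedge E A) / n ^ 3
         + (dens * real (card B) ^ 3 - nedge E B) / n ^ 3
         + (dens * real (card C) ^ 3 - nedge E C) / n ^ 3) \<le> 1/50"
    using core by (auto simp: core_def n_def)
  show n: "0 < n" and fin: "finite A" "finite B" "finite C"
    using c by (auto simp: n_def card_gt_0_iff finite_subset)
  have def0: "0 \<le> (dens * real (card X) ^ 3 - nedge E X) / n ^ 3" if "finite X" for X
    using nedge_le_dens[OF c(1) that] n by simp
  have m0: "0 \<le> miss E A B C / n ^ 3" and v0: "0 \<le> real (card (V - (A \<union> B \<union> C))) / n"
    using miss_nonneg[of E A B C] n by auto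
  have im0: "0 \<le> (real (card A) / n + real (card B) / n + real (card C) / n) ^ 3
         - 27 * (real (card A) / n) * (real (card B) / n) * (real (card C) / n)"
    using sum_cube_ge(2)[of "real (card A) / n" "real (card B) / n" "real (card C) / n"] n by simp
  note pos = def0[OF fin(1)] def0[OF fin(2)] def0[OF fin(3)] m0 v0 im0
  show "real (card (V - (A \<union> B \<union> C))) / n + 60 * (miss E A B C / n ^ 3) \<le> 1/50"
    using bud pos by argo
  show im: "(real (card A) / n + real (card B) / n + real (card C) / n) ^ 3
         - 27 * (real (card A) / n) * (real (card B) / n) * (real (card C) / n) \<le> 1/100"
    using bud pos by argo
  have "60 * (miss E A B C / n ^ 3) \<le> 1/50" "real (card (V - (A \<union> B \<union> C))) / n \<le> 1/50"
    using bud pos by argo+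
  then show "3000 * miss E A B C \<le> n ^ 3"
    using n by (simp add: pos_divide_le_eq)
  have "card V = card (V - (A \<union> B \<union> C)) + (card A + card B + card C)"
  proof -
    have "card (A \<union> B \<union> C) = card A + card B + card C"
      using c fin by (simp add: card_Un_disjoint Int_Un_distrib2)
    moreover have "card (V - (A \<union> B \<union> C)) = card V - card (A \<union> B \<union> C)"
      using c fin by (intro card_Diff_subset) auto
    moreover have "card (A \<union> B \<union> C) \<le> card V"
      using c by (intro card_mono) auto
    ultimately show ?thesis by simp
  qed
  then have "n = real (card (V - (A \<union> B \<union> C))) + (real (card A) + real (card B) + real (card C))"
    by (simp add: n_def)
  then show s: "real (card (V - (A \<union> B \<union> C))) / n + (real (card A) / n + real (card B) / n + real (card C) / n) = 1"
    using n by (simp add: add_divide_distrib[symmetric])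
  then show s1: "49/50 \<le> real (card A) / n + real (card B) / n + real (card C) / n"
    using \<open>real (card (V - (A \<union> B \<union> C))) / n \<le> 1/50\<close> by argo
  have s2: "real (card A) / n + real (card B) / n + real (card C) / n \<le> 1"
    using s v0 by argo
  have "143/500 \<le> real (card A) / n" "real (card A) / n \<le> 187/500"
    using balance(2,3)[OF _ _ _ refl s1 s2 im] n by auto
  then show "143/500 * n \<le> real (card A)" "real (card A) \<le> 187/500 * n"
    using n by (simp_all add: pos_le_divide_eq pos_divide_le_eq)
qed

text \<open>The hypotheses of \<open>class_numeric\<close>, obtained by dividing the combinatorial
  inequalities by powers of card V.\<close>

lemma core_link_max:
  fixes V :: "'a set"
  assumes core: "core E V A B C" and u: "u \<in> V" and max: "link E u A B \<le> link E u B C" "link E u A C \<le> link E u B C"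
  shows "3/4 * (real (card B) * real (card C)) \<le> link E u B C"
proof -
  define n where "n = real (card V)"
  have c: "good E" "finite V" "V \<noteq> {}" "A \<subseteq> V" "B \<subseteq> V" "C \<subseteq> V" "A \<inter> B = {}" "A \<inter> C = {}" "B \<inter> C = {}"
    and d40: "40 dvd card V" and dens: "1/4 \<le> dens"
    and deg: "dens - 1/1000 \<le> link E u V V / n ^ 2"
    and bud: "real (card (V - (A \<union> B \<union> C))) / n + 60 * (miss E A B C / n ^ 3)
     + 2 * ((real (card A) / n + real (card B) / n + real (card C) / n) ^ 3
         - 27 * (real (card A) / n) * (real (card B) / n) * (real (card C) / n))
     + 8 * ((dens * real (card A) ^ 3 - nedge E A) / n ^ 3
         + (dens * real (card B) ^ 3 - nedge E B) / n ^ 3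
         + (dens * real (card C) ^ 3 - nedge E C) / n ^ 3) \<le> 1/50"
    using core u by (auto simp: core_def n_def)
  note sz = core_sizes[OF core, folded n_def] and szB = core_sizes[OF core_swap(1)[OF core], folded n_def]
    and szC = core_sizes[OF core_swap(1)[OF core_swap(2)[OF core]], folded n_def]
  have n: "0 < n" and fin: "finite A" "finite B" "finite C"
    using sz by auto
  have pos: "0 < real (card A)" "0 < real (card B)" "0 < real (card C)"
    using sz(5) szB(5) szC(5) n by argo+
  define v0 a b k where "v0 = real (card (V - (A \<union> B \<union> C))) / n" and "a = real (card A) / n"
    and "b = real (card B) / n" and "k = real (card C) / n"
  define M d where "M = miss E A B C / n ^ 3" and "d = (dens * real (card A) ^ 3 - nedge E A) / n ^ 3"
  define l where "l = link E u B C / n ^ 2"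
  define p where "p = link E u B C / (real (card B) * real (card C))"
  have def0: "0 \<le> (dens * real (card X) ^ 3 - nedge E X) / n ^ 3" if "finite X" for X
    using nedge_le_dens[OF c(1) that] n by simp
  have "3/4 \<le> p"
  proof (rule class_numeric[where ?v0.0 = v0 and ?v1.0 = a and ?v2.0 = b and ?v3.0 = k and M = M and d = d and s = "a + b + k"
        and l = l and ?l12.0 = "link E u A B / n ^ 2" and ?l13.0 = "link E u A C / n ^ 2" and ?I1.0 = "link E u A A / n ^ 2"
        and ?I2.0 = "link E u B B / n ^ 2" and ?I3.0 = "link E u C C / n ^ 2" and lam = dens])
    show "0 \<le> v0" "0 \<le> a" "0 \<le> b" "0 \<le> k" "0 \<le> M" "0 \<le> d" "0 \<le> link E u A B / n ^ 2" "0 \<le> link E u A C / n ^ 2"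
      using n miss_nonneg[of E A B C] link_nonneg[of E u A B] link_nonneg[of E u A C] def0[OF fin(1)]
      by (auto simp: v0_def a_def b_def k_def M_def d_def)
    show "a + b + k = a + b + k" ..
    show "v0 + (a + b + k) = 1"
      using sz(11) by (simp add: v0_def a_def b_def k_def)
    show "v0 + 60 * M + 2 * ((a + b + k) ^ 3 - 27 * a * b * k) + 8 * d \<le> 1 / 50"
      using bud def0[OF fin(2)] def0[OF fin(3)] unfolding v0_def a_def b_def k_def M_def d_def by argo
    show "0 \<le> (a + b + k) ^ 3 - 27 * a * b * k"
      using sum_cube_ge(2)[of a b k] n by (simp add: a_def b_def k_def)
    show "1/4 \<le> dens" by fact
    show "link E u A B / n ^ 2 \<le> l" "link E u A C / n ^ 2 \<le> l"
      using max n by (auto simp: l_def divide_right_mono)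
    show "link E u A B / n\<^sup>2 * l \<le> 2 * M * b"
    proof -
      have "link E u A B * link E u B C / n ^ 4 \<le> 2 * real (card B) * miss E A B C / n ^ 4"
        using link_product[OF c(1), of u A B C] n by (intro divide_right_mono) auto
      then show ?thesis
        by (simp add: l_def M_def b_def power2_eq_square power3_eq_cube power4_eq_xxxx mult_ac)
    qed
    show "link E u A C / n\<^sup>2 * l \<le> 2 * M * k"
    proof -
      have "link E u A C * link E u C B / n ^ 4 \<le> 2 * real (card C) * miss E A C B / n ^ 4"
        using link_product[OF c(1), of u A C B] n by (intro divide_right_mono) auto
      then show ?thesis
        unfolding link_commute[OF c(1), of u C B] miss_swap(2)[OF c(1), of A C B]
        by (simp add: l_def M_def k_def power2_eq_square power3_eq_cube power4_eq_xxxx mult_ac)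
    qed
    show "l = p * (b * k)"
      using pos n by (simp add: l_def p_def b_def k_def power2_eq_square)
    show "p \<le> 1"
      using link_le[of E u B C] pos by (simp add: p_def)
    show "dens - 1 / 1000 \<le> 2 * v0 + 2 * (link E u A B / n\<^sup>2 + link E u A C / n\<^sup>2 + l) + link E u A A / n\<^sup>2 + link E u B B / n\<^sup>2 + link E u C C / n\<^sup>2"
    proof -
      have "link E u V V \<le> 2 * real (card (V - (A \<union> B \<union> C))) * n + 2 * (link E u A B + link E u A C + link E u B C)
         + (link E u A A + link E u B B + link E u C C)"
        unfolding n_def using c by (intro link_split) auto
      then have "link E u V V / n\<^sup>2 \<le> (2 * real (card (V - (A \<union> B \<union> C))) * n + 2 * (link E u A B + link E u A C + link E u B C)
         + (link E u A A + link E u B B + link E u C C)) / n\<^sup>2"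
        using n by (intro divide_right_mono) auto
      also have "\<dots> = 2 * v0 + 2 * (link E u A B / n\<^sup>2 + link E u A C / n\<^sup>2 + l) + link E u A A / n\<^sup>2 + link E u B B / n\<^sup>2 + link E u C C / n\<^sup>2"
        using n by (simp add: v0_def l_def add_divide_distrib power2_eq_square)
      finally show ?thesis
        using deg by argo
    qed
    \<comment> \<open>Compare A with n/40 clones of u added against the density bound: (a + 1/40)^3
      - a^3 = 3/40 * (a^2 + a/40 + 1/4800), and dividing by 3/40 turns the defect d into 40/3 *
      d.\<close>
    show "link E u A A / n\<^sup>2 \<le> dens * (a\<^sup>2 + a / 40 + 1 / 4800) + 40 / 3 * d"
    proof -
      obtain q where q: "card V = 40 * q"
        using d40 by blast
      then have rq: "real q = n / 40"
        by (simp add: n_def)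
      have "nedge E A + 3 * (n / 40) * link E u A A \<le> dens * (real (card A) + n / 40) ^ 3"
        using clone_bound[OF c(1) fin(1), of q u] by (simp add: rq)
      then have "(nedge E A + 3 * (n / 40) * link E u A A) / n ^ 3 \<le> dens * (real (card A) + n / 40) ^ 3 / n ^ 3"
        using n by (intro divide_right_mono) auto
      moreover have "dens * (real (card A) + n / 40) ^ 3 / n ^ 3 = dens * (a + 1/40) ^ 3"
      proof -
        have "a + 1/40 = (real (card A) + n / 40) / n"
          using n by (simp add: a_def add_divide_distrib)
        then show ?thesis
          by (simp only: power_divide times_divide_eq_right)
      qed
      moreover have "(nedge E A + 3 * (n / 40) * link E u A A) / n ^ 3 = nedge E A / n ^ 3 + 3 / 40 * (link E u A A / n\<^sup>2)"
        using n by (simp add: add_divide_distrib power2_eq_square power3_eq_cube)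
      moreover have "d = dens * a ^ 3 - nedge E A / n ^ 3"
        by (simp add: d_def a_def diff_divide_distrib power_divide)
      ultimately have "3 / 40 * (link E u A A / n\<^sup>2) \<le> dens * (a + 1/40) ^ 3 - dens * a ^ 3 + d"
        by argo
      moreover have "dens * (a + 1/40) ^ 3 - dens * a ^ 3 = 3 / 40 * (dens * (a\<^sup>2 + a / 40 + 1 / 4800))"
        by (simp add: power2_eq_square power3_eq_cube field_simps)
      ultimately show ?thesis
        by argo
    qed
    have ins: "link E u X X / n\<^sup>2 \<le> (x - p * x)\<^sup>2 / 2 + 4 * M * x / (a * y)"
      if X: "finite X" "finite Y" "miss E A X Y = miss E A B C" "link E u X Y = link E u B C"
        "real (card X) * real (card Y) = real (card B) * real (card C)" "0 < real (card X)" "0 < real (card Y)"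
        "x = real (card X) / n" "y = real (card Y) / n" for X Y x y
    proof -
      have "link E u X X / n\<^sup>2 \<le> ((real (card X) - link E u X Y / real (card Y))\<^sup>2 / 2
         + 4 * real (card X) * miss E A X Y / (real (card A) * real (card Y))) / n\<^sup>2"
        using n X pos fin by (intro divide_right_mono link_inside[OF c(1)]) auto
      also have "\<dots> = (x - p * x)\<^sup>2 / 2 + 4 * M * x / (a * y)"
      proof -
        have "link E u X Y / real (card Y) = p * real (card X)"
          using X pos by (auto simp: p_def X(5)[symmetric])
        then have "(real (card X) - link E u X Y / real (card Y)) = n * (x - p * x)"
          using n X by (simp add: algebra_simps)
        then have "(real (card X) - link E u X Y / real (card Y))\<^sup>2 / 2 / n\<^sup>2 = (x - p * x)\<^sup>2 / 2"
          using n by (simp add: power_mult_distrib)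
        moreover have "4 * real (card X) * miss E A X Y / (real (card A) * real (card Y)) / n\<^sup>2 = 4 * M * x / (a * y)"
          using n X pos by (simp add: M_def a_def power2_eq_square power3_eq_cube mult_ac)
        ultimately show ?thesis
          by (simp only: add_divide_distrib)
      qed
      finally show ?thesis .
    qed
    show "link E u B B / n\<^sup>2 \<le> (b - p * b)\<^sup>2 / 2 + 4 * M * b / (a * k)"
      using fin pos by (intro ins[of B C]) (auto simp: b_def k_def)
    show "link E u C C / n\<^sup>2 \<le> (k - p * k)\<^sup>2 / 2 + 4 * M * k / (a * b)"
      using fin pos by (intro ins[of C B]) (auto simp: b_def k_def miss_swap(2)[OF c(1)] link_commute[OF c(1), of u C B])
  qed
  then show ?thesis
    using pos by (simp add: p_def pos_le_divide_eq)
qed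

lemma core_link:
  assumes core: "core E V A B C" and u: "u \<in> V"
  shows "3/4 * (real (card B) * real (card C)) \<le> link E u B C \<or> 3/4 * (real (card A) * real (card C)) \<le> link E u A C
    \<or> 3/4 * (real (card A) * real (card B)) \<le> link E u A B"
proof -
  note g = core[unfolded core_def, THEN conjunct1]
  note link = link_commute[OF g]
  consider "link E u A B \<le> link E u B C \<and> link E u A C \<le> link E u B C" | "link E u A B \<le> link E u A C \<and> link E u B C \<le> link E u A C"
    | "link E u A C \<le> link E u A B \<and> link E u B C \<le> link E u A B"
    by linarith
  then show ?thesis
  proof cases
    case 1
    then show ?thesis
      using core_link_max[OF core u] by blast
  next
    case 2
    then show ?thesis
      using core_link_max[OF core_swap(1)[OF core] u] link[of u A B] by auto
  next
    case 3
    then show ?thesis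
      using core_link_max[OF core_swap(1)[OF core_swap(2)[OF core]] u] link[of u C A] link[of u C B] by auto
  qed
qed

section \<open>The partition of all vertices by their links\<close>

text \<open>For a core with classes A, B, C this is the part of the partition associated with A: the
  vertices that behave like those of A, whether or not they belong to it. The other two parts arise
  from the pairs A, C and A, B.\<close>

definition dense_to :: "('a \<Rightarrow> 'a \<Rightarrow> 'a \<Rightarrow> bool) \<Rightarrow> 'a set \<Rightarrow> 'a set \<Rightarrow> 'a set \<Rightarrow> 'a set" where
  "dense_to E V B C = {u \<in> V. 3/4 * (real (card B) * real (card C)) \<le> link E u B C}"

lemma dense_to_commute: "good E \<Longrightarrow> dense_to E V C B = dense_to E V B C"
  by (simp add: dense_to_def link_commute[of E _ C B] mult.commute)

text \<open>\<open>link_product\<close> through the common class C: a dense link to A and C leaves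
  little room for one to C and B.\<close>

lemma dense_to_other:
  assumes core: "core E V A B C" and u: "u \<in> dense_to E V A C"
  shows "link E u B C \<le> 8/3 * miss E A B C / real (card A)"
proof -
  have g: "good E"
    using core by (simp add: core_def)
  note sz = core_sizes[OF core] and szB = core_sizes[OF core_swap(1)[OF core]]
    and szC = core_sizes[OF core_swap(1)[OF core_swap(2)[OF core]]]
  have pos: "0 < real (card A)" "0 < real (card B)" "0 < real (card C)"
    using sz(1,5) szB(5) szC(5) by argo+
  have "3/4 * (real (card A) * real (card C)) * link E u B C \<le> link E u A C * link E u B C"
    using u link_nonneg[of E u B C] by (intro mult_right_mono) (auto simp: dense_to_def)
  also have "\<dots> \<le> 2 * real (card C) * miss E A B C"
    using link_product[OF g, of u A C B] unfolding link_commute[OF g, of u C B] miss_swap(2)[OF g, of A C B] .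
  finally have "real (card C) * (3/4 * real (card A) * link E u B C) \<le> real (card C) * (2 * miss E A B C)"
    by (simp add: mult_ac)
  then have "3/4 * real (card A) * link E u B C \<le> 2 * miss E A B C"
    using pos by (simp add: mult_le_cancel_left)
  then show ?thesis
    using pos by (simp add: pos_le_divide_eq mult_ac)
qed

text \<open>At most n^3 / 3000 triples are missing and A has at least 143/500 * n vertices, so the
  ratio is below 32/10000 * n^2.\<close>

lemma dense_to_other_small:
  fixes V :: "'a set"
  assumes core: "core E V A B C" and u: "u \<in> dense_to E V A C"
  shows "link E u B C \<le> 32/10000 * real (card V) ^ 2"
proof -
  define n where "n = real (card V)"
  note sz = core_sizes[OF core, folded n_def]
  have "8/3 * miss E A B C \<le> 8/9000 * n ^ 3"
    using sz(7) by simp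
  also have "\<dots> \<le> 32/10000 * n ^ 2 * (143/500 * n)"
    using sz(1) by (simp add: power2_eq_square power3_eq_cube)
  also have "\<dots> \<le> 32/10000 * n ^ 2 * real (card A)"
    using sz(5) by (intro mult_left_mono) auto
  finally have "8/3 * miss E A B C / real (card A) \<le> 32/10000 * n ^ 2"
    using sz(1,5) by (subst pos_divide_le_eq) auto
  then show ?thesis
    using dense_to_other[OF core u] by (simp add: n_def)
qed

lemma dense_to_disjoint:
  fixes V :: "'a set"
  assumes core: "core E V A B C"
  shows "dense_to E V A C \<inter> dense_to E V B C = {}"
proof (rule ccontr)
  define n where "n = real (card V)"
  assume "\<not> ?thesis"
  then obtain u where u: "u \<in> dense_to E V A C" "3/4 * (real (card B) * real (card C)) \<le> link E u B C"
    by (auto simp: dense_to_def)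
  note sz = core_sizes[OF core, folded n_def] and szB = core_sizes[OF core_swap(1)[OF core], folded n_def]
    and szC = core_sizes[OF core_swap(1)[OF core_swap(2)[OF core]], folded n_def]
  have "143/500 * n * (143/500 * n) \<le> real (card B) * real (card C)"
    using sz(1) szB(5) szC(5) by (intro mult_mono) auto
  then have "3/4 * (143/500 * n * (143/500 * n)) \<le> 32/10000 * n ^ 2"
    using u(2) dense_to_other_small[OF core u(1)] by (simp add: n_def)
  moreover have "0 < n\<^sup>2"
    using sz(1) by simp
  ultimately show False
    by (simp add: power2_eq_square)
qed

lemma dense_to_cover:
  assumes core: "core E V A B C"
  shows "V = dense_to E V B C \<union> dense_to E V A C \<union> dense_to E V A B"
  using core_link[OF core] by (auto simp: dense_to_def)

lemma miss_link: "miss E A B C = (\<Sum>a\<in>A. real (card B) * real (card C) - link E a B C)"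
  unfolding miss_def link_def by (simp add: of_bool_not_iff sum_subtractf)

text \<open>A vertex of A in a foreign part has at most 32/10000 * n^2 link pairs in B and C, hence
  accounts for at least ((143/500)^2 - 32/10000) * n^2 missing triples, and this exceeds 100/1275 *
  n^2.\<close>

lemma omega_bound:
  fixes V :: "'a set"
  assumes core: "core E V A B C"
  shows "real (card (A - dense_to E V B C)) * real (card V) ^ 2 \<le> 1275/100 * miss E A B C"
proof -
  define n where "n = real (card V)"
  have g: "good E" and AV: "A \<subseteq> V"
    using core by (auto simp: core_def)
  note sz = core_sizes[OF core, folded n_def] and szB = core_sizes[OF core_swap(1)[OF core], folded n_def]
    and szC = core_sizes[OF core_swap(1)[OF core_swap(2)[OF core]], folded n_def]
  have "143/500 * n * (143/500 * n) \<le> real (card B) * real (card C)"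
    using sz(1) szB(5) szC(5) by (intro mult_mono) auto
  then have BC: "20449/250000 * n\<^sup>2 \<le> real (card B) * real (card C)"
    by (simp add: power2_eq_square)
  have le: "100/1275 * n\<^sup>2 \<le> real (card B) * real (card C) - link E a B C" if "a \<in> A - dense_to E V B C" for a
  proof -
    have "a \<in> dense_to E V A C \<or> a \<in> dense_to E V A B"
      using that dense_to_cover[OF core] AV by auto
    then have "link E a B C \<le> 32/10000 * n\<^sup>2"
      unfolding n_def using dense_to_other_small[OF core, of a] dense_to_other_small[OF core_swap(2)[OF core], of a] link_commute[OF g, of a B C] by auto
    moreover have "0 \<le> n\<^sup>2"
      by simp
    ultimately show ?thesis
      using BC by argo
  qed
  have "real (card (A - dense_to E V B C)) * (100/1275 * n\<^sup>2) = (\<Sum>a\<in>A - dense_to E V B C. 100/1275 * n\<^sup>2)"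
    by simp
  also have "\<dots> \<le> (\<Sum>a\<in>A - dense_to E V B C. real (card B) * real (card C) - link E a B C)"
    using le by (intro sum_mono)
  also have "\<dots> \<le> (\<Sum>a\<in>A. real (card B) * real (card C) - link E a B C)"
    using sz(2) link_le[of E _ B C] by (intro sum_mono2) auto
  finally show ?thesis
    unfolding miss_link n_def[symmetric] by simp
qed

text \<open>A pair \<open>b' c\<close> in the links of both \<open>a\<close> and \<open>a'\<close> excludes the edges \<open>abc\<close> and \<open>a'bc\<close> by the cycle on
  \<open>a', b', c, a, b\<close>; for every other \<open>c\<close> one of the two is missing.\<close>

lemma bad_pair:
  assumes g: "good E" and fin: "finite B" "finite C" and ne: "B \<noteq> {}"
    and a: "a \<in> dense_to E V B C" and a': "a' \<in> dense_to E V B C" and e: "E b a a'"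
  shows "3/2 * real (card C) \<le> (\<Sum>c\<in>C. of_bool (\<not> E a b c)) + (\<Sum>c\<in>C. of_bool (\<not> E a' b c))"
proof -
  define S where "S = {c \<in> C. \<exists>b'\<in>B. E a b' c \<and> E a' b' c}"
  have pos: "0 < real (card B)"
    using fin ne by (simp add: card_gt_0_iff)
  have "link E a B C + link E a' B C - real (card B) * real (card C) = (\<Sum>b'\<in>B. \<Sum>c\<in>C. of_bool (E a b' c) + of_bool (E a' b' c) - 1)"
    by (simp add: link_def sum.distrib sum_subtractf)
  also have "\<dots> \<le> (\<Sum>b'\<in>B. \<Sum>c\<in>C. of_bool (c \<in> S))"
  proof (intro sum_mono)
    fix b' c assume "b' \<in> B" "c \<in> C"
    then show "of_bool (E a b' c) + of_bool (E a' b' c) - 1 \<le> (of_bool (c \<in> S) :: real)"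
      by (auto simp: S_def)
  qed
  also have "\<dots> = real (card B) * (\<Sum>c\<in>C. of_bool (c \<in> S))"
    by simp
  finally have "1/2 * (real (card B) * real (card C)) \<le> real (card B) * (\<Sum>c\<in>C. of_bool (c \<in> S))"
    using a a' by (simp add: dense_to_def)
  then have "real (card B) * (1/2 * real (card C)) \<le> real (card B) * (\<Sum>c\<in>C. of_bool (c \<in> S))"
    by simp
  then have S: "1/2 * real (card C) \<le> (\<Sum>c\<in>C. of_bool (c \<in> S))"
    using pos by (simp only: mult_le_cancel_left_pos)
  have "real (card C) + (\<Sum>c\<in>C. of_bool (c \<in> S)) = (\<Sum>c\<in>C. 1 + of_bool (c \<in> S))"
    by (simp add: sum.distrib)
  also have "\<dots> \<le> (\<Sum>c\<in>C. of_bool (\<not> E a b c) + of_bool (\<not> E a' b c))"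
  proof (intro sum_mono)
    fix c
    have "\<not> (E a b c \<and> E a' b c)"
      using good_K4[OF g, of b a a' c] e good_commute[OF g] by metis
    moreover have "\<not> E a b c \<and> \<not> E a' b c" if "c \<in> S"
    proof -
      obtain b' where "E a b' c" "E a' b' c"
        using \<open>c \<in> S\<close> by (auto simp: S_def)
      then show ?thesis
        using good_C5[OF g, of a' b' c a b] good_C5[OF g, of a b' c a' b] e good_commute[OF g] by metis
    qed
    ultimately show "1 + of_bool (c \<in> S) \<le> (of_bool (\<not> E a b c) + of_bool (\<not> E a' b c) :: real)"
      by (cases "c \<in> S") auto
  qed
  finally show ?thesis
    using S by (simp add: sum.distrib)
qed

text \<open>Weight each a by the number m a of missing triples abc with c in C. By
  \<open>bad_pair\<close> both ends of a link pair inside the part of A have large weight, with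
  product at least k^2 / 2, so weighted Mantel gives k^2 * link \<le> S^2. One factor S is bounded
  by the density of b to A and C, the other by the missing triples that meet the actual part of
  C.\<close>

lemma bad_link:
  fixes V :: "'a set"
  assumes core: "core E V A B C" and b: "b \<in> dense_to E V A C"
  shows "(real (card C) - 2 * real (card (C - dense_to E V A B))) * link E b (dense_to E V B C) (dense_to E V B C)
    \<le> (real (card A) / 4 + real (card (dense_to E V B C - A)))
       * (\<Sum>a\<in>dense_to E V B C. \<Sum>c\<in>dense_to E V A B. of_bool (\<not> E a b c))"
proof (cases "0 \<le> real (card C) - 2 * real (card (C - dense_to E V A B))")
  case False
  have "0 \<le> (real (card A) / 4 + real (card (dense_to E V B C - A)))
       * (\<Sum>a\<in>dense_to E V B C. \<Sum>c\<in>dense_to E V A B. of_bool (\<not> E a b c))"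
    by (intro mult_nonneg_nonneg sum_nonneg) auto
  moreover have "(real (card C) - 2 * real (card (C - dense_to E V A B))) * link E b (dense_to E V B C) (dense_to E V B C) \<le> 0"
    using False link_nonneg by (intro mult_nonpos_nonneg) auto
  ultimately show ?thesis
    by linarith
next
  case True
  define U where "U = dense_to E V B C"
  define W where "W = dense_to E V A B"
  define k where "k = real (card C)"
  define \<omega> where "\<omega> = real (card (C - W))"
  define \<psi> where "\<psi> = real (card A) / 4 + real (card (U - A))"
  define m where "m a = (\<Sum>c\<in>C. of_bool (\<not> E a b c) :: real)" for a
  define m' where "m' a = (\<Sum>c\<in>W. of_bool (\<not> E a b c) :: real)" for a
  \<comment> \<open>Since m a is at most k and a link pair has total weight at least 3/2 * k, both
    its ends reach k/2.\<close>
  define \<Lambda> where "\<Lambda> = {a \<in> U. k \<le> 2 * m a}"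
  define S where "S = sum m \<Lambda>"
  have g: "good E" and V: "finite V" and AV: "A \<subseteq> V"
    using core by (auto simp: core_def)
  note sz = core_sizes[OF core] and szB = core_sizes[OF core_swap(1)[OF core]]
    and szC = core_sizes[OF core_swap(1)[OF core_swap(2)[OF core]]]
  have posC: "0 < real (card C)" and posB: "0 < real (card B)"
    using sz(1) szC(5) szB(5) by argo+
  then have k: "0 < k" and BC: "B \<noteq> {}" "C \<noteq> {}"
    by (auto simp: k_def)
  have fin: "finite U" "finite W" "finite C" "finite A" "finite B"
    using V sz by (auto simp: U_def W_def dense_to_def)
  have m0: "0 \<le> m a" and mk: "m a \<le> k" and m'0: "0 \<le> m' a" for a
  proof -
    show "0 \<le> m a" "0 \<le> m' a"
      unfolding m_def m'_def by (intro sum_nonneg; simp)+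
    have "m a \<le> (\<Sum>c\<in>C. 1)"
      unfolding m_def by (intro sum_mono) simp
    then show "m a \<le> k" by (simp add: k_def)
  qed
  have pair: "3/2 * k \<le> m a + m a'" if "a \<in> U" "a' \<in> U" "E b a a'" for a a'
    unfolding k_def m_def using bad_pair[OF g fin(5,3) BC(1) _ _ that(3)] that by (simp add: U_def)
  have "link E b U U = (\<Sum>a\<in>\<Lambda>. \<Sum>a'\<in>\<Lambda>. of_bool (E b a a'))"
  proof -
    have inner: "(\<Sum>a'\<in>U. of_bool (E b a a')) = (\<Sum>a'\<in>\<Lambda>. of_bool (E b a a') :: real)" if "a \<in> U" for a
    proof (rule sum.mono_neutral_right)
      show "\<forall>i\<in>U - \<Lambda>. of_bool (E b a i) = (0 :: real)"
      proof
        fix i assume i: "i \<in> U - \<Lambda>"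
        then have "\<not> E b a i"
          using pair[OF that, of i] mk[of a] by (auto simp: \<Lambda>_def)
        then show "of_bool (E b a i) = (0 :: real)" by simp
      qed
    qed (use fin in \<open>auto simp: \<Lambda>_def\<close>)
    have "link E b U U = (\<Sum>a\<in>U. \<Sum>a'\<in>\<Lambda>. of_bool (E b a a'))"
      unfolding link_def by (intro sum.cong refl inner)
    also have "\<dots> = (\<Sum>a\<in>\<Lambda>. \<Sum>a'\<in>\<Lambda>. of_bool (E b a a'))"
    proof (rule sum.mono_neutral_right)
      show "\<forall>i\<in>U - \<Lambda>. (\<Sum>a'\<in>\<Lambda>. of_bool (E b i a')) = (0 :: real)"
      proof (intro ballI sum.neutral)
        fix i a' assume i: "i \<in> U - \<Lambda>" "a' \<in> \<Lambda>"
        then have "\<not> E b i a'"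
          using pair[of i a'] mk[of a'] by (auto simp: \<Lambda>_def)
        then show "of_bool (E b i a') = (0 :: real)" by simp
      qed
    qed (use fin in \<open>auto simp: \<Lambda>_def\<close>)
    finally show ?thesis .
  qed
  then have "k\<^sup>2 / 2 * link E b U U = (\<Sum>a\<in>\<Lambda>. \<Sum>a'\<in>\<Lambda>. k\<^sup>2 / 2 * of_bool (E b a a'))"
    by (simp only: sum_distrib_left)
  also have "\<dots> \<le> (\<Sum>a\<in>\<Lambda>. \<Sum>a'\<in>\<Lambda>. m a * m a' * of_bool (E b a a'))"
  proof (intro sum_mono)
    fix a a' assume aa: "a \<in> \<Lambda>" "a' \<in> \<Lambda>"
    show "k\<^sup>2 / 2 * of_bool (E b a a') \<le> m a * m a' * of_bool (E b a a')"
    proof (cases "E b a a'")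
      case True
      have "k * (3/2 * k) \<le> k * (m a + m a')"
        using pair[of a a'] aa True k by (intro mult_left_mono) (auto simp: \<Lambda>_def)
      moreover have "0 \<le> (k - m a) * (k - m a')"
        using mk by simp
      ultimately show ?thesis
        using True by (simp add: power2_eq_square algebra_simps)
    qed simp
  qed
  also have "\<dots> \<le> S\<^sup>2 / 2"
    unfolding S_def
  proof (rule weighted_mantel)
    show "finite \<Lambda>"
      using fin by (simp add: \<Lambda>_def)
    show "E b x y \<Longrightarrow> E b y x" for x y
      using good_sym2[OF g] .
    show "E b x y \<Longrightarrow> E b x z \<Longrightarrow> E b y z \<Longrightarrow> False" for x y z
      using good_K4[OF g] .
  qed (rule m0)
  finally have 1: "k\<^sup>2 * link E b U U \<le> S\<^sup>2"
    by simp
  have S0: "0 \<le> S"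
    unfolding S_def by (intro sum_nonneg m0)
  have S1: "S \<le> k * \<psi>"
  proof -
    have "S \<le> sum m U"
      unfolding S_def using fin m0 by (intro sum_mono2) (auto simp: \<Lambda>_def)
    also have "\<dots> \<le> sum m (A \<union> (U - A))"
      using fin m0 by (intro sum_mono2) auto
    also have "\<dots> = sum m A + sum m (U - A)"
      using fin by (intro sum.union_disjoint) auto
    also have "sum m (U - A) \<le> (\<Sum>a\<in>U - A. k)"
      using mk by (intro sum_mono)
    also have "sum m A = real (card A) * k - link E b A C"
      unfolding m_def link_def k_def using good_commute(1)[OF g, of _ b]
      by (simp add: of_bool_not_iff sum_subtractf)
    finally show ?thesis
      using b by (simp add: \<psi>_def dense_to_def k_def algebra_simps)
  qed
  \<comment> \<open>Passing from C to the part W loses at most \<omega> per vertex, and on \<Lambda>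
    this loss is at most the fraction 2 \<omega> / k of m a.\<close>
  have 2: "(k - 2 * \<omega>) * S \<le> k * sum m' U"
  proof -
    have "(k - 2 * \<omega>) * m a \<le> k * m' a" if "a \<in> \<Lambda>" for a
    proof -
      have "m a \<le> (\<Sum>c\<in>W \<union> (C - W). of_bool (\<not> E a b c))"
        unfolding m_def using fin by (intro sum_mono2) auto
      also have "\<dots> = m' a + (\<Sum>c\<in>C - W. of_bool (\<not> E a b c))"
        unfolding m'_def using fin by (intro sum.union_disjoint) auto
      also have "(\<Sum>c\<in>C - W. of_bool (\<not> E a b c) :: real) \<le> (\<Sum>c\<in>C - W. 1)"
        by (intro sum_mono) simp
      finally have "m a \<le> m' a + \<omega>"
        by (simp add: \<omega>_def)
      then have "k * m a \<le> k * (m' a + \<omega>)"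
        using k by (intro mult_left_mono) auto
      moreover have "\<omega> * k \<le> \<omega> * (2 * m a)"
        using that by (intro mult_left_mono) (auto simp: \<Lambda>_def \<omega>_def)
      ultimately show ?thesis
        by (simp add: algebra_simps)
    qed
    then have "(k - 2 * \<omega>) * S \<le> (\<Sum>a\<in>\<Lambda>. k * m' a)"
      unfolding S_def sum_distrib_left by (rule sum_mono)
    also have "\<dots> \<le> (\<Sum>a\<in>U. k * m' a)"
      using fin m'0 k by (intro sum_mono2) (auto simp: \<Lambda>_def)
    finally show ?thesis
      by (simp add: sum_distrib_left)
  qed
  have \<psi>: "0 \<le> \<psi>"
    by (simp add: \<psi>_def)
  have "k\<^sup>2 * ((k - 2 * \<omega>) * link E b U U) \<le> (k - 2 * \<omega>) * S\<^sup>2"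
    using mult_left_mono[OF 1, of "k - 2 * \<omega>"] True by (simp add: k_def \<omega>_def W_def mult_ac)
  also have "\<dots> = ((k - 2 * \<omega>) * S) * S"
    by (simp add: power2_eq_square)
  also have "\<dots> \<le> (k * sum m' U) * (k * \<psi>)"
  proof (rule mult_mono[OF 2 S1 _ S0])
    show "0 \<le> k * sum m' U"
      using k m'0 by (intro mult_nonneg_nonneg sum_nonneg) auto
  qed
  also have "\<dots> = k\<^sup>2 * (\<psi> * sum m' U)"
    by (simp add: power2_eq_square)
  finally have "(k - 2 * \<omega>) * link E b U U \<le> \<psi> * sum m' U"
    using k by (simp add: mult_le_cancel_left_pos)
  then show ?thesis
    by (simp add: k_def \<omega>_def \<psi>_def U_def W_def m'_def)
qed

section \<open>Edges with two vertices in one part against missing transversals\<close>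

definition edge_count :: "('a \<Rightarrow> 'a \<Rightarrow> 'a \<Rightarrow> bool) \<Rightarrow> 'a set \<Rightarrow> 'a set \<Rightarrow> 'a set \<Rightarrow> real" where
  "edge_count E X Y Z = (\<Sum>x\<in>X. link E x Y Z)"

lemma bad_edges:
  fixes V :: "'a set"
  assumes core: "core E V A B C"
  shows "(real (card C) - 2 * real (card (C - dense_to E V A B))) * edge_count E (dense_to E V A C) (dense_to E V B C) (dense_to E V B C)
    \<le> (real (card A) / 4 + real (card (dense_to E V B C - A))) * miss E (dense_to E V B C) (dense_to E V A C) (dense_to E V A B)"
proof -
  have g: "good E"
    using core by (simp add: core_def)
  have "(real (card C) - 2 * real (card (C - dense_to E V A B))) * edge_count E (dense_to E V A C) (dense_to E V B C) (dense_to E V B C)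
    \<le> (\<Sum>b\<in>dense_to E V A C. (real (card A) / 4 + real (card (dense_to E V B C - A)))
       * (\<Sum>a\<in>dense_to E V B C. \<Sum>c\<in>dense_to E V A B. of_bool (\<not> E a b c)))"
    unfolding edge_count_def sum_distrib_left[of _ "\<lambda>x. link E x _ _"] by (intro sum_mono bad_link[OF core])
  also have "\<dots> = (real (card A) / 4 + real (card (dense_to E V B C - A)))
      * (\<Sum>b\<in>dense_to E V A C. \<Sum>a\<in>dense_to E V B C. \<Sum>c\<in>dense_to E V A B. of_bool (\<not> E a b c))"
    by (simp only: sum_distrib_left)
  also have "(\<Sum>b\<in>dense_to E V A C. \<Sum>a\<in>dense_to E V B C. \<Sum>c\<in>dense_to E V A B. of_bool (\<not> E a b c)) = miss E (dense_to E V B C) (dense_to E V A C) (dense_to E V A B)"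
    unfolding miss_def by (rule sum.swap)
  finally show ?thesis .
qed

lemma edge_count_swap:
  assumes g: "good E"
  shows "edge_count E X Z Y = edge_count E X Y Z" "edge_count E Y X Z = edge_count E X Y Z"
proof -
  show "edge_count E X Z Y = edge_count E X Y Z"
    unfolding edge_count_def by (simp add: link_commute[OF g, of _ Z Y])
  have "edge_count E Y X Z = (\<Sum>x\<in>X. \<Sum>y\<in>Y. \<Sum>z\<in>Z. of_bool (E y x z))"
    unfolding edge_count_def link_def by (rule sum.swap)
  then show "edge_count E Y X Z = edge_count E X Y Z"
    unfolding edge_count_def link_def by (simp add: good_commute(1)[OF g, of _ "_ :: 'a"])
qed

text \<open>Transversal edges have six orderings. The terms with a repeated part carry only the
  factor 3 because \<open>edge_count\<close> already counts both orders of the two vertices in that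
  part.\<close>

lemma nedge_three_parts:
  assumes g: "good E" and fin: "finite X" "finite Y" "finite Z" and d: "X \<inter> Y = {}" "X \<inter> Z = {}" "Y \<inter> Z = {}"
  shows "nedge E (X \<union> Y \<union> Z) = nedge E X + nedge E Y + nedge E Z
    + 6 * (real (card X) * real (card Y) * real (card Z) - miss E X Y Z)
    + 3 * (edge_count E Y X X + edge_count E Z X X + edge_count E X Y Y + edge_count E Z Y Y + edge_count E X Z Z + edge_count E Y Z Z)"
proof -
  have link: "link E x (X \<union> Y \<union> Z) (X \<union> Y \<union> Z) = link E x X X + link E x Y Y + link E x Z Z + 2 * link E x X Y + 2 * link E x X Z + 2 * link E x Y Z" for x
    using fin d link_commute[OF g, of x Y X] link_commute[OF g, of x Z X] link_commute[OF g, of x Z Y]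
    by (simp add: link_Un1 link_Un2 Int_Un_distrib Int_Un_distrib2)
  have sp: "(\<Sum>x\<in>X \<union> Y \<union> Z. f x) = sum f X + sum f Y + sum f Z" for f :: "'a \<Rightarrow> real"
    using fin d by (simp add: sum.union_disjoint Int_Un_distrib2)
  have tp: "edge_count E (X \<union> Y \<union> Z) P Q = edge_count E X P Q + edge_count E Y P Q + edge_count E Z P Q" for P Q
    unfolding edge_count_def by (rule sp)
  have t: "edge_count E X X Y = edge_count E Y X X" "edge_count E X X Z = edge_count E Z X X" "edge_count E Y X Y = edge_count E X Y Y" "edge_count E Y Y Z = edge_count E Z Y Y"
    "edge_count E Z X Z = edge_count E X Z Z" "edge_count E Z Y Z = edge_count E Y Z Z" "edge_count E Y X Z = edge_count E X Y Z" "edge_count E Z X Y = edge_count E X Y Z"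
    using edge_count_swap[OF g] by metis+
  have "edge_count E X Y Z = real (card X) * real (card Y) * real (card Z) - miss E X Y Z"
    unfolding miss_link edge_count_def by (simp add: sum_subtractf)
  moreover have "nedge E (X \<union> Y \<union> Z) = edge_count E X X X + edge_count E Y Y Y + edge_count E Z Z Z + 6 * edge_count E X Y Z
    + 3 * (edge_count E Y X X + edge_count E Z X X + edge_count E X Y Y + edge_count E Z Y Y + edge_count E X Z Z + edge_count E Y Z Z)"
    unfolding nedge_link[of E "X \<union> Y \<union> Z"] link sum.distrib sum_distrib_left[symmetric] edge_count_def[symmetric] tp t by simp
  ultimately show ?thesis
    by (simp add: nedge_link edge_count_def)
qed

text \<open>In the perfectly balanced case the value is 9; the defect 1/100 raises it by at most
  1/10.\<close>

lemma recip_sum: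
  fixes a b c s :: real
  assumes pos: "0 < a" "0 < b" "0 < c" and s: "s = a + b + c" "49/50 \<le> s" and im: "s ^ 3 - 27 * a * b * c \<le> 1/100"
  shows "s * (1 / a + 1 / b + 1 / c) \<le> 91/10"
proof -
  have "(49/50) ^ 3 \<le> s ^ 3"
    using s by (intro power_mono) auto
  then have "9 * s ^ 3 \<le> 91/10 * 27 * (a * b * c)"
    using im by (simp add: power3_eq_cube)
  moreover have "3 * (a * b + a * c + b * c) \<le> s\<^sup>2"
  proof -
    have "0 \<le> (a - b)\<^sup>2 + (a - c)\<^sup>2 + (b - c)\<^sup>2"
      by simp
    then show ?thesis
      by (simp add: s power2_eq_square algebra_simps)
  qed
  then have "s * (3 * (a * b + a * c + b * c)) \<le> s * s\<^sup>2"
    using s by (intro mult_left_mono) auto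
  ultimately have "s * (a * b + a * c + b * c) \<le> 91/10 * (a * b * c)"
    unfolding power3_eq_cube power2_eq_square mult.left_commute[of s 3] mult.assoc by argo
  then have "s * (a * b + a * c + b * c) / (a * b * c) \<le> 91/10"
    using pos by (subst pos_divide_le_eq) auto
  moreover have "s * (a * b + a * c + b * c) / (a * b * c) = s * (1 / a + 1 / b + 1 / c)"
    using pos by (simp add: field_simps)
  ultimately show ?thesis
    by simp
qed

text \<open>The bound 2 * m is what \<open>nedge_three_parts\<close> calls for: its factors 3 and 6
  then cancel exactly. With balanced parts and losses ignored, the six ratios would sum to 3/2; the
  imbalance, D and the factor 97/100 use up the remainder.\<close>

lemma bad_numeric:
  fixes a b c s D m :: real
  assumes pos: "0 < a" "0 < b" "0 < c" and s: "s = a + b + c" "49/50 \<le> s" and im: "s ^ 3 - 27 * a * b * c \<le> 1/100"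
    and D: "D \<le> 1/50" and m: "0 \<le> m"
    and t: "97/100 * c * t1 \<le> (a / 4 + D) * m" "97/100 * b * t2 \<le> (a / 4 + D) * m"
      "97/100 * c * t3 \<le> (b / 4 + D) * m" "97/100 * a * t4 \<le> (b / 4 + D) * m"
      "97/100 * b * t5 \<le> (c / 4 + D) * m" "97/100 * a * t6 \<le> (c / 4 + D) * m"
  shows "t1 + t2 + t3 + t4 + t5 + t6 \<le> 2 * m"
proof -
  have step: "97/100 * t \<le> (x / 4 + D) / y * m" if "97/100 * y * t \<le> (x / 4 + D) * m" "0 < y" for x y t
  proof -
    have "97/100 * t = 97/100 * y * t / y"
      using that(2) by simp
    also have "\<dots> \<le> (x / 4 + D) * m / y"
      using that by (intro divide_right_mono) auto
    finally show ?thesis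
      by simp
  qed
  define R where "R = 1 / a + 1 / b + 1 / c"
  have sR: "s * R \<le> 91/10"
    unfolding R_def by (rule recip_sum[OF pos s im])
  have R0: "0 \<le> R"
    using pos by (simp add: R_def)
  have R: "R \<le> 929/100"
  proof -
    have "49/50 * R \<le> s * R"
      using s R0 by (intro mult_right_mono)
    then show ?thesis
      using sR by linarith
  qed
  have "D * R \<le> 1/50 * R"
    using D R0 by (intro mult_right_mono)
  have "97/100 * (t1 + t2 + t3 + t4 + t5 + t6) \<le>
     ((a / 4 + D) / c + (a / 4 + D) / b + (b / 4 + D) / c + (b / 4 + D) / a + (c / 4 + D) / b + (c / 4 + D) / a) * m"
    using step[OF t(1) pos(3)] step[OF t(2) pos(2)] step[OF t(3) pos(3)] step[OF t(4) pos(1)] step[OF t(5) pos(2)] step[OF t(6) pos(1)]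
    by (simp add: distrib_right)
  also have "((a / 4 + D) / c + (a / 4 + D) / b + (b / 4 + D) / c + (b / 4 + D) / a + (c / 4 + D) / b + (c / 4 + D) / a)
     = s * R / 4 - 3/4 + 2 * (D * R)"
    using pos by (simp add: R_def s field_simps)
  also have "(s * R / 4 - 3/4 + 2 * (D * R)) * m \<le> 194/100 * m"
  proof (rule mult_right_mono[OF _ m])
    show "s * R / 4 - 3/4 + 2 * (D * R) \<le> 194/100"
      using sR R \<open>D * R \<le> 1/50 * R\<close> by argo
  qed
  finally show ?thesis
    by simp
qed

text \<open>Once the missing transversals absorb the edges with two vertices in one part, the parts
  contribute dens * q and the transversals at most (1 - q) / 4. Since q is bounded away from 1, the
  excess dens - 1/4 is at most a constant times \<epsilon>.\<close>

lemma core_dens: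
  fixes V :: "'a set"
  assumes core: "core E V A B C" and N: "(dens - \<epsilon>) * real (card V) ^ 3 \<le> nedge E V"
  shows "dens - 1/4 \<le> 2 * \<epsilon>"
proof -
  define n where "n = real (card V)"
  define X Y Z where "X = dense_to E V B C" and "Y = dense_to E V A C" and "Z = dense_to E V A B"
  have g: "good E" and V: "finite V" and sub: "A \<subseteq> V" "B \<subseteq> V" "C \<subseteq> V" and dj: "A \<inter> B = {}" "A \<inter> C = {}" "B \<inter> C = {}"
    and dens: "1/4 \<le> dens"
    using core by (auto simp: core_def)
  note cB = core_swap(1)[OF core] and cC = core_swap(2)[OF core]
  note cCA = core_swap(1)[OF cC] and cBC = core_swap(2)[OF cB]
  note cCB = core_swap(2)[OF cCA]
  note clc = dense_to_commute[OF g]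
  note sz = core_sizes[OF core, folded n_def] and szB = core_sizes[OF cB, folded n_def] and szC = core_sizes[OF cCA, folded n_def]
  have n: "0 < n"
    by (rule sz)
  have fin: "finite X" "finite Y" "finite Z"
    using V by (auto simp: X_def Y_def Z_def dense_to_def)
  have VU: "V = X \<union> Y \<union> Z"
    unfolding X_def Y_def Z_def by (rule dense_to_cover[OF core])
  have d: "X \<inter> Y = {}" "X \<inter> Z = {}" "Y \<inter> Z = {}"
    using dense_to_disjoint[OF core] dense_to_disjoint[OF cC] dense_to_disjoint[OF cBC] unfolding X_def Y_def Z_def
    by (auto simp: clc[of V B C, symmetric] clc[of V A B] clc[of V A C])
  define M where "M = miss E A B C / n ^ 3"
  define v0 where "v0 = real (card (V - (A \<union> B \<union> C))) / n"
  define a b c where "a = real (card A) / n" and "b = real (card B) / n" and "c = real (card C) / n"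
  have om: "real (card (A - X)) / n \<le> 1275/100 * M" "real (card (B - Y)) / n \<le> 1275/100 * M" "real (card (C - Z)) / n \<le> 1275/100 * M"
  proof -
    have sc: "w / n \<le> 1275/100 * M" if "w * n ^ 2 \<le> 1275/100 * miss E A B C" for w
    proof -
      have "w * n ^ 2 / n ^ 3 \<le> 1275/100 * miss E A B C / n ^ 3"
        using that n by (intro divide_right_mono) auto
      moreover have "w * n ^ 2 / n ^ 3 = w / n"
        using n by (simp add: power2_eq_square power3_eq_cube)
      ultimately show ?thesis
        by (simp add: M_def)
    qed
    show "real (card (A - X)) / n \<le> 1275/100 * M"
      using omega_bound[OF core] unfolding X_def n_def[symmetric] by (rule sc)
    show "real (card (B - Y)) / n \<le> 1275/100 * M"
      using omega_bound[OF cB] unfolding Y_def n_def[symmetric] miss_swap(1)[OF g, of B A C] by (rule sc)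
    have "miss E C A B = miss E A B C"
      using miss_swap[OF g] by metis
    then show "real (card (C - Z)) / n \<le> 1275/100 * M"
      using omega_bound[OF cCA] unfolding Z_def n_def[symmetric] by (intro sc) simp
  qed
  have M: "0 \<le> M" "M \<le> 1/3000"
    using miss_nonneg[of E A B C] sz(7) n by (auto simp: M_def divide_le_eq)
  have bud: "v0 + 60 * M \<le> 1/50"
    using sz(8) by (simp add: v0_def M_def)
  \<comment> \<open>A vertex of a part outside its own class is uncovered or misplaced from one of
    the other two classes; 2 * 1275/100 * M fits into the 60 * M of the budget.\<close>
  have out: "real (card (P - A')) / n \<le> 1/50"
    if P: "P \<subseteq> V" "P \<inter> Q = {}" "P \<inter> R = {}" "V - (A' \<union> B' \<union> C') = V - (A \<union> B \<union> C)"
      "real (card (B' - Q)) / n \<le> 1275/100 * M" "real (card (C' - R)) / n \<le> 1275/100 * M"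
      "finite B'" "finite C'" for P Q R A' B' C'
  proof -
    have "P - A' \<subseteq> (V - (A \<union> B \<union> C)) \<union> (B' - Q) \<union> (C' - R)"
      using P(1-3) unfolding P(4)[symmetric] by auto
    then have "card (P - A') \<le> card ((V - (A \<union> B \<union> C)) \<union> (B' - Q) \<union> (C' - R))"
      using V P by (intro card_mono) auto
    also have "\<dots> \<le> card (V - (A \<union> B \<union> C)) + card (B' - Q) + card (C' - R)"
      by (meson add_mono_thms_linordered_semiring(3) card_Un_le order_trans)
    finally have "real (card (P - A')) / n \<le> (real (card (V - (A \<union> B \<union> C))) + real (card (B' - Q)) + real (card (C' - R))) / n"
      using n by (intro divide_right_mono) auto
    also have "\<dots> = v0 + real (card (B' - Q)) / n + real (card (C' - R)) / n"
      by (simp add: v0_def add_divide_distrib)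
    finally show ?thesis
      using P(5,6) bud M by argo
  qed
  have o: "real (card (X - A)) / n \<le> 1/50" "real (card (Y - B)) / n \<le> 1/50" "real (card (Z - C)) / n \<le> 1/50"
    using out[of X Y Z A B C] out[of Y X Z B A C] out[of Z X Y C A B] VU d om sz(2,3,4) by (auto simp: Un_ac Int_commute)
  have abc: "143/500 \<le> a" "143/500 \<le> b" "143/500 \<le> c"
    using sz(5) szB(5) szC(5) n by (auto simp: a_def b_def c_def pos_le_divide_eq)
  define mU where "mU = miss E X Y Z"
  have mU: "0 \<le> mU"
    unfolding mU_def by (rule miss_nonneg)
  \<comment> \<open>Twice the misplaced share is at most 2 * 1275/100 / 3000 = 0.0085, below 3/100
    of the least class share 143/500.\<close>
  have conv: "97/100 * (real (card C') / n) * t \<le> (real (card A') / n / 4 + 1/50) * mU"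
    if "(real (card C') - 2 * real (card (C' - R))) * t \<le> (real (card A') / 4 + real (card (P - A'))) * mU" "0 \<le> t"
      "real (card (C' - R)) / n \<le> 1275/100 * M" "real (card (P - A')) / n \<le> 1/50" "143/500 \<le> real (card C') / n"
    for A' C' P R t
  proof -
    have "97/100 * (real (card C') / n) * t \<le> (real (card C') / n - 2 * (real (card (C' - R)) / n)) * t"
      using that M by (intro mult_right_mono) auto
    also have "\<dots> = (real (card C') - 2 * real (card (C' - R))) * t / n"
      by (simp add: diff_divide_distrib left_diff_distrib)
    also have "\<dots> \<le> (real (card A') / 4 + real (card (P - A'))) * mU / n"
      using that n by (intro divide_right_mono) auto
    also have "\<dots> = (real (card A') / n / 4 + real (card (P - A')) / n) * mU"
      by (simp add: add_divide_distrib distrib_right)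
    also have "\<dots> \<le> (real (card A') / n / 4 + 1/50) * mU"
      using that mU by (intro mult_right_mono) auto
    finally show ?thesis .
  qed
  have t0: "0 \<le> edge_count E P Q R" for P Q R
    unfolding edge_count_def by (intro sum_nonneg link_nonneg)
  have ms: "miss E Y X Z = mU" "miss E X Z Y = mU" "miss E Y Z X = mU" "miss E Z X Y = mU" "miss E Z Y X = mU"
    unfolding mU_def using miss_swap[OF g] by metis+
  have XYZ: "dense_to E V C B = X" "dense_to E V C A = Y" "dense_to E V B A = Z"
    unfolding X_def Y_def Z_def by (rule clc)+
  have "edge_count E Y X X + edge_count E Z X X + edge_count E X Y Y + edge_count E Z Y Y + edge_count E X Z Z + edge_count E Y Z Z \<le> 2 * mU"
  proof (rule bad_numeric[where a = a and b = b and c = c and s = "a + b + c" and D = "1/50"])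
    show "0 < a" "0 < b" "0 < c"
      using abc by auto
    show "49/50 \<le> a + b + c" "(a + b + c) ^ 3 - 27 * a * b * c \<le> 1/100"
      using sz(9,10) by (simp_all add: a_def b_def c_def)
    show "97/100 * c * edge_count E Y X X \<le> (a / 4 + 1/50) * mU"
      using bad_edges[OF core, folded X_def Y_def Z_def, folded mU_def] t0 om o abc unfolding a_def c_def by (intro conv) auto
    show "97/100 * b * edge_count E Z X X \<le> (a / 4 + 1/50) * mU"
      using bad_edges[OF cC, folded X_def Y_def Z_def, unfolded XYZ ms] t0 om o abc unfolding a_def b_def by (intro conv) auto
    show "97/100 * c * edge_count E X Y Y \<le> (b / 4 + 1/50) * mU"
      using bad_edges[OF cB, folded X_def Y_def Z_def, unfolded XYZ ms] t0 om o abc unfolding c_def b_def by (intro conv) auto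
    show "97/100 * a * edge_count E Z Y Y \<le> (b / 4 + 1/50) * mU"
      using bad_edges[OF cBC, folded X_def Y_def Z_def, unfolded XYZ ms] t0 om o abc unfolding a_def b_def by (intro conv) auto
    show "97/100 * b * edge_count E X Z Z \<le> (c / 4 + 1/50) * mU"
      using bad_edges[OF cCA, folded X_def Y_def Z_def, unfolded XYZ ms] t0 om o abc unfolding c_def b_def by (intro conv) auto
    show "97/100 * a * edge_count E Y Z Z \<le> (c / 4 + 1/50) * mU"
      using bad_edges[OF cCB, folded X_def Y_def Z_def, unfolded XYZ ms] t0 om o abc unfolding a_def c_def by (intro conv) auto
  qed (use mU in auto)
  then have up: "nedge E V \<le> nedge E X + nedge E Y + nedge E Z + 6 * (real (card X) * real (card Y) * real (card Z))"
    unfolding VU nedge_three_parts[OF g fin d] mU_def by argo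
  define x y z where "x = real (card X) / n" and "y = real (card Y) / n" and "z = real (card Z) / n"
  have xyz: "x + y + z = 1"
  proof -
    have "card V = card X + card Y + card Z"
      unfolding VU using fin d by (simp add: card_Un_disjoint Int_Un_distrib2)
    then have "n = real (card X) + real (card Y) + real (card Z)"
      by (simp add: n_def)
    then show ?thesis
      using n by (simp add: x_def y_def z_def add_divide_distrib[symmetric])
  qed
  have x0: "0 \<le> x" "0 \<le> y" "0 \<le> z"
    using n by (auto simp: x_def y_def z_def)
  have u: "real (card P) / n \<le> 2/5" if "real (card (P - A')) / n \<le> 1/50" "real (card A') \<le> 187/500 * n" "finite A'" for P A'
  proof -
    have "card P \<le> card ((P - A') \<union> A')"
      using that fin by (cases "finite P") (auto intro!: card_mono)
    also have "\<dots> \<le> card (P - A') + card A'"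
      by (rule card_Un_le)
    finally have "real (card P) / n \<le> real (card (P - A')) / n + real (card A') / n"
      using n by (simp add: add_divide_distrib[symmetric] divide_right_mono)
    moreover have "real (card A') / n \<le> 187/500"
      using that n by (simp add: pos_divide_le_eq)
    ultimately show ?thesis
      using that by argo
  qed
  have x4: "x \<le> 2/5" "y \<le> 2/5" "z \<le> 2/5"
    unfolding x_def y_def z_def using u o sz(2,3,4,6) szB(6) szC(6) by blast+
  define q where "q = x ^ 3 + y ^ 3 + z ^ 3"
  have cube: "w ^ 3 \<le> 4/25 * w" if "0 \<le> w" "w \<le> 2/5" for w :: real
  proof -
    have "w\<^sup>2 \<le> (2/5)\<^sup>2"
      using that by (intro power_mono)
    then have "w * w\<^sup>2 \<le> w * (4/25)"
      using that by (intro mult_left_mono) (auto simp: power2_eq_square)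
    then show ?thesis
      by (simp add: power2_eq_square power3_eq_cube)
  qed
  have q: "q \<le> 4/25"
    using cube[OF x0(1) x4(1)] cube[OF x0(2) x4(2)] cube[OF x0(3) x4(3)] xyz unfolding q_def by argo
  have "(dens - \<epsilon>) * n ^ 3 / n ^ 3 \<le> (dens * real (card X) ^ 3 + dens * real (card Y) ^ 3 + dens * real (card Z) ^ 3
      + 6 * (real (card X) * real (card Y) * real (card Z))) / n ^ 3"
  proof (intro divide_right_mono)
    show "(dens - \<epsilon>) * n ^ 3 \<le> dens * real (card X) ^ 3 + dens * real (card Y) ^ 3 + dens * real (card Z) ^ 3
      + 6 * (real (card X) * real (card Y) * real (card Z))"
      using N up nedge_le_dens[OF g fin(1)] nedge_le_dens[OF g fin(2)] nedge_le_dens[OF g fin(3)] unfolding n_def by argo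
  qed (use n in simp)
  also have "\<dots> = dens * q + 6 * (x * y * z)"
    using n by (simp add: q_def x_def y_def z_def power3_eq_cube add_divide_distrib distrib_left)
  also have "6 * (x * y * z) \<le> (1 - q) / 4"
    using sum_cube_ge(1)[OF x0] xyz by (simp add: q_def)
  finally have "dens - \<epsilon> \<le> dens * q + (1 - q) / 4"
    using n by simp
  moreover have "(dens - 1/4) * (1 - q) = dens - dens * q - (1 - q) / 4"
    by (simp add: field_simps)
  ultimately have "(dens - 1/4) * (1 - q) \<le> \<epsilon>"
    by argo
  moreover have "(dens - 1/4) * (1/2) \<le> (dens - 1/4) * (1 - q)"
    using dens q by (intro mult_left_mono) auto
  ultimately show ?thesis
    by simp
qed

lemma ex_core:
  assumes d: "1/4 \<le> dens" and \<epsilon>: "0 < \<epsilon>" "\<epsilon> \<le> 1/20000"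
  obtains E :: "nat \<Rightarrow> nat \<Rightarrow> nat \<Rightarrow> bool" and V A B C where "core E V A B C" "(dens - \<epsilon>) * real (card V) ^ 3 \<le> nedge E V"
proof -
  obtain E0 :: "nat \<Rightarrow> nat \<Rightarrow> nat \<Rightarrow> bool" and m where E0: "good E0" "m > 0" "(dens - \<epsilon>) * real m ^ 3 < nedge E0 {..<m}"
    using dens_nearly_attained[OF \<epsilon>(1)] by blast
  \<comment> \<open>The factor 4000 makes card V divisible by 40 and large enough that the loss 2 *
    n of \<open>optimal_degree\<close> is at most n^2 / 2000.\<close>
  define N where "N = m * 4000"
  define V where "V = {..<N}"
  obtain E :: "nat \<Rightarrow> nat \<Rightarrow> nat \<Rightarrow> bool" where g: "good E" and opt: "\<And>E'. good E' \<Longrightarrow> nedge E' V \<le> nedge E V"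
    using ex_optimal[of N] unfolding V_def by blast
  define n where "n = real (card V)"
  have nm: "n = 4000 * real m"
    by (simp add: n_def V_def N_def)
  have n: "4000 \<le> n"
    using E0(2) by (simp add: nm)
  have Vf: "finite V" "V \<noteq> {}"
    using E0(2) by (auto simp: V_def N_def lessThan_empty_iff)
  have NE: "(dens - \<epsilon>) * n ^ 3 \<le> nedge E V"
  proof -
    have "(dens - \<epsilon>) * n ^ 3 = real 4000 ^ 3 * ((dens - \<epsilon>) * real m ^ 3)"
      by (simp add: nm power_mult_distrib)
    also have "\<dots> \<le> real 4000 ^ 3 * nedge E0 {..<m}"
      using E0(3) by (intro mult_left_mono) auto
    also have "\<dots> = nedge (reind E0 (\<lambda>i. i mod m)) V"
      unfolding V_def N_def by (rule nedge_blow_up[OF E0(2), symmetric])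
    also have "\<dots> \<le> nedge E V"
      by (rule opt[OF good_reind[OF E0(1)]])
    finally show ?thesis .
  qed
  have rec: "nedge E W \<le> dens * real (card W) ^ 3" if "W \<subseteq> V" for W
    using that Vf by (intro nedge_le_dens[OF g]) (auto intro: finite_subset)
  have N2: "(dens - 1/20000) * real (card V) ^ 3 \<le> nedge E V"
  proof -
    have "(dens - 1/20000) * n ^ 3 \<le> (dens - \<epsilon>) * n ^ 3"
      using \<epsilon> n by (intro mult_right_mono) auto
    then show ?thesis
      using NE by (simp add: n_def)
  qed
  obtain x y z where "E x y z" and ineq:
    "27000 * (\<Sum>a\<in>{p\<in>V. E y z p}. \<Sum>b\<in>{p\<in>V. E x z p}. \<Sum>c\<in>{p\<in>V. E x y p}. of_bool (\<not> E a b c))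
     + 900 * ((real (card {p\<in>V. E y z p}) + real (card {p\<in>V. E x z p}) + real (card {p\<in>V. E x y p})) ^ 3
        - 27 * real (card {p\<in>V. E y z p}) * real (card {p\<in>V. E x z p}) * real (card {p\<in>V. E x y p}))
     + 3600 * ((dens * real (card {p\<in>V. E y z p}) ^ 3 - nedge E {p\<in>V. E y z p})
        + (dens * real (card {p\<in>V. E x z p}) ^ 3 - nedge E {p\<in>V. E x z p})
        + (dens * real (card {p\<in>V. E x y p}) ^ 3 - nedge E {p\<in>V. E x y p}))
     + (50 * real (card (V - ({p\<in>V. E y z p} \<union> {p\<in>V. E x z p} \<union> {p\<in>V. E x y p}))) - real (card V))
        * (4 * (real (card {p\<in>V. E y z p}) + real (card {p\<in>V. E x z p}) + real (card {p\<in>V. E x y p})) - real (card V))\<^sup>2 < 0"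
    by (rule core_edge[OF Vf g d N2 rec])
  define A B C where "A = {p\<in>V. E y z p}" and "B = {p\<in>V. E x z p}" and "C = {p\<in>V. E x y p}"
  have dj: "A \<inter> B = {}" "A \<inter> C = {}" "B \<inter> C = {}"
    using good_K4[OF g, of z x y] good_K4[OF g, of y x z] good_K4[OF g, of x y z] \<open>E x y z\<close> good_commute[OF g]
    unfolding A_def B_def C_def by blast+
  have sub: "A \<subseteq> V" "B \<subseteq> V" "C \<subseteq> V"
    by (auto simp: A_def B_def C_def)
  have fin: "finite A" "finite B" "finite C"
    using sub Vf(1) by (auto intro: finite_subset)
  define v0 a b c where "v0 = real (card (V - (A \<union> B \<union> C))) / n" and "a = real (card A) / n"
    and "b = real (card B) / n" and "c = real (card C) / n"
  define M where "M = miss E A B C / n ^ 3"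
  define d1 d2 d3 where "d1 = (dens * real (card A) ^ 3 - nedge E A) / n ^ 3" and "d2 = (dens * real (card B) ^ 3 - nedge E B) / n ^ 3"
    and "d3 = (dens * real (card C) ^ 3 - nedge E C) / n ^ 3"
  have n0: "0 < n"
    using n by simp
  have "27000 * M + 900 * ((a + b + c) ^ 3 - 27 * a * b * c) + 3600 * (d1 + d2 + d3) + (50 * v0 - 1) * (4 * (a + b + c) - 1)\<^sup>2 < 0"
  proof -
    have cA: "real (card A) = a * n" "real (card B) = b * n" "real (card C) = c * n" "real (card (V - (A \<union> B \<union> C))) = v0 * n"
      "miss E A B C = M * n ^ 3" "dens * real (card A) ^ 3 - nedge E A = d1 * n ^ 3" "dens * real (card B) ^ 3 - nedge E B = d2 * n ^ 3"
      "dens * real (card C) ^ 3 - nedge E C = d3 * n ^ 3"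
      using n0 by (simp_all add: a_def b_def c_def v0_def M_def d1_def d2_def d3_def)
    have "27000 * (M * n ^ 3) + 900 * ((a * n + b * n + c * n) ^ 3 - 27 * (a * n) * (b * n) * (c * n))
        + 3600 * (d1 * n ^ 3 + d2 * n ^ 3 + d3 * n ^ 3) + (50 * (v0 * n) - n) * (4 * (a * n + b * n + c * n) - n)\<^sup>2 < 0"
      using ineq unfolding A_def[symmetric] B_def[symmetric] C_def[symmetric] miss_def[symmetric] n_def[symmetric] cA(6-8)
      unfolding cA(1-5) .
    moreover have "27000 * (M * n ^ 3) + 900 * ((a * n + b * n + c * n) ^ 3 - 27 * (a * n) * (b * n) * (c * n))
        + 3600 * (d1 * n ^ 3 + d2 * n ^ 3 + d3 * n ^ 3) + (50 * (v0 * n) - n) * (4 * (a * n + b * n + c * n) - n)\<^sup>2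
      = n ^ 3 * (27000 * M + 900 * ((a + b + c) ^ 3 - 27 * a * b * c) + 3600 * (d1 + d2 + d3) + (50 * v0 - 1) * (4 * (a + b + c) - 1)\<^sup>2)"
      by (simp add: power2_eq_square power3_eq_cube algebra_simps)
    ultimately show ?thesis
      using n0 by (simp add: mult_less_0_iff)
  qed
  \<comment> \<open>An uncovered share above 1/50 would make every summand non-negative. Otherwise
    (4 s - 1)^2 is at most 9, and division by 450 yields the budget.\<close>
  moreover have "- 9 * (1 - 50 * v0) \<le> (50 * v0 - 1) * (4 * (a + b + c) - 1)\<^sup>2 \<or> v0 > 1/50"
  proof (cases "v0 > 1/50")
    case False
    have "card (A \<union> B \<union> C) = card A + card B + card C"
      using fin dj by (simp add: card_Un_disjoint Int_Un_distrib2)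
    moreover have "card (A \<union> B \<union> C) \<le> card V"
      using Vf sub by (intro card_mono) auto
    ultimately have "real (card A) + real (card B) + real (card C) \<le> n"
      by (simp add: n_def)
    then have "a + b + c \<le> 1"
      using n0 by (simp add: a_def b_def c_def add_divide_distrib[symmetric])
    moreover have "0 \<le> a" "0 \<le> b" "0 \<le> c"
      by (simp_all add: a_def b_def c_def n_def)
    ultimately have "4 * (a + b + c) - 1 \<le> 3" "- (4 * (a + b + c) - 1) \<le> 3"
      by argo+
    then have "\<bar>4 * (a + b + c) - 1\<bar> \<le> 3"
      by (simp only: abs_le_iff)
    then have "(4 * (a + b + c) - 1)\<^sup>2 \<le> 3\<^sup>2"
      by (simp only: abs_le_square_iff[symmetric])
    then have "(1 - 50 * v0) * (4 * (a + b + c) - 1)\<^sup>2 \<le> (1 - 50 * v0) * 9"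
      using False by (intro mult_left_mono) auto
    then show ?thesis
      by (simp add: algebra_simps)
  qed simp
  moreover have "0 \<le> M"
    using miss_nonneg[of E A B C] n0 by (simp add: M_def)
  moreover have "0 \<le> d1" "0 \<le> d2" "0 \<le> d3"
    using nedge_le_dens[OF g fin(1)] nedge_le_dens[OF g fin(2)] nedge_le_dens[OF g fin(3)] n0
    by (simp_all add: d1_def d2_def d3_def)
  moreover have "0 \<le> (a + b + c) ^ 3 - 27 * a * b * c"
    using sum_cube_ge(2)[of a b c] n0 by (simp add: a_def b_def c_def)
  moreover have "0 \<le> (50 * v0 - 1) * (4 * (a + b + c) - 1)\<^sup>2" if "v0 > 1/50"
    using that by (intro mult_nonneg_nonneg) auto
  ultimately have bud: "v0 + 60 * M + 2 * ((a + b + c) ^ 3 - 27 * a * b * c) + 8 * (d1 + d2 + d3) \<le> 1/50"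
    by argo
  have deg: "dens - 1/1000 \<le> link E u V V / n ^ 2" if "u \<in> V" for u
  proof -
    have "n * ((dens - 1/20000) * n\<^sup>2) \<le> n * (link E u V V + 2 * n)"
      using optimal_degree[OF g opt Vf(1) that] N2 unfolding n_def[symmetric]
      by (simp add: power2_eq_square power3_eq_cube algebra_simps)
    then have 1: "(dens - 1/20000) * n\<^sup>2 \<le> link E u V V + 2 * n"
      using n0 by simp
    have "2 * n \<le> 1/2000 * n\<^sup>2"
      using n by (simp add: power2_eq_square)
    then have "(dens - 1/1000) * n\<^sup>2 \<le> link E u V V"
      using 1 zero_le_power2[of n] unfolding left_diff_distrib by argo
    then show ?thesis
      using n0 by (simp add: pos_le_divide_eq)
  qed
  have "core E V A B C"
    unfolding core_def n_def[symmetric] using g Vf sub dj d deg bud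
    by (auto simp: V_def N_def v0_def a_def b_def c_def M_def d1_def d2_def d3_def)
  then show thesis
    using that NE by (simp add: n_def)
qed

theorem dens_le: "dens \<le> 1/4"
proof (rule ccontr)
  assume "\<not> ?thesis"
  then have d: "1/4 < dens"
    by simp
  define \<epsilon> where "\<epsilon> = min (1/20000) ((dens - 1/4) / 4)"
  have \<epsilon>: "0 < \<epsilon>" "\<epsilon> \<le> 1/20000"
    using d by (simp_all add: \<epsilon>_def)
  have \<epsilon>': "\<epsilon> \<le> (dens - 1/4) / 4"
    unfolding \<epsilon>_def by (rule min.cobounded2)
  obtain E :: "nat \<Rightarrow> nat \<Rightarrow> nat \<Rightarrow> bool" and V A B C where "core E V A B C" "(dens - \<epsilon>) * real (card V) ^ 3 \<le> nedge E V"
    using ex_core[OF _ \<epsilon>(1,2)] d by (metis less_imp_le)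
  from core_dens[OF this] show False
    using \<epsilon>' d by argo
qed

section \<open>Sampling from cycle-free 3-graphs\<close>

lemma sum_PiE_update:
  assumes "finite I" "i \<in> I"
  shows "(\<Sum>\<phi>\<in>I \<rightarrow>\<^sub>E V. G \<phi>) = (\<Sum>v\<in>V. \<Sum>\<phi>\<in>(I - {i}) \<rightarrow>\<^sub>E V. G (\<phi>(i := v)))"
proof -
  have "(\<Sum>\<phi>\<in>I \<rightarrow>\<^sub>E V. G \<phi>) = (\<Sum>\<phi>\<in>(\<lambda>(y, g). g(i := y)) ` (V \<times> ((I - {i}) \<rightarrow>\<^sub>E V)). G \<phi>)"
    using PiE_insert_eq[of i "I - {i}" "\<lambda>_. V"] assms by (simp add: insert_absorb)
  also have "\<dots> = (\<Sum>(v, \<phi>)\<in>V \<times> ((I - {i}) \<rightarrow>\<^sub>E V). G (\<phi>(i := v)))"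
    using inj_combinator[of i "I - {i}" "\<lambda>_. V"] by (subst sum.reindex) (auto simp: split_def)
  finally show ?thesis
    by (simp add: sum.cartesian_product)
qed

lemma sum_PiE3:
  fixes g :: "'a \<Rightarrow> 'a \<Rightarrow> 'a \<Rightarrow> real"
  assumes I: "finite I" "i \<in> I" "j \<in> I" "k \<in> I" "distinct [i, j, k]"
  shows "(\<Sum>\<phi>\<in>I \<rightarrow>\<^sub>E V. g (\<phi> i) (\<phi> j) (\<phi> k)) = real (card V) ^ (card I - 3) * (\<Sum>x\<in>V. \<Sum>y\<in>V. \<Sum>z\<in>V. g x y z)"
proof -
  have c: "card (I - {i} - {j} - {k}) = card I - 3"
    using I by (auto simp: card_Diff_singleton)
  have "j \<noteq> i" "k \<noteq> i" "k \<noteq> j"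
    using I by auto
  then show ?thesis
    using I by (simp add: sum_PiE_update[of I i] sum_PiE_update[of "I - {i}" j] sum_PiE_update[of "I - {i} - {j}" k]
        card_PiE c sum_distrib_left del: Diff_insert0)
qed

lemma sum_PiE4:
  fixes g :: "'a \<Rightarrow> 'a \<Rightarrow> 'a \<Rightarrow> 'a \<Rightarrow> real"
  assumes I: "finite I" "i \<in> I" "j \<in> I" "k \<in> I" "l \<in> I" "distinct [i, j, k, l]"
  shows "(\<Sum>\<phi>\<in>I \<rightarrow>\<^sub>E V. g (\<phi> i) (\<phi> j) (\<phi> k) (\<phi> l))
    = real (card V) ^ (card I - 4) * (\<Sum>x\<in>V. \<Sum>y\<in>V. \<Sum>z\<in>V. \<Sum>w\<in>V. g x y z w)"
proof -
  have c: "card (I - {i} - {j} - {k} - {l}) = card I - 4"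
    using I by (auto simp: card_Diff_singleton)
  have "j \<noteq> i" "k \<noteq> i" "k \<noteq> j" "l \<noteq> i" "l \<noteq> j" "l \<noteq> k"
    using I by auto
  then show ?thesis
    using I by (simp add: sum_PiE_update[of I i] sum_PiE_update[of "I - {i}" j] sum_PiE_update[of "I - {i} - {j}" k]
        sum_PiE_update[of "I - {i} - {j} - {k}" l] card_PiE c sum_distrib_left del: Diff_insert0)
qed

text \<open>Only genuine copies of the cycle are excluded, unlike in \<open>good\<close>; so a
  vertex may not be cloned here, and copies of \<open>K\<^sub>4\<close> minus an edge can
  occur.\<close>

definition C5_free_inj :: "('a \<Rightarrow> 'a \<Rightarrow> 'a \<Rightarrow> bool) \<Rightarrow> 'a set \<Rightarrow> bool" where
  "C5_free_inj E V \<longleftrightarrow> (\<forall>x y z. E x y z \<longrightarrow> E y x z \<and> E x z y) \<and> (\<forall>x y. \<not> E x x y) \<and>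
     (\<forall>a\<in>V. \<forall>b\<in>V. \<forall>c\<in>V. \<forall>d\<in>V. \<forall>e\<in>V. distinct [a, b, c, d, e] \<longrightarrow>
       E a b c \<longrightarrow> E b c d \<longrightarrow> E c d e \<longrightarrow> \<not> E d e a)"

lemma C5_free_injD:
  assumes "C5_free_inj E V"
  shows "E x y z \<Longrightarrow> E y x z \<and> E x z y" "\<not> E x x y"
    "a \<in> V \<Longrightarrow> b \<in> V \<Longrightarrow> c \<in> V \<Longrightarrow> d \<in> V \<Longrightarrow> e \<in> V \<Longrightarrow> distinct [a, b, c, d, e] \<Longrightarrow>
      E a b c \<Longrightarrow> E b c d \<Longrightarrow> E c d e \<Longrightarrow> E d e a \<Longrightarrow> False"
proof -
  show "E x y z \<Longrightarrow> E y x z \<and> E x z y" "\<not> E x x y"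
    using assms unfolding C5_free_inj_def by blast+
  have "\<forall>a\<in>V. \<forall>b\<in>V. \<forall>c\<in>V. \<forall>d\<in>V. \<forall>e\<in>V. distinct [a, b, c, d, e] \<longrightarrow>
       E a b c \<longrightarrow> E b c d \<longrightarrow> E c d e \<longrightarrow> \<not> E d e a"
    using assms unfolding C5_free_inj_def by (elim conjE)
  then show "a \<in> V \<Longrightarrow> b \<in> V \<Longrightarrow> c \<in> V \<Longrightarrow> d \<in> V \<Longrightarrow> e \<in> V \<Longrightarrow> distinct [a, b, c, d, e] \<Longrightarrow>
      E a b c \<Longrightarrow> E b c d \<Longrightarrow> E c d e \<Longrightarrow> E d e a \<Longrightarrow> False"
    by (simp only: Ball_def)
qed

definition K4_count :: "('a \<Rightarrow> 'a \<Rightarrow> 'a \<Rightarrow> bool) \<Rightarrow> 'a set \<Rightarrow> real" where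
  "K4_count E V = (\<Sum>a\<in>V. \<Sum>b\<in>V. \<Sum>c\<in>V. \<Sum>d\<in>V. of_bool (E a b c \<and> E a b d \<and> E a c d))"

text \<open>Three leaves b, c, d determine the apex: two apices a and e would give the cycle b, a,
  c, d, e.\<close>

lemma K4_count_bound:
  assumes free: "C5_free_inj E V" and V: "finite V"
  shows "K4_count E V \<le> real (card V) ^ 3"
proof -
  note symE = C5_free_injD(1)[OF free] and irr = C5_free_injD(2)[OF free] and C5 = C5_free_injD(3)[OF free]
  have s: "E x y z = E y x z" "E x y z = E x z y" for x y z
    using symE by blast+
  have "(\<Sum>a\<in>V. of_bool (E a b c \<and> E a b d \<and> E a c d)) \<le> (1 :: real)" if "b \<in> V" "c \<in> V" "d \<in> V" for b c d
  proof -
    let ?S = "{a \<in> V. E a b c \<and> E a b d \<and> E a c d}"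
    have "card ?S \<le> 1"
    proof (rule ccontr)
      assume "\<not> card ?S \<le> 1"
      then obtain a e where ae: "a \<in> ?S" "e \<in> ?S" "a \<noteq> e"
        using V by (auto simp: card_le_Suc0_iff_eq[of ?S, simplified] One_nat_def)
      have ne: "distinct [b, a, c, d, e]"
        using ae irr s by (auto simp del: not_False_eq_True) metis+
      show False
        by (rule C5[OF that(1) _ that(2,3) _ ne]) (use ae s in \<open>auto; metis\<close>)+
    qed
    moreover have "(\<Sum>a\<in>V. of_bool (E a b c \<and> E a b d \<and> E a c d)) = real (card ?S)"
      using V sum_of_bool_filter[OF V, of "\<lambda>a. E a b c \<and> E a b d \<and> E a c d" "\<lambda>_. 1"] by simp
    ultimately show ?thesis
      by simp
  qed
  then have "(\<Sum>b\<in>V. \<Sum>c\<in>V. \<Sum>d\<in>V. \<Sum>a\<in>V. of_bool (E a b c \<and> E a b d \<and> E a c d)) \<le> (\<Sum>b\<in>V. \<Sum>c\<in>V. \<Sum>d\<in>V. 1 :: real)"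
    by (intro sum_mono)
  moreover have "K4_count E V = (\<Sum>b\<in>V. \<Sum>c\<in>V. \<Sum>d\<in>V. \<Sum>a\<in>V. of_bool (E a b c \<and> E a b d \<and> E a c d))"
  proof -
    have "K4_count E V = (\<Sum>b\<in>V. \<Sum>a\<in>V. \<Sum>c\<in>V. \<Sum>d\<in>V. of_bool (E a b c \<and> E a b d \<and> E a c d))"
      unfolding K4_count_def by (rule sum.swap)
    also have "\<dots> = (\<Sum>b\<in>V. \<Sum>c\<in>V. \<Sum>a\<in>V. \<Sum>d\<in>V. of_bool (E a b c \<and> E a b d \<and> E a c d))"
      by (rule sum.cong[OF refl], rule sum.swap)
    also have "\<dots> = (\<Sum>b\<in>V. \<Sum>c\<in>V. \<Sum>d\<in>V. \<Sum>a\<in>V. of_bool (E a b c \<and> E a b d \<and> E a c d))"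
      by (rule sum.cong[OF refl], rule sum.cong[OF refl], rule sum.swap)
    finally show ?thesis .
  qed
  ultimately show ?thesis
    by (simp add: power3_eq_cube)
qed

text \<open>Deleting every edge that lies in a copy of \<open>K4\<close> minus an edge leaves a good relation, because a
  non-injective homomorphic image of the cycle identifies its second and fifth vertex.\<close>

lemma nedge_le_K4_count:
  fixes E :: "'a \<Rightarrow> 'a \<Rightarrow> 'a \<Rightarrow> bool" and \<phi> :: "nat \<Rightarrow> 'a"
  assumes free: "C5_free_inj E V" and \<phi>: "\<And>i. i < m \<Longrightarrow> \<phi> i \<in> V"
  shows "nedge (reind E \<phi>) {..<m} \<le> dens * real m ^ 3 + 3 * K4_count (reind E \<phi>) {..<m}"
proof -
  note symE = C5_free_injD(1)[OF free] and irr = C5_free_injD(2)[OF free] and C5 = C5_free_injD(3)[OF free]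
  define F where "F = reind E \<phi>"
  have s1: "F x y z = F y x z" and s2: "F x y z = F x z y" and ir: "\<not> F x x y" for x y z
    using symE irr unfolding F_def reind_def by blast+
  \<comment> \<open>The apex of a copy containing xyz can be any of x, y, z, whence the three
    alternatives and the factor 3.\<close>
  define bad where "bad x y z \<longleftrightarrow> (\<exists>w<m. F x y w \<and> F x z w \<or> F x y w \<and> F y z w \<or> F x z w \<and> F y z w)" for x y z
  define D where "D x y z \<longleftrightarrow> x < m \<and> y < m \<and> z < m \<and> F x y z \<and> \<not> bad x y z" for x y z
  have b1: "bad x y z = bad y x z" for x y z
    unfolding bad_def s1[of y x] by blast
  have b2: "bad x y z = bad x z y" for x y z
    unfolding bad_def s1[of z y] by blast
  have K: False if "D a b c" "D a b d" "D a c d" for a b c d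
    using that unfolding D_def bad_def by blast
  have gD: "good D"
    unfolding good_def
  proof (intro conjI allI impI notI)
    fix x y z assume "D x y z"
    then show "D y x z" "D x z y"
      unfolding D_def using s1 s2 b1 b2 by blast+
  next
    fix x y assume "D x x y"
    then show False using ir by (auto simp: D_def)
  next
    fix a b c d e assume h: "D a b c" "D b c d" "D c d e" "D d e a"
    then have F: "F a b c" "F b c d" "F c d e" "F d e a" and lt: "a < m" "b < m" "c < m" "d < m" "e < m"
      by (auto simp: D_def)
    have Ff: "F x y z \<Longrightarrow> \<phi> x \<noteq> \<phi> y \<and> \<phi> y \<noteq> \<phi> z \<and> \<phi> x \<noteq> \<phi> z" for x y z
      unfolding F_def reind_def using irr symE by metis
    show False
    proof (cases "\<phi> b = \<phi> e")
      case True
      have "F d b a"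
        using F(4) True by (simp add: F_def reind_def)
      then have "F a b d" "F b c d"
        using F s1 s2 by blast+
      then have "bad a b c"
        unfolding bad_def using lt by blast
      then show False
        using h by (simp add: D_def)
    next
      case False
      then have "distinct [\<phi> a, \<phi> b, \<phi> c, \<phi> d, \<phi> e]"
        using Ff[OF F(1)] Ff[OF F(2)] Ff[OF F(3)] Ff[OF F(4)] by auto
      then show False
        using C5[OF \<phi>[OF lt(1)] \<phi>[OF lt(2)] \<phi>[OF lt(3)] \<phi>[OF lt(4)] \<phi>[OF lt(5)]] F by (simp add: F_def reind_def)
    qed
  qed (use K in blast)
  let ?I = "{..<m}"
  have "nedge F ?I \<le> nedge D ?I + (\<Sum>x\<in>?I. \<Sum>y\<in>?I. \<Sum>z\<in>?I. \<Sum>w\<in>?I.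
      of_bool (F x y z \<and> F x y w \<and> F x z w) + of_bool (F y x z \<and> F y x w \<and> F y z w) + of_bool (F z x y \<and> F z x w \<and> F z y w))"
    unfolding nedge_def sum.distrib[symmetric]
  proof (intro sum_mono)
    fix x y z assume xyz: "x \<in> ?I" "y \<in> ?I" "z \<in> ?I"
    let ?g = "\<lambda>w. of_bool (F x y z \<and> F x y w \<and> F x z w) + of_bool (F y x z \<and> F y x w \<and> F y z w) + of_bool (F z x y \<and> F z x w \<and> F z y w) :: real"
    have g0: "0 \<le> ?g w" for w
      by simp
    show "of_bool (F x y z) \<le> of_bool (D x y z) + (\<Sum>w\<in>?I. ?g w)"
    proof (cases "F x y z \<and> bad x y z")
      case True
      then obtain w where w: "w < m" "F x y w \<and> F x z w \<or> F x y w \<and> F y z w \<or> F x z w \<and> F y z w"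
        by (auto simp: bad_def)
      have "F y x z" "F z x y" "F y x w = F x y w" "F z x w = F x z w" "F z y w = F y z w"
        using True s1 s2 by blast+
      then have "1 \<le> ?g w"
        using w True by auto
      also have "\<dots> \<le> (\<Sum>w\<in>?I. ?g w)"
        using w g0 by (intro member_le_sum) auto
      finally have "1 \<le> (\<Sum>w\<in>?I. ?g w)" .
      moreover have "of_bool (F x y z) \<le> (1 :: real)" "0 \<le> (of_bool (D x y z) :: real)"
        by simp_all
      ultimately show ?thesis
        by linarith
    next
      case False
      have "0 \<le> (\<Sum>w\<in>?I. ?g w)"
        by (intro sum_nonneg g0)
      moreover have "of_bool (F x y z) \<le> (of_bool (D x y z) :: real)"
        using False xyz by (auto simp: D_def)
      ultimately show ?thesis
        by linarith
    qed
  qed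
  also have "(\<Sum>x\<in>?I. \<Sum>y\<in>?I. \<Sum>z\<in>?I. \<Sum>w\<in>?I.
      of_bool (F x y z \<and> F x y w \<and> F x z w) + of_bool (F y x z \<and> F y x w \<and> F y z w) + of_bool (F z x y \<and> F z x w \<and> F z y w)) = 3 * K4_count F ?I"
  proof -
    have "(\<Sum>x\<in>?I. \<Sum>y\<in>?I. \<Sum>z\<in>?I. \<Sum>w\<in>?I. of_bool (F y x z \<and> F y x w \<and> F y z w)) = K4_count F ?I"
      unfolding K4_count_def by (rule sum.swap)
    moreover have "(\<Sum>x\<in>?I. \<Sum>y\<in>?I. \<Sum>z\<in>?I. \<Sum>w\<in>?I. of_bool (F z x y \<and> F z x w \<and> F z y w)) = K4_count F ?I"
    proof -
      have "(\<Sum>x\<in>?I. \<Sum>y\<in>?I. \<Sum>z\<in>?I. \<Sum>w\<in>?I. of_bool (F z x y \<and> F z x w \<and> F z y w))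
        = (\<Sum>x\<in>?I. \<Sum>z\<in>?I. \<Sum>y\<in>?I. \<Sum>w\<in>?I. of_bool (F z x y \<and> F z x w \<and> F z y w) :: real)"
        by (rule sum.cong[OF refl], rule sum.swap)
      also have "\<dots> = K4_count F ?I"
        unfolding K4_count_def by (rule sum.swap)
      finally show ?thesis .
    qed
    ultimately show ?thesis
      unfolding sum.distrib by (simp add: K4_count_def)
  qed
  finally show ?thesis
    using nedge_le_dens[OF gD, of ?I] by (simp add: F_def)
qed

text \<open>Average \<open>nedge_le_K4_count\<close> over all maps from m positions to V. The loss
  3/m comes from triples with repeated positions, and 3m/n from the expected number of copies of
  \<open>K\<^sub>4\<close> minus an edge in the sample.\<close>

lemma free_bound:
  fixes E :: "'a \<Rightarrow> 'a \<Rightarrow> 'a \<Rightarrow> bool"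
  assumes free: "C5_free_inj E V" and V: "finite V" "V \<noteq> {}"
    and m: "4 \<le> m"
  shows "nedge E V / real (card V) ^ 3 \<le> 1/4 + 3 / real m + 3 * real m / real (card V)"
proof -
  note symE = C5_free_injD(1)[OF free] and irr = C5_free_injD(2)[OF free] and C5 = C5_free_injD(3)[OF free]
  define n where "n = real (card V)"
  define q where "q = n ^ (m - 4)"
  let ?I = "{..<m}" and ?P = "{..<m} \<rightarrow>\<^sub>E V"
  have n: "0 < n"
    using V by (simp add: n_def card_gt_0_iff)
  have q: "0 < q"
    using n by (simp add: q_def)
  have nm3: "n ^ (m - 3) = q * n" and nm: "n ^ m = q * n ^ 4"
  proof -
    have "m - 3 = Suc (m - 4)" "m = (m - 4) + 4"
      using m by simp_all
    then show "n ^ (m - 3) = q * n" "n ^ m = q * n ^ 4"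
      unfolding q_def by (simp, metis power_add)
  qed
  have irrs: "\<not> E x y x" "\<not> E y x x" for x y
    using irr symE by blast+
  have "(\<Sum>\<phi>\<in>?P. nedge (reind E \<phi>) ?I) \<le> (\<Sum>\<phi>\<in>?P. dens * real m ^ 3 + 3 * K4_count (reind E \<phi>) ?I)"
  proof (rule sum_mono)
    fix \<phi> assume "\<phi> \<in> ?P"
    then have "\<phi> i \<in> V" if "i < m" for i
      using that by auto
    then show "nedge (reind E \<phi>) ?I \<le> dens * real m ^ 3 + 3 * K4_count (reind E \<phi>) ?I"
      by (intro nedge_le_K4_count[OF free])
  qed
  also have "\<dots> = n ^ m * (dens * real m ^ 3) + 3 * (\<Sum>\<phi>\<in>?P. K4_count (reind E \<phi>) ?I)"
    by (simp add: sum.distrib sum_distrib_left[symmetric] card_PiE n_def)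
  \<comment> \<open>Four distinct positions receive every quadruple of V equally often, and at most
    n^3 of the n^4 quadruples are copies; with a repeated position no copy is possible.\<close>
  also have "(\<Sum>\<phi>\<in>?P. K4_count (reind E \<phi>) ?I) \<le> real m ^ 4 * (q * n ^ 3)"
  proof -
    have "(\<Sum>\<phi>\<in>?P. K4_count (reind E \<phi>) ?I) = (\<Sum>i\<in>?I. \<Sum>j\<in>?I. \<Sum>k\<in>?I. \<Sum>l\<in>?I. \<Sum>\<phi>\<in>?P.
        of_bool (reind E \<phi> i j k \<and> reind E \<phi> i j l \<and> reind E \<phi> i k l))"
      unfolding K4_count_def by (subst sum.swap, rule sum.cong[OF refl])+ (rule refl)
    also have "\<dots> \<le> (\<Sum>i\<in>?I. \<Sum>j\<in>?I. \<Sum>k\<in>?I. \<Sum>l\<in>?I. q * n ^ 3)"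
    proof (intro sum_mono)
      fix i j k l assume I: "i \<in> ?I" "j \<in> ?I" "k \<in> ?I" "l \<in> ?I"
      show "(\<Sum>\<phi>\<in>?P. of_bool (reind E \<phi> i j k \<and> reind E \<phi> i j l \<and> reind E \<phi> i k l)) \<le> q * n ^ 3"
      proof (cases "distinct [i, j, k, l]")
        case True
        have "(\<Sum>\<phi>\<in>?P. of_bool (reind E \<phi> i j k \<and> reind E \<phi> i j l \<and> reind E \<phi> i k l)) = q * K4_count E V"
          unfolding reind_def K4_count_def using sum_PiE4[OF _ I True, where V = V and g = "\<lambda>x y z w. of_bool (E x y z \<and> E x y w \<and> E x z w)"]
          by (simp add: q_def n_def)
        also have "\<dots> \<le> q * n ^ 3"
          unfolding n_def using q K4_count_bound[OF free V(1)] by (intro mult_left_mono) (auto simp: n_def)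
        finally show ?thesis .
      next
        case False
        have "\<not> (reind E \<phi> i j k \<and> reind E \<phi> i j l \<and> reind E \<phi> i k l)" for \<phi>
          using False irr irrs unfolding reind_def by auto
        then have "(\<Sum>\<phi>\<in>?P. of_bool (reind E \<phi> i j k \<and> reind E \<phi> i j l \<and> reind E \<phi> i k l)) = (0 :: real)"
          by (intro sum.neutral) auto
        then show ?thesis
          using q n by simp
      qed
    qed
    also have "\<dots> = real m ^ 4 * (q * n ^ 3)"
      by (simp add: power4_eq_xxxx)
    finally show ?thesis .
  qed
  finally have up: "(\<Sum>\<phi>\<in>?P. nedge (reind E \<phi>) ?I) \<le> q * n ^ 4 * (dens * real m ^ 3) + 3 * (real m ^ 4 * (q * n ^ 3))"
    by (simp add: nm)
  \<comment> \<open>The factor 1 - [i = j] - [i = k] - [j = k] is 1 on distinct positions and never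
    positive otherwise, so it underestimates the number of usable triples.\<close>
  have low: "(\<Sum>\<phi>\<in>?P. nedge (reind E \<phi>) ?I) \<ge> (real m ^ 3 - 3 * real m ^ 2) * (q * n * nedge E V)"
  proof -
    have c0: "0 \<le> q * n * nedge E V"
      using q n nedge_nonneg[of E V] by simp
    have "(real m ^ 3 - 3 * real m ^ 2) * (q * n * nedge E V)
      = (\<Sum>i\<in>?I. \<Sum>j\<in>?I. \<Sum>k\<in>?I. (1 - of_bool (i = j) - of_bool (i = k) - of_bool (j = k)) * (q * n * nedge E V))"
    proof -
      have "(\<Sum>i\<in>?I. \<Sum>j\<in>?I. \<Sum>k\<in>?I. (1 - of_bool (i = j) - of_bool (i = k) - of_bool (j = k) :: real)) = real m ^ 3 - 3 * real m ^ 2"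
        by (simp add: sum_subtractf of_bool_def power3_eq_cube power2_eq_square sum_distrib_left[symmetric])
          (simp add: algebra_simps)
      then show ?thesis
        by (simp only: sum_distrib_right[symmetric])
    qed
    also have "\<dots> \<le> (\<Sum>i\<in>?I. \<Sum>j\<in>?I. \<Sum>k\<in>?I. \<Sum>\<phi>\<in>?P. of_bool (reind E \<phi> i j k))"
    proof (intro sum_mono)
      fix i j k assume I: "i \<in> ?I" "j \<in> ?I" "k \<in> ?I"
      show "(1 - of_bool (i = j) - of_bool (i = k) - of_bool (j = k)) * (q * n * nedge E V) \<le> (\<Sum>\<phi>\<in>?P. of_bool (reind E \<phi> i j k))"
      proof (cases "distinct [i, j, k]")
        case True
        have "(\<Sum>\<phi>\<in>?P. of_bool (reind E \<phi> i j k)) = q * n * nedge E V"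
          unfolding reind_def nedge_def using sum_PiE3[OF _ I True, where V = V and g = "\<lambda>x y z. of_bool (E x y z)"]
          by (simp add: nm3[unfolded n_def] n_def)
        then show ?thesis
          using True by simp
      next
        case False
        then have "(1 - of_bool (i = j) - of_bool (i = k) - of_bool (j = k)) * (q * n * nedge E V) \<le> 0"
          using c0 by (intro mult_nonpos_nonneg) auto
        also have "0 \<le> (\<Sum>\<phi>\<in>?P. of_bool (reind E \<phi> i j k) :: real)"
          by (intro sum_nonneg) simp
        finally show ?thesis .
      qed
    qed
    also have "\<dots> = (\<Sum>\<phi>\<in>?P. nedge (reind E \<phi>) ?I)"
      unfolding nedge_def by (rule sym, (subst sum.swap, rule sum.cong[OF refl])+) (rule refl)
    finally show ?thesis .
  qed
  define \<rho> where "\<rho> = nedge E V / n ^ 3"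
  have \<rho>1: "\<rho> \<le> 1"
    using nedge_le[of E V] n by (simp add: \<rho>_def n_def)
  have "nedge E V = \<rho> * n ^ 3"
    using n by (simp add: \<rho>_def)
  then have "(real m ^ 3 - 3 * real m ^ 2) * (q * n * (\<rho> * n ^ 3)) \<le> q * n ^ 4 * (dens * real m ^ 3) + 3 * (real m ^ 4 * (q * n ^ 3))"
    using low up by simp
  moreover have "(q * n ^ 4 * real m ^ 3) * (\<rho> - 3 / real m * \<rho>) \<le> (q * n ^ 4 * real m ^ 3) * (dens + 3 * real m / n)"
    if "(real m ^ 3 - 3 * real m ^ 2) * (q * n * (\<rho> * n ^ 3)) \<le> q * n ^ 4 * (dens * real m ^ 3) + 3 * (real m ^ 4 * (q * n ^ 3))"
  proof -
    have "(q * n ^ 4 * real m ^ 3) * (\<rho> - 3 / real m * \<rho>) = (real m ^ 3 - 3 * real m ^ 2) * (q * n * (\<rho> * n ^ 3))"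
      using m by (simp add: field_simps power2_eq_square power3_eq_cube power4_eq_xxxx)
    moreover have "(q * n ^ 4 * real m ^ 3) * (dens + 3 * real m / n) = q * n ^ 4 * (dens * real m ^ 3) + 3 * (real m ^ 4 * (q * n ^ 3))"
      using n by (simp add: field_simps power3_eq_cube power4_eq_xxxx)
    ultimately show ?thesis
      using that by (simp only:)
  qed
  moreover have "0 < q * n ^ 4 * real m ^ 3"
    using q n m by simp
  ultimately have "\<rho> - 3 / real m * \<rho> \<le> dens + 3 * real m / n"
    by (metis mult_le_cancel_left_pos)
  moreover have "3 / real m * \<rho> \<le> 3 / real m"
    using \<rho>1 mult_left_mono[of \<rho> 1 "3 / real m"] by simp
  ultimately show ?thesis
    using dens_le by (simp add: \<rho>_def n_def)
qed

section \<open>The lower bound\<close>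

text \<open>The iterated balanced blow-up of an edge, read off the base 3 digits.\<close>

function tern :: "nat \<Rightarrow> nat \<Rightarrow> nat \<Rightarrow> bool" where
  "tern x y z = (if x + y + z = 0 then False
     else if x mod 3 = y mod 3 \<and> y mod 3 = z mod 3 then tern (x div 3) (y div 3) (z div 3)
     else x mod 3 \<noteq> y mod 3 \<and> y mod 3 \<noteq> z mod 3 \<and> x mod 3 \<noteq> z mod 3)"
  by pat_completeness auto
termination
proof (relation "Wellfounded.measure (\<lambda>(x, y, z). x + y + z)")
  fix x y z :: nat assume "x + y + z \<noteq> 0"
  then have "x div 3 + y div 3 + z div 3 < x + y + z"
    by linarith
  then show "((x div 3, y div 3, z div 3), x, y, z) \<in> Wellfounded.measure (\<lambda>(x, y, z). x + y + z)"
    by simp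
qed simp

declare tern.simps [simp del]

lemma tern_nonzero: "tern x y z \<Longrightarrow> x + y + z \<noteq> 0"
  by (subst (asm) tern.simps) (simp split: if_splits)

lemma tern_equal_digits:
  assumes "x mod 3 = y mod 3" "y mod 3 = z mod 3"
  shows "tern x y z \<longleftrightarrow> tern (x div 3) (y div 3) (z div 3)"
proof (cases "x + y + z = 0")
  case True
  then show ?thesis by simp
next
  case False
  then show ?thesis
    using assms by (subst tern.simps) auto
qed

lemma tern_digits:
  "tern x y z \<Longrightarrow> x mod 3 = y mod 3 \<and> y mod 3 = z mod 3 \<or> x mod 3 \<noteq> y mod 3 \<and> y mod 3 \<noteq> z mod 3 \<and> x mod 3 \<noteq> z mod 3"
  by (auto simp: tern.simps[of x y z] split: if_splits)

lemma tern_distinct_digits: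
  "x mod 3 \<noteq> y mod 3 \<Longrightarrow> y mod 3 \<noteq> z mod 3 \<Longrightarrow> x mod 3 \<noteq> z mod 3 \<Longrightarrow> tern x y z"
  by (auto simp: tern.simps[of x y z])

lemma tern_swap: "tern x y z \<Longrightarrow> tern y x z \<and> tern x z y"
proof (induction x y z rule: tern.induct)
  case (1 x y z)
  show ?case
  proof (cases "x mod 3 = y mod 3 \<and> y mod 3 = z mod 3")
    case True
    then have "tern (x div 3) (y div 3) (z div 3)"
      using "1.prems" by (simp add: tern_equal_digits)
    then have "tern (y div 3) (x div 3) (z div 3) \<and> tern (x div 3) (z div 3) (y div 3)"
      using "1.IH" True tern_nonzero[OF "1.prems"] by blast
    then show ?thesis
      using True by (simp add: tern_equal_digits)
  next
    case False
    then show ?thesis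
      using tern_digits[OF "1.prems"] by (auto intro!: tern_distinct_digits)
  qed
qed

lemma tern_irrefl: "\<not> tern x x y"
proof (induction "x + y" arbitrary: x y rule: less_induct)
  case less
  show ?case
  proof
    assume h: "tern x x y"
    have e: "x mod 3 = y mod 3" and p: "x + y \<noteq> 0"
      using tern_digits[OF h] tern_nonzero[OF h] by auto
    have "x div 3 + y div 3 < x + y"
      using p by linarith
    from less[OF this] show False
      using h e by (simp add: tern_equal_digits)
  qed
qed

lemma mod3_third:
  fixes a b c d :: nat
  assumes "a mod 3 \<noteq> b mod 3" "b mod 3 \<noteq> c mod 3" "a mod 3 \<noteq> c mod 3" "a mod 3 \<noteq> d mod 3" "b mod 3 \<noteq> d mod 3"
  shows "c mod 3 = d mod 3"
proof -
  have "a' < 3 \<Longrightarrow> b' < 3 \<Longrightarrow> c' < 3 \<Longrightarrow> d' < 3 \<Longrightarrow> a' \<noteq> b' \<Longrightarrow> b' \<noteq> c' \<Longrightarrow> a' \<noteq> c' \<Longrightarrow> a' \<noteq> d' \<Longrightarrow> b' \<noteq> d' \<Longrightarrow> c' = d'"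
    for a' b' c' d' :: nat
    by linarith
  from this[of "a mod 3" "b mod 3" "c mod 3" "d mod 3"] show ?thesis
    using assms by simp
qed

text \<open>If the last digits of a and b differ, then c and d both carry the third digit and acd
  has exactly two equal digits. Otherwise all digits agree and can be stripped.\<close>

lemma tern_K4: "tern a b c \<Longrightarrow> tern a b d \<Longrightarrow> \<not> tern a c d"
proof (induction "a + b + c + d" arbitrary: a b c d rule: less_induct)
  case less
  note D = tern_digits[OF less.prems(1)] tern_digits[OF less.prems(2)]
  show ?case
  proof
    assume h: "tern a c d"
    show False
    proof (cases "a mod 3 = b mod 3")
      case False
      then have "c mod 3 = d mod 3"
        using D mod3_third[of a b c d] by metis
      then show False
        using tern_digits[OF h] D False by metis
    next
      case True
      then have e: "b mod 3 = c mod 3" "b mod 3 = d mod 3" "c mod 3 = d mod 3" "a mod 3 = c mod 3"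
        using D by metis+
      have lt: "a div 3 + b div 3 + c div 3 + d div 3 < a + b + c + d"
        using tern_nonzero[OF less.prems(1)] by linarith
      have "tern (a div 3) (b div 3) (c div 3)" "tern (a div 3) (b div 3) (d div 3)" "tern (a div 3) (c div 3) (d div 3)"
        using less.prems h tern_equal_digits[OF True e(1)] tern_equal_digits[OF True e(2)] tern_equal_digits[OF e(4,3)] by simp_all
      then show False
        using less.hyps[OF lt] by blast
    qed
  qed
qed

text \<open>If the last digits of a and b differ, then d repeats the digit of a, so dea forces e to
  have that digit too, while cde with distinct digits at c and d forbids it. Otherwise all digits
  agree and can be stripped.\<close>

lemma tern_C5: "tern a b c \<Longrightarrow> tern b c d \<Longrightarrow> tern c d e \<Longrightarrow> \<not> tern d e a"
proof (induction "a + b + c + d + e" arbitrary: a b c d e rule: less_induct)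
  case less
  note D = tern_digits[OF less.prems(1)] tern_digits[OF less.prems(2)] tern_digits[OF less.prems(3)]
  show ?case
  proof
    assume h: "tern d e a"
    show False
    proof (cases "a mod 3 = b mod 3")
      case False
      then have "a mod 3 = d mod 3"
        using D mod3_third[of b c a d] by metis
      then show False
        using tern_digits[OF h] D False by metis
    next
      case True
      then have e: "b mod 3 = c mod 3" "c mod 3 = d mod 3" "d mod 3 = e mod 3" "e mod 3 = a mod 3"
        using D by metis+
      have lt: "a div 3 + b div 3 + c div 3 + d div 3 + e div 3 < a + b + c + d + e"
        using tern_nonzero[OF less.prems(1)] by linarith
      have "tern (a div 3) (b div 3) (c div 3)" "tern (b div 3) (c div 3) (d div 3)" "tern (c div 3) (d div 3) (e div 3)"
        "tern (d div 3) (e div 3) (a div 3)"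
        using less.prems h tern_equal_digits[OF True e(1)] tern_equal_digits[OF e(1,2)] tern_equal_digits[OF e(2,3)]
          tern_equal_digits[OF e(3,4)] by simp_all
      then show False
        using less.hyps[OF lt] by blast
    qed
  qed
qed

lemma good_tern: "good tern"
  unfolding good_def using tern_swap tern_irrefl tern_K4 tern_C5 by blast

text \<open>The residue classes modulo 3 are scaled copies of the whole, and all triples transversal
  to them are edges. The classes consume about a third of the error 6 n^2; the rest pays for their
  unequal sizes.\<close>

lemma nedge_tern: "real n ^ 3 / 4 - 6 * real n ^ 2 \<le> nedge tern {..<n}"
proof (induction n rule: less_induct)
  case (less n)
  show ?case
  proof (cases "n < 3")
    case True
    have "real n ^ 3 / 4 \<le> 6 * real n ^ 2"
    proof -
      have "real n * real n ^ 2 \<le> 24 * real n ^ 2"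
        using True by (intro mult_right_mono) auto
      then show ?thesis
        by (simp add: power3_eq_cube power2_eq_square)
    qed
    then show ?thesis
      using nedge_nonneg[of tern "{..<n}"] by linarith
  next
    case False
    \<comment> \<open>For r < 3 this is the number of x < n with x mod 3 = r.\<close>
    define k where "k r = (n + 2 - r) div 3" for r
    define X where "X r = (\<lambda>q. 3 * q + r) ` {..<k r}" for r
    have inj: "inj_on (\<lambda>q. 3 * q + r) A" for A and r :: nat
      by (auto simp: inj_on_def)
    have cX: "card (X r) = k r" "finite (X r)" for r
      by (simp_all add: X_def card_image[OF inj])
    have mX: "x mod 3 = r" if "x \<in> X r" "r < 3" for x r
      using that by (auto simp: X_def)
    have V: "{..<n} = X 0 \<union> X 1 \<union> X 2"
    proof (intro equalityI subsetI)
      fix x assume "x \<in> {..<n}"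
      then have x: "x < n" by simp
      have "x = 3 * (x div 3) + x mod 3" "x mod 3 < 3" by simp_all
      then consider "x = 3 * (x div 3) + 0" | "x = 3 * (x div 3) + 1" | "x = 3 * (x div 3) + 2"
        by linarith
      then show "x \<in> X 0 \<union> X 1 \<union> X 2"
      proof cases
        case 1
        then have "x div 3 < k 0" using x unfolding k_def by linarith
        then show ?thesis using 1 unfolding X_def by blast
      next
        case 2
        then have "x div 3 < k 1" using x unfolding k_def by linarith
        then show ?thesis using 2 unfolding X_def by blast
      next
        case 3
        then have "x div 3 < k 2" using x unfolding k_def by linarith
        then show ?thesis using 3 unfolding X_def by blast
      qed
    next
      fix x assume "x \<in> X 0 \<union> X 1 \<union> X 2"
      then show "x \<in> {..<n}"
        by (auto simp: X_def k_def)
    qed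
    have dj: "X 0 \<inter> X 1 = {}" "X 0 \<inter> X 2 = {}" "X 1 \<inter> X 2 = {}"
      using mX[of _ 0] mX[of _ 1] mX[of _ 2] by force+
    have part: "nedge tern (X r) = nedge tern {..<k r}" if "r < 3" for r
    proof -
      have "reind tern (\<lambda>q. 3 * q + r) = tern"
        using that by (intro ext) (simp add: reind_def tern_equal_digits)
      then show ?thesis
        unfolding X_def by (simp add: nedge_image[OF inj])
    qed
    have miss: "miss tern (X 0) (X 1) (X 2) = 0"
      unfolding miss_def using mX by (intro sum.neutral ballI) (auto intro!: tern_distinct_digits)
    have t0: "0 \<le> edge_count tern P Q R" for P Q R
      unfolding edge_count_def by (intro sum_nonneg link_nonneg)
    have low: "nedge tern {..<k 0} + nedge tern {..<k 1} + nedge tern {..<k 2} + 6 * (real (k 0) * real (k 1) * real (k 2)) \<le> nedge tern {..<n}"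
      unfolding V nedge_three_parts[OF good_tern cX(2) cX(2) cX(2) dj] miss cX(1)
      using part[of 0] part[of 1] part[of 2] t0[of "X 1" "X 0" "X 0"] t0[of "X 2" "X 0" "X 0"] t0[of "X 0" "X 1" "X 1"]
        t0[of "X 2" "X 1" "X 1"] t0[of "X 0" "X 2" "X 2"] t0[of "X 1" "X 2" "X 2"] by simp
    have IH: "real (k r) ^ 3 / 4 - 6 * real (k r) ^ 2 \<le> nedge tern {..<k r}" for r
      using less[of "k r"] False unfolding k_def by force
    define a b c where "a = real (k 0)" and "b = real (k 1)" and "c = real (k 2)"
    have kk: "k 0 + k 1 + k 2 = n" "k 1 \<le> k 0" "k 2 \<le> k 1" "k 0 \<le> k 2 + 1"
    proof -
      have k: "k 0 = (n + 2) div 3" "k 1 = (n + 1) div 3" "k 2 = n div 3"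
        by (simp_all add: k_def)
      show "k 0 + k 1 + k 2 = n"
        unfolding k by presburger
      show "k 1 \<le> k 0" "k 2 \<le> k 1"
        unfolding k by (simp_all add: div_le_mono)
      show "k 0 \<le> k 2 + 1"
        unfolding k by presburger
    qed
    have n: "real n = a + b + c"
      unfolding kk(1)[symmetric] a_def b_def c_def by simp
    have le: "b \<le> a" "c \<le> b" "a \<le> c + 1"
      using kk(2-4) unfolding a_def b_def c_def by linarith+
    have nn: "0 \<le> a" "0 \<le> b" "0 \<le> c"
      by (simp_all add: a_def b_def c_def)
    have n3: "3 \<le> a + b + c"
      using False n by linarith
    have sq: "(b - c)\<^sup>2 \<le> 1" "(a - c)\<^sup>2 \<le> 1" "(a - b)\<^sup>2 \<le> 1"
      using le by (auto intro!: power_le_one)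
    have "a * (b - c)\<^sup>2 + b * (a - c)\<^sup>2 + c * (a - b)\<^sup>2 \<le> a * 1 + b * 1 + c * 1"
      using nn sq by (intro add_mono mult_left_mono)
    moreover have "(a + b + c) ^ 3 = a ^ 3 + b ^ 3 + c ^ 3 + 24 * (a * b * c) + 3 * (a * (b - c)\<^sup>2 + b * (a - c)\<^sup>2 + c * (a - b)\<^sup>2)"
      by (simp add: power2_eq_square power3_eq_cube algebra_simps)
    moreover have "3 * (a\<^sup>2 + b\<^sup>2 + c\<^sup>2) = (a + b + c)\<^sup>2 + ((b - c)\<^sup>2 + (a - c)\<^sup>2 + (a - b)\<^sup>2)"
      by (simp add: power2_eq_square algebra_simps)
    moreover have "3 * (a + b + c) \<le> (a + b + c)\<^sup>2"
      unfolding power2_eq_square using n3 by (intro mult_right_mono) auto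
    ultimately have "(a + b + c) ^ 3 / 4 - 6 * (a + b + c)\<^sup>2 \<le> a ^ 3 / 4 - 6 * a\<^sup>2 + (b ^ 3 / 4 - 6 * b\<^sup>2) + (c ^ 3 / 4 - 6 * c\<^sup>2) + 6 * (a * b * c)"
      using sq n3 by argo
    then show ?thesis
      using low IH[of 0] IH[of 1] IH[of 2] unfolding n a_def b_def c_def by argo
  qed
qed

section \<open>From ordered triples to edge sets, and the limit\<close>

lemma set3_eqD:
  assumes eq: "{x, y, z} = {a, b, c}" and "a \<noteq> b" "b \<noteq> c" "a \<noteq> c"
  shows "(x, y, z) \<in> {(a, b, c), (a, c, b), (b, a, c), (b, c, a), (c, a, b), (c, b, a)}"
proof -
  have "x \<in> {a, b, c}" "y \<in> {a, b, c}" "z \<in> {a, b, c}" "a \<in> {x, y, z}" "b \<in> {x, y, z}" "c \<in> {x, y, z}"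
    using eq by blast+
  then show ?thesis
    using assms(2-4) by (simp only: insert_iff empty_iff prod.inject) argo
qed

text \<open>Each 3-element edge is listed by its six orderings, and different edges have disjoint
  lists.\<close>

lemma card_triples:
  assumes V: "finite V" and F: "\<And>e. e \<in> F \<Longrightarrow> e \<subseteq> V \<and> card e = 3"
  shows "nedge (\<lambda>x y z. {x, y, z} \<in> F) V = 6 * real (card F)"
proof -
  define T where "T e = {(x, y, z). {x, y, z} = e}" for e :: "'a set"
  have T: "(x, y, z) \<in> T e \<longleftrightarrow> {x, y, z} = e" for x y z e
    by (simp add: T_def)
  have UT: "(x, y, z) \<in> (\<Union>e\<in>F. T e) \<longleftrightarrow> {x, y, z} \<in> F" for x y z
    unfolding UN_iff T by blast
  have finF: "finite F"
    using F V by (intro finite_subset[of F "Pow V"]) auto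
  have six: "card (T e) = 6 \<and> finite (T e)" if e: "card e = 3" for e :: "'a set"
  proof -
    obtain a b c where abc: "e = {a, b, c}" "a \<noteq> b" "b \<noteq> c" "a \<noteq> c"
      using e by (auto simp: card_3_iff)
    have "T e = {(a, b, c), (a, c, b), (b, a, c), (b, c, a), (c, a, b), (c, b, a)}"
    proof (intro equalityI subsetI)
      fix p assume p: "p \<in> T e"
      obtain x y z where xyz: "p = (x, y, z)"
        by (cases p)
      show "p \<in> {(a, b, c), (a, c, b), (b, a, c), (b, c, a), (c, a, b), (c, b, a)}"
        using p unfolding xyz T abc(1) by (rule set3_eqD[OF _ abc(2-4)])
    next
      fix p assume "p \<in> {(a, b, c), (a, c, b), (b, a, c), (b, c, a), (c, a, b), (c, b, a)}"
      then show "p \<in> T e"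
        unfolding abc(1) by (elim insertE emptyE) (simp_all add: T insert_commute)
    qed
    then show ?thesis
      using abc by simp
  qed
  have "nedge (\<lambda>x y z. {x, y, z} \<in> F) V = (\<Sum>(x, y, z)\<in>V \<times> V \<times> V. of_bool ({x, y, z} \<in> F))"
    by (simp add: nedge_def sum.cartesian_product)
  also have "\<dots> = (\<Sum>p\<in>V \<times> V \<times> V. of_bool (p \<in> (\<Union>e\<in>F. T e)) * 1)"
  proof (intro sum.cong refl)
    fix p :: "'a \<times> 'a \<times> 'a"
    show "(case p of (x, y, z) \<Rightarrow> of_bool ({x, y, z} \<in> F)) = (of_bool (p \<in> (\<Union>e\<in>F. T e)) * 1 :: real)"
      by (cases p) (simp only: prod.case UT mult_1_right)
  qed
  also have "\<dots> = real (card {p \<in> V \<times> V \<times> V. p \<in> (\<Union>e\<in>F. T e)})"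
    using V by (subst sum_of_bool_filter) simp_all
  also have "{p \<in> V \<times> V \<times> V. p \<in> (\<Union>e\<in>F. T e)} = (\<Union>e\<in>F. T e)"
  proof -
    have "p \<in> V \<times> V \<times> V" if p: "p \<in> (\<Union>e\<in>F. T e)" for p
    proof -
      obtain x y z where xyz: "p = (x, y, z)"
        by (cases p)
      show ?thesis
        using F[of "{x, y, z}"] p unfolding xyz UT by simp
    qed
    then show ?thesis
      by blast
  qed
  also have "card (\<Union>e\<in>F. T e) = (\<Sum>e\<in>F. card (T e))"
  proof (rule card_UN_disjoint[OF finF])
    show "\<forall>e\<in>F. finite (T e)"
      using six F by blast
    have "T e \<inter> T f = {}" if "e \<noteq> f" for e f
      using that by (auto simp: T_def)
    then show "\<forall>e\<in>F. \<forall>f\<in>F. e \<noteq> f \<longrightarrow> T e \<inter> T f = {}"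
      by blast
  qed
  also have "\<dots> = 6 * card F"
    using six F by simp
  finally show ?thesis
    by simp
qed

lemma ex_turan_upper:
  assumes "0 < n" "4 \<le> m"
  shows "6 * real (ex_turan n C5_minus) / real n ^ 3 \<le> 1/4 + 3 / real m + 3 * real m / real n"
proof -
  have "ex_turan n C5_minus \<in> free_sizes n C5_minus"
    unfolding ex_turan_def by (rule Max_in[OF finite_free_sizes free_sizes_nonempty]) (simp add: C5_minus_def)
  then obtain G :: "nat hypergraph" where G: "finite (fst G)" "card (fst G) = n" "three_graph G" "\<not> contains_copy G C5_minus"
    and e: "ex_turan n C5_minus = card (snd G)"
    by (auto simp: free_sizes_def)
  let ?E = "\<lambda>x y z. {x, y, z} \<in> snd G"
  have F: "e \<subseteq> fst G \<and> card e = 3" if "e \<in> snd G" for e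
    using G(3) that by (auto simp: three_graph_def)
  have "C5_free_inj ?E (fst G)"
    unfolding C5_free_inj_def
  proof (intro conjI allI ballI impI notI)
    fix x y z assume "{x, y, z} \<in> snd G"
    then show "{y, x, z} \<in> snd G" "{x, z, y} \<in> snd G"
      by (simp_all add: insert_commute)
  next
    fix x y assume "{x, x, y} \<in> snd G"
    then show False
      using F[of "{x, x, y}"] by (auto simp: card_insert_if split: if_splits)
  next
    fix a b c d e
    assume h: "a \<in> fst G" "b \<in> fst G" "c \<in> fst G" "d \<in> fst G" "e \<in> fst G" "distinct [a, b, c, d, e]"
      "{a, b, c} \<in> snd G" "{b, c, d} \<in> snd G" "{c, d, e} \<in> snd G" "{d, e, a} \<in> snd G"
    \<comment> \<open>The default branch serves the vertex 5.\<close>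
    define \<phi> where "\<phi> i = (if i = 1 then a else if i = 2 then b else if i = 3 then c else if i = 4 then d else e)" for i :: nat
    have "contains_copy G C5_minus"
      unfolding contains_copy_def
    proof (intro exI[of _ \<phi>] conjI ballI)
      show "inj_on \<phi> (fst C5_minus)"
        using h(6) by (auto simp: inj_on_def C5_minus_def \<phi>_def)
      show "\<phi> ` fst C5_minus \<subseteq> fst G"
        using h by (auto simp: C5_minus_def \<phi>_def)
      fix f assume "f \<in> snd C5_minus"
      then show "\<phi> ` f \<in> snd G"
        using h by (auto simp: C5_minus_def \<phi>_def insert_commute)
    qed
    then show False
      using G(4) by simp
  qed
  moreover have "fst G \<noteq> {}"
    using G(2) assms(1) by auto
  ultimately have "nedge ?E (fst G) / real n ^ 3 \<le> 1/4 + 3 / real m + 3 * real m / real n"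
    using free_bound[of ?E "fst G" m] G(1,2) assms(2) by simp
  then show ?thesis
    using card_triples[OF G(1) F] e by simp
qed

text \<open>The unordered triples of \<open>tern\<close> below n form the witness; membership of {x,
  y, z} reduces to \<open>tern x y z\<close> by symmetry, so goodness excludes the cycle.\<close>

lemma ex_turan_lower: "real n ^ 3 / 4 - 6 * real n ^ 2 \<le> 6 * real (ex_turan n C5_minus)"
proof -
  define F where "F = {{x, y, z} | x y z. x < n \<and> y < n \<and> z < n \<and> tern x y z}"
  have ne: "x \<noteq> y \<and> y \<noteq> z \<and> x \<noteq> z" if "tern x y z" for x y z
    using that good_irr[OF good_tern] by blast
  have F: "e \<subseteq> {..<n} \<and> card e = 3" if "e \<in> F" for e
    using that ne by (auto simp: F_def)
  have mem: "{x, y, z} \<in> F \<longleftrightarrow> x < n \<and> y < n \<and> z < n \<and> tern x y z" for x y z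
  proof
    assume "{x, y, z} \<in> F"
    then obtain a b c where abc: "{x, y, z} = {a, b, c}" "a < n" "b < n" "c < n" "tern a b c"
      by (auto simp: F_def)
    have mem: "(x, y, z) \<in> {(a, b, c), (a, c, b), (b, a, c), (b, c, a), (c, a, b), (c, b, a)}"
      using ne[OF abc(5)] by (intro set3_eqD[OF abc(1)]) auto
    show "x < n \<and> y < n \<and> z < n \<and> tern x y z"
    proof -
      have "tern a c b" "tern b a c" "tern b c a" "tern c a b" "tern c b a"
        using abc(5) good_commute[OF good_tern] by metis+
      then show ?thesis
        using mem abc(2-5) by (elim insertE emptyE) simp_all
    qed
  qed (auto simp: F_def)
  have "\<not> contains_copy ({..<n}, F) C5_minus"
  proof
    assume "contains_copy ({..<n}, F) C5_minus"
    then obtain \<phi> where "\<forall>e\<in>snd C5_minus. \<phi> ` e \<in> F"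
      by (auto simp: contains_copy_def)
    then have "{\<phi> 1, \<phi> 2, \<phi> 3} \<in> F" "{\<phi> 2, \<phi> 3, \<phi> 4} \<in> F" "{\<phi> 3, \<phi> 4, \<phi> 5} \<in> F" "{\<phi> 4, \<phi> 5, \<phi> 1} \<in> F"
      by (auto simp: C5_minus_def)
    then show False
      using good_C5[OF good_tern] unfolding mem by blast
  qed
  then have "card F \<in> free_sizes n C5_minus"
    unfolding free_sizes_def using F by (intro CollectI exI[of _ "({..<n}, F)"]) (auto simp: three_graph_def)
  then have "card F \<le> ex_turan n C5_minus"
    unfolding ex_turan_def by (rule Max_ge[OF finite_free_sizes])
  moreover have "6 * real (card F) = nedge tern {..<n}"
  proof -
    have "6 * real (card F) = nedge (\<lambda>x y z. {x, y, z} \<in> F) {..<n}"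
      using card_triples[of "{..<n}" F] F by simp
    also have "\<dots> = nedge tern {..<n}"
      unfolding nedge_def mem by (intro sum.cong) auto
    finally show ?thesis .
  qed
  ultimately show ?thesis
    using nedge_tern[of n] by linarith
qed

lemma choose_three: "real (n choose 3) = real n * (real n - 1) * (real n - 2) / 6"
  by (simp add: binomial_gbinomial gbinomial_prod_rev numeral_3_eq_3 lessThan_Suc fact_numeral mult_ac)

lemma ex_turan_cube_limit: "(\<lambda>n. 6 * real (ex_turan n C5_minus) / real n ^ 3) \<longlonglongrightarrow> 1/4"
proof (rule LIMSEQ_I)
  fix r :: real assume r: "0 < r"
  \<comment> \<open>The sample size m is fixed first to make 3/m less than r/2; n then grows to make
    3m/n less than r/2.\<close>
  obtain m :: nat where m: "6 / r < real m" "4 \<le> m"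
    using reals_Archimedean2[of "max (6 / r) 4"] by (metis max_less_iff_conj less_imp_le of_nat_less_iff of_nat_numeral)
  obtain N :: nat where N: "max (6 * real m / r) (6 / r) < real N"
    using reals_Archimedean2 by blast
  have "norm (6 * real (ex_turan n C5_minus) / real n ^ 3 - 1/4) < r" if "N \<le> n" for n
  proof -
    have n1: "6 * real m / r < real n" "6 / r < real n"
      using N that by auto
    have n0: "0 < real n"
      using n1(2) r by (meson divide_pos_pos less_trans zero_less_numeral)
    have "6 * real (ex_turan n C5_minus) / real n ^ 3 \<le> 1/4 + 3 / real m + 3 * real m / real n"
      using n0 m by (intro ex_turan_upper) auto
    moreover have "3 / real m < r / 2" "3 * real m / real n < r / 2" "6 / real n < r"
      using m n1 n0 r by (simp_all add: field_simps)
    moreover have "1/4 - 6 / real n \<le> 6 * real (ex_turan n C5_minus) / real n ^ 3"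
    proof -
      have "(real n ^ 3 / 4 - 6 * real n ^ 2) / real n ^ 3 \<le> 6 * real (ex_turan n C5_minus) / real n ^ 3"
        using ex_turan_lower[of n] n0 by (intro divide_right_mono) auto
      moreover have "(real n ^ 3 / 4 - 6 * real n ^ 2) / real n ^ 3 = 1/4 - 6 / real n"
        using n0 by (simp add: field_simps power2_eq_square power3_eq_cube)
      ultimately show ?thesis by simp
    qed
    ultimately show ?thesis
      by (simp add: abs_less_iff)
  qed
  then show "\<exists>no. \<forall>n\<ge>no. norm (6 * real (ex_turan n C5_minus) / real n ^ 3 - 1/4) < r"
    by blast
qed

theorem theorem1p1:
  shows "(\<lambda>n. real (ex_turan n C5_minus) / real (n choose 3)) \<longlonglongrightarrow> 1 / 4
    \<and> turan_density C5_minus = 1 / 4"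
proof -
  have "(\<lambda>n. real n ^ 3 / (real n * (real n - 1) * (real n - 2))) \<longlonglongrightarrow> 1"
    by real_asymp
  from tendsto_mult[OF ex_turan_cube_limit this]
  have "(\<lambda>n. 6 * real (ex_turan n C5_minus) / real n ^ 3 * (real n ^ 3 / (real n * (real n - 1) * (real n - 2)))) \<longlonglongrightarrow> 1/4"
    by simp
  moreover have "\<forall>\<^sub>F n in sequentially. 6 * real (ex_turan n C5_minus) / real n ^ 3 * (real n ^ 3 / (real n * (real n - 1) * (real n - 2)))
      = real (ex_turan n C5_minus) / real (n choose 3)"
    using eventually_gt_at_top[of 0] by eventually_elim (simp add: choose_three)
  ultimately have "(\<lambda>n. real (ex_turan n C5_minus) / real (n choose 3)) \<longlonglongrightarrow> 1 / 4"
    by (rule Lim_transform_eventually)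
  then show ?thesis
    unfolding turan_density_def by (simp add: limI)
qed

end
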